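(* Let $\vec\beta$ be in the high temperature (sub-critical) phase. There exists a constant $c>0$, independent of $n$, such that for all sufficiently large $n$, for every vector $\mathbf v=(v_1,\dots,v_M)$ with nonnegative entries, every $f\in\mathrm{Lip}(\mathbf v)$ and every $t\ge0$, if $X$ has law $\mathrm{ERGM}(\vec\beta)$ on $\mathcal G_n$, then $$\mathbb P\big(|f(X)-\mathbb E f(X)|>t\big)\le 2\exp\Big(-\frac{ct^2}{\|\mathbf v\|_1\|\mathbf v\|_\infty}\Big).$$
   Context: Configurations. $\mathcal G_n$ is the set of simple graphs on vertex set $\{1,\dots,n\}$, identified with $\{0,1\}^M$, $M=n(n-1)/2$, with coordinates indexed by the edges of the complete graph $K_n$: $x=(x_e)_{e\in E(K_n)}$, $x_e=1$ iff $e$ is present. ERGM. Fix $s\ge1$, finite simple graphs $G_1,\dots,G_s$ with $|V_i|$ vertices and $|E_i|$ edges, and $\vec\beta=(\beta_1,\dots,\beta_s)$ with all $\beta_i>0$ (all independent of $n$). For a graph $G$, $N_G(x)=\sum_{\psi}\prod_{(v,w)\in E(G)}x_{(\psi(v),\psi(w))}$, the sum over all injective $\psi:V(G)\to\{1,\dots,n\}$. The Hamiltonian is $H(x)=\sum_{i=1}^s\beta_i N_{G_i}(x)/n^{|V_i|-2}$, and $\mathrm{ERGM}(\vec\beta)$ is the probability measure $\pi=\pi_n$ on $\mathcal G_n$ with $\pi(x)\propto e^{H(x)}$. High temperature phase. Let $\Phi(u)=e^u/(1+e^u)$ and, for $p>0$, $\Psi_{\vec\beta}(p)=\sum_{i=1}^s2\beta_i|E_i|p^{|E_i|-1}$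 and $\varphi_{\vec\beta}(p)=\Phi(\Psi_{\vec\beta}(p))$. $\vec\beta$ is in the high temperature (sub-critical) phase if $\varphi_{\vec\beta}(p)=p$ has a unique solution $p^*$ and $\varphi_{\vec\beta}'(p^* )<1$. Lipschitz functions. For $\mathbf v=(v_1,\dots,v_M)$ with $v_i\ge0$, $f:\mathcal G_n\to\mathbb R$ is in $\mathrm{Lip}(\mathbf v)$ if $|f(x)-f(y)|\le\sum_{i=1}^Mv_i\mathbf 1\{x_i\ne y_i\}$ for all $x,y\in\mathcal G_n$. Here $\|\mathbf v\|_1=\sum_iv_i$ and $\|\mathbf v\|_\infty=\max_iv_i$. *)

theory Defs
  imports "HOL-Probability.Probability"
begin

(* A finite simple graph: vertex set and set of edges, an edge being the set of its two ends. *)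
type_synonym 'v sgraph = "'v set \<times> 'v set set"

abbreviation verts :: "'v sgraph \<Rightarrow> 'v set" where "verts \<equiv> fst"

abbreviation edges :: "'v sgraph \<Rightarrow> 'v set set" where "edges \<equiv> snd"

definition finite_simple_graph :: "'v sgraph \<Rightarrow> bool" where
  "finite_simple_graph G \<longleftrightarrow> finite (verts G) \<and> edges G \<subseteq> {e. e \<subseteq> verts G \<and> card e = 2}"

definition complete_edges :: "nat \<Rightarrow> nat set set" where
  "complete_edges n = {e. e \<subseteq> {1..n} \<and> card e = 2}"

(* A configuration is a simple graph on {1..n}, given by its edge set x; its coordinate at an
   edge e of the complete graph is x_e = of_bool (e \<in> x). *)
definition configs :: "nat \<Rightarrow> nat set set set" where
  "configs n = Pow (complete_edges n)"

definition embedding_count :: "nat \<Rightarrow> 'v sgraph \<Rightarrow> nat set set \<Rightarrow> real" where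
  "embedding_count n G x =
     (\<Sum>\<psi> \<in> {\<psi> \<in> verts G \<rightarrow>\<^sub>E {1..n}. inj_on \<psi> (verts G)}.
        \<Prod>e\<in>edges G. of_bool (\<psi> ` e \<in> x))"

(* The exponent |V_i| - 2 is an integer, negative when G_i has fewer than two vertices. *)
definition hamiltonian ::
  "nat \<Rightarrow> (nat \<Rightarrow> 'v sgraph) \<Rightarrow> (nat \<Rightarrow> real) \<Rightarrow> nat \<Rightarrow> nat set set \<Rightarrow> real" where
  "hamiltonian s G \<beta> n x =
     (\<Sum>i=1..s. \<beta> i * embedding_count n (G i) x / real n powi (int (card (verts (G i))) - 2))"

definition partition_function ::
  "nat \<Rightarrow> (nat \<Rightarrow> 'v sgraph) \<Rightarrow> (nat \<Rightarrow> real) \<Rightarrow> nat \<Rightarrow> real" where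
  "partition_function s G \<beta> n = (\<Sum>x\<in>configs n. exp (hamiltonian s G \<beta> n x))"

definition ergm ::
  "nat \<Rightarrow> (nat \<Rightarrow> 'v sgraph) \<Rightarrow> (nat \<Rightarrow> real) \<Rightarrow> nat \<Rightarrow> nat set set measure" where
  "ergm s G \<beta> n =
     point_measure (configs n)
       (\<lambda>x. ennreal (exp (hamiltonian s G \<beta> n x) / partition_function s G \<beta> n))"

lemma finite_configs: "finite (configs n)"
proof -
  have "complete_edges n \<subseteq> Pow {1..n}"
    by (auto simp: complete_edges_def)
  then have "finite (complete_edges n)"
    by (rule finite_subset) simp
  then show ?thesis
    by (simp add: configs_def)
qed

lemma prob_space_ergm: "prob_space (ergm s G \<beta> n)"
proof
  have ne: "configs n \<noteq> {}"
    by (auto simp: configs_def)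
  have pos: "partition_function s G \<beta> n > 0"
    unfolding partition_function_def using finite_configs ne by (intro sum_pos) auto
  have "(\<Sum>x\<in>configs n. ennreal (exp (hamiltonian s G \<beta> n x) / partition_function s G \<beta> n))
      = ennreal (\<Sum>x\<in>configs n. exp (hamiltonian s G \<beta> n x) / partition_function s G \<beta> n)"
    using pos by (intro sum_ennreal) auto
  also have "\<dots> = 1"
    using pos by (simp add: partition_function_def flip: sum_divide_distrib)
  finally show "emeasure (ergm s G \<beta> n) (space (ergm s G \<beta> n)) = 1"
    unfolding ergm_def space_point_measure
    by (subst emeasure_point_measure_finite) (auto simp: finite_configs)
qed

definition Phi :: "real \<Rightarrow> real" where
  "Phi u = exp u / (1 + exp u)"

(* When G_i has no edges the i-th term is 0, so the truncated exponent is immaterial. *)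
definition Psi :: "nat \<Rightarrow> (nat \<Rightarrow> 'v sgraph) \<Rightarrow> (nat \<Rightarrow> real) \<Rightarrow> real \<Rightarrow> real" where
  "Psi s G \<beta> p =
     (\<Sum>i=1..s. 2 * \<beta> i * real (card (edges (G i))) * p ^ (card (edges (G i)) - 1))"

definition phi :: "nat \<Rightarrow> (nat \<Rightarrow> 'v sgraph) \<Rightarrow> (nat \<Rightarrow> real) \<Rightarrow> real \<Rightarrow> real" where
  "phi s G \<beta> p = Phi (Psi s G \<beta> p)"

definition high_temperature :: "nat \<Rightarrow> (nat \<Rightarrow> 'v sgraph) \<Rightarrow> (nat \<Rightarrow> real) \<Rightarrow> bool" where
  "high_temperature s G \<beta> \<longleftrightarrow>
     (\<exists>p>0. phi s G \<beta> p = p \<and> (\<forall>q>0. phi s G \<beta> q = q \<longrightarrow> q = p) \<and> deriv (phi s G \<beta>) p < 1)"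

definition Lip :: "nat \<Rightarrow> (nat set \<Rightarrow> real) \<Rightarrow> (nat set set \<Rightarrow> real) set" where
  "Lip n v = {f. \<forall>x\<in>configs n. \<forall>y\<in>configs n.
     \<bar>f x - f y\<bar> \<le> (\<Sum>e\<in>complete_edges n. v e * of_bool ((e \<in> x) \<noteq> (e \<in> y)))}"

(* For nonnegative v; norm_inf is meaningful for n \<ge> 2, when there is at least one edge. *)
definition norm_1 :: "nat \<Rightarrow> (nat set \<Rightarrow> real) \<Rightarrow> real" where
  "norm_1 n v = (\<Sum>e\<in>complete_edges n. v e)"

definition norm_inf :: "nat \<Rightarrow> (nat set \<Rightarrow> real) \<Rightarrow> real" where
  "norm_inf n v = Max (v ` complete_edges n)"

end

theory Submission
  imports Defs "HOL-Combinatorics.Permutations" "HOL-Real_Asymp.Real_Asymp"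
begin

text \<open>
  Let \<open>P\<close> be one step of the Glauber dynamics. If \<open>F\<close> solves the Poisson equation \<open>F - P F = f - E f\<close> and all its
  discrete gradients are \<open>O(M * norm_inf v)\<close>, where \<open>M\<close> is the number of edges, then by reversibility
  \<open>E (f - E f) exp (t (f - E f))\<close> is at most \<open>O(norm_1 v * norm_inf v) * t * E exp (t (f - E f))\<close>,
  and the claim follows by integration in \<open>t\<close> and Markov's inequality.

  The gradient bound comes from a weight \<open>1 \<le> W \<le> C\<close> on configurations such that the seminorm
  \<open>sup \<bar>F (x + e) - F x\<bar> / W x\<close> is contracted by the factor \<open>1 - \<delta> / M\<close>. At configurations in which all
  densities of subgraphs rooted at an edge are close to the corresponding powers of the fixed point \<open>p\<close>, the
  sum of the influences of an edge on the others is about \<open>phi' p < 1\<close> and a constant weight would do.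
  Elsewhere the influences are only bounded, but there the largest deviation \<open>\<rho>\<close> of the densities decreases:
  if \<open>p * exp \<rho>\<close> is the largest \<open>k\<close>-th root of a density with \<open>k\<close> edges, then all edges are added with
  probability at most \<open>phi (p * exp \<rho>) < p * exp \<rho>\<close>, and similarly for the smallest one. Hence a smoothed version
  of \<open>W = exp (K * \<rho>)\<close> with \<open>K\<close> large has so negative a drift that it compensates the influences.
\<close>

section \<open>Glauber dynamics and concentration\<close>

text \<open>The product \<open>norm_1 v * norm_inf v\<close> appears because the Dirichlet form
  pairs two gradients: that of \<open>exp (t * f)\<close> keeps the single \<open>v a\<close>, while
  that of \<open>F\<close> has spread over all edges and is controlled by \<open>norm_inf v\<close>
  alone; the \<open>M\<close> in its bound cancels against the choice of one edge among
  \<open>M\<close>. The price of the weight is its upper bound \<open>C\<close>, which therefore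
  must not depend on \<open>n\<close>. The densities run over all edge subsets \<open>B\<close> of
  the \<open>G i\<close> without the root edge, since the drift of a density with \<open>k\<close>
  edges involves densities with \<open>k - 1\<close> edges. Comparing \<open>k\<close>-th roots
  closes this system: where the root takes its largest value \<open>R\<close>, the drift is at most
  \<open>k * (phi R * R ^ (k - 1) - R ^ k)\<close> up to small errors, which has the sign of
  \<open>phi R - R\<close> for every \<open>k\<close>. Positive \<beta> make the rates monotone, so
  influences are nonnegative and, by double counting, their sum is governed by the derivative of
  \<open>Psi\<close>. The constants are fixed in the order \<delta>, \<theta>, \<open>r\<close>,
  \<open>c\<close>, \<open>K\<close>, \<open>h\<close>, \<tau>, and \<open>n\<close> is taken large
  only afterwards.\<close>

lemma Phi_pos: "0 < Phi u" and Phi_less_1: "Phi u < 1"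
  by (auto simp: Phi_def field_simps add_pos_pos)

text \<open>Convexity gives the larger exponential as a factor. The sum of both is kept because in
  the Dirichlet form the two terms recombine into a mean over all configurations.\<close>

lemma exp_diff_le: "\<bar>exp a - exp (b::real)\<bar> \<le> \<bar>a - b\<bar> * (exp a + exp b)"
proof -
  have *: "\<bar>exp a - exp b\<bar> \<le> \<bar>a - b\<bar> * (exp a + exp b)" if "a \<le> b" for a b :: real
  proof -
    have "1 + (a - b) \<le> exp (a - b)" by (rule exp_ge_add_one_self)
    then have "1 - exp (a - b) \<le> b - a" by linarith
    then have "exp b * (1 - exp (a - b)) \<le> exp b * (b - a)"
      by (intro mult_left_mono) auto
    then have "exp b - exp a \<le> (b - a) * exp b"
      by (simp add: right_diff_distrib mult.commute flip: exp_add)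
    also have "\<dots> \<le> (b - a) * (exp a + exp b)"
      using that by (intro mult_left_mono) auto
    finally show ?thesis using that by (simp add: abs_if)
  qed
  show ?thesis using *[of a b] *[of b a]
    by (cases "a \<le> b") (auto simp: abs_minus_commute add.commute)
qed

locale glauber =
  fixes E :: "'e set" and H :: "'e set \<Rightarrow> real"
  assumes finite_E: "finite E" and E_ne: "E \<noteq> {}"
begin

definition gibbs :: "'e set \<Rightarrow> real" where
  "gibbs x = exp (H x) / (\<Sum>y\<in>Pow E. exp (H y))"

definition mean :: "('e set \<Rightarrow> real) \<Rightarrow> real" where
  "mean F = (\<Sum>x\<in>Pow E. gibbs x * F x)"

definition rate :: "'e \<Rightarrow> 'e set \<Rightarrow> real" where
  "rate a x = Phi (H (insert a x) - H (x - {a}))"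

text \<open>Resampling the coordinate \<open>a\<close>: the conditional expectation of
  \<open>F\<close> given all other coordinates.\<close>

definition upd :: "'e \<Rightarrow> ('e set \<Rightarrow> real) \<Rightarrow> 'e set \<Rightarrow> real" where
  "upd a F x = rate a x * F (insert a x) + (1 - rate a x) * F (x - {a})"

definition step :: "('e set \<Rightarrow> real) \<Rightarrow> 'e set \<Rightarrow> real" where
  "step F x = (\<Sum>a\<in>E. upd a F x) / card E"

lemma card_E: "0 < card E"
  using finite_E E_ne by (simp add: card_gt_0_iff)

lemma partition_pos: "0 < (\<Sum>y\<in>Pow E. exp (H y))"
  using finite_E by (intro sum_pos) auto

lemma gibbs_pos: "0 < gibbs x"
  using partition_pos by (simp add: gibbs_def)

lemma sum_gibbs: "(\<Sum>x\<in>Pow E. gibbs x) = 1"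
  using partition_pos by (simp add: gibbs_def flip: sum_divide_distrib)

lemma rate_pos: "0 < rate a x" and rate_less_1: "rate a x < 1"
  by (simp_all add: rate_def Phi_pos Phi_less_1)

lemma rate_idem [simp]: "rate a (insert a x) = rate a x" "rate a (x - {a}) = rate a x"
  by (simp_all add: rate_def)

text \<open>Detailed balance: \<open>rate a x\<close> is the conditional probability that
  \<open>a\<close> is present given the rest of \<open>x\<close>.\<close>

lemma rate_gibbs:
  assumes "a \<notin> x"
  shows "rate a x * (gibbs x + gibbs (insert a x)) = gibbs (insert a x)"
proof -
  have 1: "x - {a} = x" using assms by auto
  have 2: "exp (H x) + exp (H (insert a x)) \<noteq> 0"
    by (metis add_pos_pos exp_gt_zero less_irrefl)
  have 3: "rate a x = exp (H (insert a x)) / (exp (H x) + exp (H (insert a x)))"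
    by (simp add: rate_def Phi_def 1 exp_diff field_simps)
  show ?thesis
    unfolding gibbs_def 3 using 2 by (simp flip: add_divide_distrib)
qed

lemma sum_Pow_split:
  assumes "a \<in> E"
  shows "(\<Sum>x\<in>Pow E. g x) = (\<Sum>x\<in>Pow (E - {a}). g x + g (insert a x))"
proof -
  have "Pow E = Pow (E - {a}) \<union> insert a ` Pow (E - {a})"
    using assms Pow_insert[of a "E - {a}"] by (simp add: insert_absorb)
  moreover have "inj_on (insert a) (Pow (E - {a}))"
    by (auto simp: inj_on_def)
  moreover have "Pow (E - {a}) \<inter> insert a ` Pow (E - {a}) = {}" by auto
  ultimately show ?thesis
    using finite_E by (simp add: sum.union_disjoint sum.reindex sum.distrib)
qed

text \<open>Configurations are paired along \<open>a\<close>. \<open>upd a F\<close> takes the same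
  value on both members of a pair, and by detailed balance both enter with the same weight, so only
  the product of two increments survives.\<close>

lemma dirichlet_form:
  assumes "a \<in> E"
  shows "(\<Sum>x\<in>Pow E. gibbs x * ((F x - upd a F x) * g x)) =
    (\<Sum>x\<in>Pow (E - {a}). (1 - rate a x) * gibbs (insert a x) *
       ((F (insert a x) - F x) * (g (insert a x) - g x)))"
  unfolding sum_Pow_split[OF assms]
proof (rule sum.cong[OF refl])
  fix x assume "x \<in> Pow (E - {a})"
  then have ax: "a \<notin> x" and [simp]: "x - {a} = x" by auto
  have upd: "upd a F (insert a x) = upd a F x"
    by (simp add: upd_def)
  have bal: "rate a x * gibbs x = (1 - rate a x) * gibbs (insert a x)"
    using rate_gibbs[OF ax] by (simp add: algebra_simps)
  have "gibbs x * ((F x - upd a F x) * g x) = rate a x * gibbs x * ((F x - F (insert a x)) * g x)"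
    by (simp add: upd_def algebra_simps)
  moreover have "gibbs (insert a x) * ((F (insert a x) - upd a F (insert a x)) * g (insert a x)) =
     (1 - rate a x) * gibbs (insert a x) * ((F (insert a x) - F x) * g (insert a x))"
    unfolding upd by (simp add: upd_def algebra_simps)
  ultimately show "gibbs x * ((F x - upd a F x) * g x) +
      gibbs (insert a x) * ((F (insert a x) - upd a F (insert a x)) * g (insert a x)) =
      (1 - rate a x) * gibbs (insert a x) * ((F (insert a x) - F x) * (g (insert a x) - g x))"
    unfolding bal by (simp add: algebra_simps)
qed

lemma step_diff: "F x - step F x = (\<Sum>a\<in>E. F x - upd a F x) / card E"
  using card_E by (simp add: step_def sum_subtractf field_simps)

text \<open>Stationarity: the Dirichlet form vanishes on the constant test function 1.\<close>

lemma mean_step: "mean (step F) = mean F"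
proof -
  have "mean F - mean (step F) = (\<Sum>x\<in>Pow E. gibbs x * (F x - step F x))"
    by (simp add: mean_def sum_subtractf algebra_simps)
  also have "\<dots> = (\<Sum>a\<in>E. \<Sum>x\<in>Pow E. gibbs x * ((F x - upd a F x) * 1)) / card E"
    unfolding step_diff
    by (subst sum.swap) (simp add: sum_divide_distrib sum_distrib_left)
  also have "\<dots> = 0"
    by (subst sum.cong[OF refl dirichlet_form]) auto
  finally show ?thesis by simp
qed

lemma mean_diff_const: "mean (\<lambda>x. F x - c) = mean F - c"
  by (simp add: mean_def right_diff_distrib sum_subtractf sum_gibbs flip: sum_distrib_right)

text \<open>Every configuration is reached from the empty one by at most \<open>card E\<close>
  insertions, and two configurations are compared through the empty one, hence the 2. This turns
  decay of the gradients of \<open>step\<close> powers into decay of their values.\<close>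

lemma mean_zero_bound:
  fixes F :: "'e set \<Rightarrow> real" and d :: real
  assumes "\<And>e x. e \<in> E \<Longrightarrow> x \<subseteq> E - {e} \<Longrightarrow> \<bar>F (insert e x) - F x\<bar> \<le> d"
    and "mean F = 0" "0 \<le> d" "x \<subseteq> E"
  shows "\<bar>F x\<bar> \<le> 2 * card E * d"
proof -
  have *: "\<bar>F x - F {}\<bar> \<le> card E * d" if "x \<subseteq> E" for x
  proof -
    have "finite x" using that finite_E finite_subset by blast
    then have "x \<subseteq> E \<Longrightarrow> \<bar>F x - F {}\<bar> \<le> card x * d"
    proof (induction x)
      case (insert e x)
      then have "\<bar>F (insert e x) - F x\<bar> \<le> d" "\<bar>F x - F {}\<bar> \<le> card x * d"
        using assms(1)[of e x] by auto
      then show ?case using insert by (simp add: algebra_simps)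
    qed simp
    also have "card x * d \<le> card E * d"
      using that finite_E assms(3) by (intro mult_right_mono) (auto intro: card_mono)
    finally show ?thesis using that by simp
  qed
  have "F x = (\<Sum>y\<in>Pow E. gibbs y * (F x - F y))"
    using assms(2) sum_gibbs
    by (simp add: mean_def right_diff_distrib sum_subtractf flip: sum_distrib_right)
  also have "\<bar>\<dots>\<bar> \<le> (\<Sum>y\<in>Pow E. gibbs y * (2 * card E * d))"
  proof (intro order_trans[OF sum_abs] sum_mono)
    fix y assume "y \<in> Pow E"
    then have "\<bar>F x - F y\<bar> \<le> 2 * card E * d"
      using *[of x] *[of y] assms(4) by (simp add: abs_le_iff)
    then show "\<bar>gibbs y * (F x - F y)\<bar> \<le> gibbs y * (2 * card E * d)"
      using gibbs_pos[of y] by (simp add: abs_mult)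
  qed
  also have "\<dots> = 2 * card E * d"
    by (simp add: sum_gibbs flip: sum_distrib_right)
  finally show ?thesis .
qed

text \<open>A coupling of two chains written without probability: the first two terms are the
  discrepancy at \<open>e\<close> after the same update of \<open>a\<close>, the last one corrects
  for the different update probabilities by an increment along \<open>a\<close>. The term
  \<open>a = e\<close> is absent because resampling \<open>e\<close> forgets its state.\<close>

lemma step_gradient:
  assumes e: "e \<in> E" and x: "x \<subseteq> E - {e}"
  shows "step F (insert e x) - step F x =
    (\<Sum>a\<in>E - {e}. rate a x * (F (insert e (insert a x)) - F (insert a x)) +
       (1 - rate a x) * (F (insert e (x - {a})) - F (x - {a})) +
       (rate a (insert e x) - rate a x) *
         (F (insert a (insert e x - {a})) - F (insert e x - {a}))) / card E"
proof -
  have ex: "e \<notin> x" using x by auto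
  have "upd e F (insert e x) = upd e F x" using ex by (simp add: upd_def)
  then have 1: "(\<Sum>a\<in>E. upd a F (insert e x) - upd a F x) =
      (\<Sum>a\<in>E - {e}. upd a F (insert e x) - upd a F x)"
    using e finite_E by (simp add: sum.remove)
  have 2: "upd a F (insert e x) - upd a F x =
      rate a x * (F (insert e (insert a x)) - F (insert a x)) +
       (1 - rate a x) * (F (insert e (x - {a})) - F (x - {a})) +
       (rate a (insert e x) - rate a x) *
         (F (insert a (insert e x - {a})) - F (insert e x - {a}))" if "a \<in> E - {e}" for a
  proof -
    have [simp]: "insert e x - {a} = insert e (x - {a})" using that by auto
    have [simp]: "insert a (insert e x) = insert e (insert a x)" by auto
    have [simp]: "insert a (insert e (x - {a})) = insert e (insert a x)" by auto
    show ?thesis by (simp add: upd_def algebra_simps)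
  qed
  show ?thesis
    using 1 2 by (simp add: step_def sum_subtractf flip: diff_divide_distrib)
qed

end

section \<open>Concentration from contraction in a weighted gradient seminorm\<close>

locale contracting_glauber = glauber E H for E :: "'e set" and H +
  fixes W :: "'e set \<Rightarrow> real" and \<delta> C :: real
  assumes rate_mono: "a \<in> E \<Longrightarrow> e \<in> E \<Longrightarrow> x \<subseteq> E \<Longrightarrow> rate a x \<le> rate a (insert e x)"
    and \<delta>: "0 < \<delta>" "\<delta> \<le> 1"
    and W_bounds: "x \<subseteq> E \<Longrightarrow> 1 \<le> W x" "x \<subseteq> E \<Longrightarrow> W x \<le> C"
    and W_contr: "e \<in> E \<Longrightarrow> x \<subseteq> E - {e} \<Longrightarrow>
       (\<Sum>a\<in>E - {e}. upd a W x - W x) +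
       (\<Sum>a\<in>E - {e}. (rate a (insert e x) - rate a x) * W (insert e x - {a}))
       \<le> (1 - \<delta>) * W x"
begin

lemma C_ge_1: "1 \<le> C"
  using W_bounds[of "{}"] by simp

text \<open>Of the \<open>card E\<close> equally likely updates, the one at \<open>e\<close> erases
  the discrepancy. By \<open>W_contr\<close> the others raise the weighted discrepancy by at most
  \<open>(1 - \<delta>) * W x\<close> in total, which leaves a net loss of
  \<open>\<delta> * W x / card E\<close>.\<close>

lemma gradient_contraction:
  assumes F: "\<And>e x. e \<in> E \<Longrightarrow> x \<subseteq> E - {e} \<Longrightarrow> \<bar>F (insert e x) - F x\<bar> \<le> q * W x"
    and q: "0 \<le> q" and e: "e \<in> E" and x: "x \<subseteq> E - {e}"
  shows "\<bar>step F (insert e x) - step F x\<bar> \<le> q * (1 - \<delta> / card E) * W x"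
proof -
  have bnd: "\<bar>rate a x * (F (insert e (insert a x)) - F (insert a x)) +
       (1 - rate a x) * (F (insert e (x - {a})) - F (x - {a})) +
       (rate a (insert e x) - rate a x) *
         (F (insert a (insert e x - {a})) - F (insert e x - {a}))\<bar>
      \<le> q * (upd a W x + (rate a (insert e x) - rate a x) * W (insert e x - {a}))"
    (is "\<bar>?r * ?A + ?s * ?B + ?d * ?D\<bar> \<le> _")
    if a: "a \<in> E - {e}" for a
  proof -
    have "\<bar>?r * ?A + ?s * ?B + ?d * ?D\<bar> \<le> \<bar>?r * ?A\<bar> + \<bar>?s * ?B\<bar> + \<bar>?d * ?D\<bar>" by linarith
    \<comment> \<open>Monotone rates make \<open>?d\<close> nonnegative, so the rate increments
      enter without absolute values and can later be summed exactly.\<close>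
    also have "\<dots> = ?r * \<bar>?A\<bar> + ?s * \<bar>?B\<bar> + ?d * \<bar>?D\<bar>"
      using rate_pos[of a x] rate_less_1[of a x] rate_mono[of a e x] a e subset_trans[OF x Diff_subset]
      by (simp add: abs_mult)
    also have "\<dots> \<le> ?r * (q * W (insert a x)) + ?s * (q * W (x - {a})) + ?d * (q * W (insert e x - {a}))"
      using rate_pos[of a x] rate_less_1[of a x] rate_mono[of a e x] a e x
      by (intro add_mono mult_left_mono F) auto
    also have "\<dots> = q * (upd a W x + ?d * W (insert e x - {a}))"
      by (simp add: upd_def algebra_simps)
    finally show ?thesis .
  qed
  have "\<bar>step F (insert e x) - step F x\<bar> \<le>
      (\<Sum>a\<in>E - {e}. q * (upd a W x + (rate a (insert e x) - rate a x) * W (insert e x - {a}))) / card E"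
    unfolding step_gradient[OF e x] abs_divide
    using sum_mono[of "E - {e}", OF bnd] order_trans[OF sum_abs] card_E
    by (fastforce intro!: divide_right_mono)
  also have "(\<Sum>a\<in>E - {e}. q * (upd a W x + (rate a (insert e x) - rate a x) * W (insert e x - {a})))
      = q * ((\<Sum>a\<in>E - {e}. upd a W x - W x) +
       (\<Sum>a\<in>E - {e}. (rate a (insert e x) - rate a x) * W (insert e x - {a})) + (card E - 1) * W x)"
    using e card_E finite_E by (simp add: sum_subtractf sum.distrib of_nat_diff Suc_leI flip: sum_distrib_left)
  also have "\<dots> \<le> q * ((1 - \<delta>) * W x + (card E - 1) * W x)"
    using W_contr[OF e x] q by (intro mult_left_mono) auto
  also have "\<dots> / card E = q * (1 - \<delta> / card E) * W x"
    using card_E by (simp add: field_simps of_nat_diff Suc_leI)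
  finally show ?thesis using card_E by (simp add: divide_right_mono)
qed

context
  fixes f :: "'e set \<Rightarrow> real" and v :: "'e \<Rightarrow> real" and vmax :: real
  assumes lip: "\<And>e x. e \<in> E \<Longrightarrow> x \<subseteq> E - {e} \<Longrightarrow> \<bar>f (insert e x) - f x\<bar> \<le> v e"
    and v: "\<And>e. e \<in> E \<Longrightarrow> v e \<le> vmax"
    and centred: "mean f = 0"
begin

lemma v_nonneg: "e \<in> E \<Longrightarrow> 0 \<le> v e"
  using lip[of e "{}"] by (auto intro: order_trans[OF abs_ge_zero])

lemma vmax_nonneg: "0 \<le> vmax"
  using E_ne v v_nonneg by (meson ex_in_conv order_trans)

lemma step_power_gradient:
  "e \<in> E \<Longrightarrow> x \<subseteq> E - {e} \<Longrightarrow>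
    \<bar>(step ^^ k) f (insert e x) - (step ^^ k) f x\<bar> \<le> vmax * (1 - \<delta> / card E) ^ k * W x"
proof (induction k arbitrary: e x)
  case 0
  \<comment> \<open>The lower bound 1 on \<open>W\<close> is what lets a plain Lipschitz bound start
    the weighted induction; the upper bound \<open>C\<close> serves for the way back.\<close>
  have "vmax * 1 \<le> vmax * W x"
    using W_bounds(1)[of x] 0 vmax_nonneg by (intro mult_left_mono) auto
  then show ?case using lip[of e x] v[of e] 0 by simp
next
  case (Suc k)
  have "0 \<le> 1 - \<delta> / card E"
    using \<delta> card_E by (simp add: field_simps)
  then show ?case
    using gradient_contraction[of "(step ^^ k) f" "vmax * (1 - \<delta> / card E) ^ k" e x] Suc vmax_nonneg
    by (simp add: mult_ac)
qed

lemma mean_step_power: "mean ((step ^^ k) f) = 0"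
  by (induction k) (simp_all add: mean_step centred)

lemma step_power_tendsto_0:
  "(\<lambda>k. 2 * card E * (vmax * (1 - \<delta> / card E) ^ k * C)) \<longlonglongrightarrow> 0"
proof -
  have "\<bar>1 - \<delta> / card E\<bar> < 1"
    using \<delta> card_E by (simp add: field_simps abs_if)
  then have "(\<lambda>k. (1 - \<delta> / card E) ^ k) \<longlonglongrightarrow> 0"
    by (intro LIMSEQ_power_zero) simp
  then have "(\<lambda>k. 2 * card E * (vmax * (1 - \<delta> / card E) ^ k * C)) \<longlonglongrightarrow> 2 * card E * (vmax * 0 * C)"
    by (intro tendsto_mult tendsto_const)
  then show ?thesis by simp
qed

lemma step_power_bound:
  assumes "x \<subseteq> E"
  shows "\<bar>(step ^^ k) f x\<bar> \<le> 2 * card E * (vmax * (1 - \<delta> / card E) ^ k * C)"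
proof (rule mean_zero_bound)
  show "mean ((step ^^ k) f) = 0" "x \<subseteq> E" using mean_step_power assms by auto
  have ge: "0 \<le> 1 - \<delta> / card E"
    using \<delta> card_E by (simp add: field_simps)
  show "0 \<le> vmax * (1 - \<delta> / card E) ^ k * C"
    using ge vmax_nonneg C_ge_1 by simp
  fix e x assume ex: "e \<in> E" "x \<subseteq> E - {e}"
  have "vmax * (1 - \<delta> / card E) ^ k * W x \<le> vmax * (1 - \<delta> / card E) ^ k * C"
    using ge vmax_nonneg ex by (intro mult_left_mono W_bounds) auto
  then show "\<bar>(step ^^ k) f (insert e x) - (step ^^ k) f x\<bar> \<le> vmax * (1 - \<delta> / card E) ^ k * C"
    using step_power_gradient[OF ex, of k] by linarith
qed

text \<open>
  Chatterjee's argument with the truncated Poisson solution \<open>F = (\<Sum>k<T. step\<^sup>k f)\<close> and \<open>T\<close> tending to infinity.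
\<close>

lemma mean_times_exp_bound:
  assumes "0 \<le> \<theta>"
  shows "mean (\<lambda>x. f x * exp (\<theta> * f x)) \<le>
    C / \<delta> * vmax * (\<Sum>e\<in>E. v e) * \<theta> * mean (\<lambda>x. exp (\<theta> * f x))"
proof -
  define \<rho> where "\<rho> = 1 - \<delta> / card E"
  have \<rho>: "0 \<le> \<rho>" "\<rho> < 1" "1 - \<rho> = \<delta> / card E"
    using \<delta> card_E by (auto simp: \<rho>_def field_simps)
  define g where "g x = exp (\<theta> * f x)" for x
  \<comment> \<open>The gradients of the summands of \<open>F\<close> form a geometric series of
    ratio \<rho>, and \<open>1 / (1 - \<rho>) = card E / \<delta>\<close>; \<open>C\<close> replaces
    the weight.\<close>
  define D where "D = vmax * C * card E / \<delta>"
  define S where "S = (\<Sum>e\<in>E. v e)"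
  have main: "mean (\<lambda>x. f x * g x) \<le> D / card E * S * \<theta> * mean g
      + 2 * card E * (vmax * \<rho> ^ T * C) * mean g" for T
  proof -
    define F where "F x = (\<Sum>k<T. (step ^^ k) f x)" for x
    have gradF: "\<bar>F (insert e x) - F x\<bar> \<le> D" if "e \<in> E" "x \<subseteq> E - {e}" for e x
    proof -
      have "\<bar>F (insert e x) - F x\<bar> \<le> (\<Sum>k<T. vmax * \<rho> ^ k * W x)"
        unfolding F_def sum_subtractf[symmetric] \<rho>_def
        by (rule order_trans[OF sum_abs sum_mono]) (rule step_power_gradient[OF that])
      also have "\<dots> \<le> (\<Sum>k<T. vmax * C * \<rho> ^ k)"
      proof (intro sum_mono)
        fix k
        have "vmax * \<rho> ^ k * W x \<le> vmax * \<rho> ^ k * C"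
          using that \<rho> vmax_nonneg by (intro mult_left_mono W_bounds) auto
        then show "vmax * \<rho> ^ k * W x \<le> vmax * C * \<rho> ^ k" by (simp add: mult_ac)
      qed
      also have "\<dots> = vmax * C * (\<Sum>k<T. \<rho> ^ k)" by (simp add: sum_distrib_left)
      also have "(\<Sum>k<T. \<rho> ^ k) = (1 - \<rho> ^ T) / (1 - \<rho>)"
        using \<rho> by (simp add: sum_gp_strict)
      also have "\<dots> \<le> 1 / (1 - \<rho>)"
        using \<rho> by (intro divide_right_mono) auto
      finally show ?thesis
        using vmax_nonneg C_ge_1 by (simp add: D_def \<rho>(3) mult_left_mono)
    qed
    have upd_F: "step F x = (\<Sum>k<T. (step ^^ Suc k) f x)" for x
      unfolding F_def step_def upd_def
      by (simp add: sum_distrib_left sum_divide_distrib[symmetric] sum.swap[of _ E] step_def upd_def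
        flip: sum.distrib)
    have "F x - step F x = f x - (step ^^ T) f x" for x
      unfolding upd_F unfolding F_def sum_subtractf[symmetric]
      by (subst sum_lessThan_telescope') simp
    then have fx: "f x = (F x - step F x) + (step ^^ T) f x" for x by (simp add: algebra_simps)
    have "mean (\<lambda>x. f x * g x) = mean (\<lambda>x. (F x - step F x) * g x) + mean (\<lambda>x. (step ^^ T) f x * g x)"
      by (subst fx) (simp add: mean_def algebra_simps sum.distrib sum_subtractf)
    moreover have "mean (\<lambda>x. (step ^^ T) f x * g x) \<le> 2 * card E * (vmax * \<rho> ^ T * C) * mean g"
      unfolding mean_def sum_distrib_left
    proof (intro sum_mono)
      fix x assume "x \<in> Pow E"
      then have "(step ^^ T) f x \<le> 2 * card E * (vmax * \<rho> ^ T * C)"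
        using step_power_bound[of x T] by (simp add: \<rho>_def)
      then have "(step ^^ T) f x * (gibbs x * g x) \<le> 2 * card E * (vmax * \<rho> ^ T * C) * (gibbs x * g x)"
        using gibbs_pos[of x] by (intro mult_right_mono) (auto simp: g_def)
      then show "gibbs x * ((step ^^ T) f x * g x) \<le> 2 * card E * (vmax * \<rho> ^ T * C) * (gibbs x * g x)"
        by (simp add: mult_ac)
    qed
    moreover have "mean (\<lambda>x. (F x - step F x) * g x) \<le> D / card E * S * \<theta> * mean g"
    proof -
      have one: "(\<Sum>x\<in>Pow E. gibbs x * ((F x - upd a F x) * g x)) \<le> D * \<theta> * v a * mean g" if a: "a \<in> E" for a
      proof -
        have "(\<Sum>x\<in>Pow E. gibbs x * ((F x - upd a F x) * g x)) \<le>
            (\<Sum>x\<in>Pow (E - {a}). D * \<theta> * v a * (gibbs x * g x + gibbs (insert a x) * g (insert a x)))"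
          unfolding dirichlet_form[OF a]
        proof (intro sum_mono)
          fix x assume "x \<in> Pow (E - {a})"
          then have x: "x \<subseteq> E - {a}" "a \<notin> x" by auto
          let ?w = "(1 - rate a x) * gibbs (insert a x)"
          have bal: "?w = rate a x * gibbs x"
            using rate_gibbs[OF x(2)] by (simp add: algebra_simps)
          \<comment> \<open>The weight is below both Gibbs weights, so each value of
            \<open>g\<close> can be matched with the Gibbs weight of its own configuration and the
            sum becomes \<open>mean g\<close>.\<close>
          have w: "0 \<le> ?w" "?w \<le> gibbs (insert a x)" "?w \<le> gibbs x"
            using rate_pos[of a x] rate_less_1[of a x] gibbs_pos[of x] gibbs_pos[of "insert a x"]
            by (simp, simp add: algebra_simps, unfold bal, simp)
          have "\<bar>\<theta> * f (insert a x) - \<theta> * f x\<bar> \<le> \<theta> * v a"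
            using lip[OF a x(1)] assms by (simp add: abs_mult mult_left_mono flip: right_diff_distrib)
          then have "\<bar>g (insert a x) - g x\<bar> \<le> \<theta> * v a * (g (insert a x) + g x)"
            unfolding g_def by (intro order_trans[OF exp_diff_le] mult_right_mono) (auto simp: add_nonneg_nonneg)
          then have "\<bar>(F (insert a x) - F x) * (g (insert a x) - g x)\<bar> \<le> D * (\<theta> * v a * (g (insert a x) + g x))"
            unfolding abs_mult using gradF[OF a x(1)] by (intro mult_mono) auto
          then have "?w * ((F (insert a x) - F x) * (g (insert a x) - g x)) \<le> ?w * (D * (\<theta> * v a * (g (insert a x) + g x)))"
            using w(1) by (intro mult_left_mono) auto
          also have "\<dots> = D * \<theta> * v a * (?w * g x + ?w * g (insert a x))"
            by (simp add: algebra_simps)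
          also have "\<dots> \<le> D * \<theta> * v a * (gibbs x * g x + gibbs (insert a x) * g (insert a x))"
            using w \<delta> assms v_nonneg[OF a] vmax_nonneg C_ge_1
            by (intro mult_left_mono add_mono mult_right_mono) (auto simp: g_def D_def)
          finally show "?w * ((F (insert a x) - F x) * (g (insert a x) - g x)) \<le> \<dots>" .
        qed
        also have "\<dots> = D * \<theta> * v a * mean g"
          by (simp add: mean_def sum_Pow_split[OF a] sum_distrib_left)
        finally show ?thesis .
      qed
      have "mean (\<lambda>x. (F x - step F x) * g x) =
          (\<Sum>a\<in>E. \<Sum>x\<in>Pow E. gibbs x * ((F x - upd a F x) * g x)) / card E"
        unfolding step_diff mean_def
        by (subst sum.swap) (simp add: sum_divide_distrib sum_distrib_left sum_distrib_right)
      also have "\<dots> \<le> (\<Sum>a\<in>E. D * \<theta> * v a * mean g) / card E"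
        by (intro divide_right_mono sum_mono one) auto
      also have "\<dots> = D / card E * S * \<theta> * mean g"
        by (simp add: S_def sum_distrib_left sum_distrib_right mult_ac)
      finally show ?thesis .
    qed
    ultimately show ?thesis by linarith
  qed
  have "(\<lambda>T. D / card E * S * \<theta> * mean g + 2 * card E * (vmax * \<rho> ^ T * C) * mean g)
      \<longlonglongrightarrow> D / card E * S * \<theta> * mean g + 0 * mean g"
    using step_power_tendsto_0 unfolding \<rho>_def by (intro tendsto_intros)
  then have "mean (\<lambda>x. f x * g x) \<le> D / card E * S * \<theta> * mean g + 0 * mean g"
    by (rule LIMSEQ_le_const) (use main in auto)
  then show ?thesis
    using card_E by (simp add: D_def S_def g_def[abs_def] mult_ac)
qed

text \<open>The preceding bound reads \<open>m' \<le> B * t * m\<close> for the moment generating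
  function \<open>m\<close>, so \<open>m t * exp (- B * t\<^sup>2 / 2)\<close> is nonincreasing for
  nonnegative \<open>t\<close>, and it equals 1 at 0.\<close>

lemma mgf_bound:
  assumes "0 \<le> \<theta>"
  shows "mean (\<lambda>x. exp (\<theta> * f x)) \<le> exp (C / \<delta> * vmax * (\<Sum>e\<in>E. v e) * \<theta>\<^sup>2 / 2)"
proof -
  define B where "B = C / \<delta> * vmax * (\<Sum>e\<in>E. v e)"
  define m where "m \<theta> = mean (\<lambda>x. exp (\<theta> * f x))" for \<theta>
  have m': "(m has_real_derivative mean (\<lambda>x. f x * exp (\<theta> * f x))) (at \<theta>)" for \<theta>
    unfolding m_def mean_def by (auto intro!: derivative_eq_intros sum.cong)
  have "m \<theta> * exp (- B * \<theta>\<^sup>2 / 2) \<le> m 0 * exp (- B * 0\<^sup>2 / 2)"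
  proof (rule DERIV_nonpos_imp_nonincreasing[OF assms])
    fix t :: real assume t: "0 \<le> t" "t \<le> \<theta>"
    have "((\<lambda>t. m t * exp (- B * t\<^sup>2 / 2)) has_real_derivative
       (mean (\<lambda>x. f x * exp (t * f x)) - B * t * m t) * exp (- B * t\<^sup>2 / 2)) (at t)"
      by (auto intro!: derivative_eq_intros m' simp: algebra_simps)
    moreover have "(mean (\<lambda>x. f x * exp (t * f x)) - B * t * m t) * exp (- B * t\<^sup>2 / 2) \<le> 0"
      using mean_times_exp_bound[OF t(1)] by (intro mult_nonpos_nonneg) (auto simp: B_def m_def)
    ultimately show "\<exists>y. ((\<lambda>t. m t * exp (- B * t\<^sup>2 / 2)) has_real_derivative y) (at t) \<and> y \<le> 0"
      by blast
  qed
  moreover have "m 0 = 1" by (simp add: m_def mean_def sum_gibbs)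
  ultimately show ?thesis
    by (simp add: m_def B_def exp_minus field_simps)
qed

lemma upper_tail:
  assumes "0 \<le> t" and B: "0 < vmax * (\<Sum>e\<in>E. v e)"
  shows "(\<Sum>x | x \<subseteq> E \<and> t < f x. gibbs x) \<le> exp (- (\<delta> / (2 * C) * t\<^sup>2 / (vmax * (\<Sum>e\<in>E. v e))))"
proof -
  define B where "B = C / \<delta> * vmax * (\<Sum>e\<in>E. v e)"
  have Bpos: "0 < B" using B C_ge_1 \<delta> by (simp add: B_def mult.assoc)
  \<comment> \<open>This minimises \<open>- \<theta> * t + B * \<theta>\<^sup>2 / 2\<close>, with
    value \<open>- t\<^sup>2 / (2 * B)\<close>; the final constant \<open>\<delta> / (2 * C)\<close>
    originates here.\<close>
  define \<theta> where "\<theta> = t / B"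
  have \<theta>: "0 \<le> \<theta>" using assms Bpos by (simp add: \<theta>_def)
  have "(\<Sum>x | x \<subseteq> E \<and> t < f x. gibbs x) \<le> (\<Sum>x | x \<subseteq> E \<and> t < f x. exp (- \<theta> * t) * (gibbs x * exp (\<theta> * f x)))"
  proof (intro sum_mono)
    fix x assume "x \<in> {x. x \<subseteq> E \<and> t < f x}"
    then have "\<theta> * t \<le> \<theta> * f x" using \<theta> by (intro mult_left_mono) auto
    then have "1 \<le> exp (- \<theta> * t) * exp (\<theta> * f x)" by (simp flip: exp_add)
    then show "gibbs x \<le> exp (- \<theta> * t) * (gibbs x * exp (\<theta> * f x))"
      using mult_left_mono[of 1 "exp (- \<theta> * t) * exp (\<theta> * f x)" "gibbs x"] gibbs_pos[of x] by (simp add: mult_ac)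
  qed
  also have "\<dots> \<le> (\<Sum>x\<in>Pow E. exp (- \<theta> * t) * (gibbs x * exp (\<theta> * f x)))"
    using finite_E gibbs_pos by (intro sum_mono2) (auto intro: less_imp_le)
  also have "\<dots> = exp (- \<theta> * t) * mean (\<lambda>x. exp (\<theta> * f x))"
    by (simp add: mean_def sum_distrib_left)
  also have "\<dots> \<le> exp (- \<theta> * t) * exp (B * \<theta>\<^sup>2 / 2)"
    using mgf_bound[OF \<theta>] by (simp add: B_def)
  also have "\<dots> = exp (- (t\<^sup>2 / (2 * B)))"
    using Bpos by (simp add: \<theta>_def field_simps power2_eq_square flip: exp_add)
  also have "t\<^sup>2 / (2 * B) = \<delta> / (2 * C) * t\<^sup>2 / (vmax * (\<Sum>e\<in>E. v e))"
    by (simp add: B_def mult_ac)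
  finally show ?thesis .
qed

end

lemma concentration:
  assumes lip: "\<And>e x. e \<in> E \<Longrightarrow> x \<subseteq> E - {e} \<Longrightarrow> \<bar>f (insert e x) - f x\<bar> \<le> v e"
    and v: "\<And>e. e \<in> E \<Longrightarrow> v e \<le> vmax"
    and "0 \<le> t" and B: "0 < vmax * (\<Sum>e\<in>E. v e)"
  shows "(\<Sum>x | x \<subseteq> E \<and> t < \<bar>f x - mean f\<bar>. gibbs x)
    \<le> 2 * exp (- (\<delta> / (2 * C) * t\<^sup>2 / (vmax * (\<Sum>e\<in>E. v e))))"
proof -
  have *: "mean (\<lambda>x. mean f - f x) = 0"
    by (simp add: mean_def right_diff_distrib sum_subtractf sum_gibbs flip: sum_distrib_right)
  have "(\<Sum>x | x \<subseteq> E \<and> t < \<bar>f x - mean f\<bar>. gibbs x) \<le>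
      (\<Sum>x\<in>{x. x \<subseteq> E \<and> t < f x - mean f} \<union> {x. x \<subseteq> E \<and> t < mean f - f x}. gibbs x)"
    using finite_E gibbs_pos by (intro sum_mono2) (auto intro: less_imp_le)
  also have "\<dots> \<le> (\<Sum>x | x \<subseteq> E \<and> t < f x - mean f. gibbs x) + (\<Sum>x | x \<subseteq> E \<and> t < mean f - f x. gibbs x)"
    using finite_E by (subst sum_Un) (auto intro!: sum_nonneg less_imp_le[OF gibbs_pos])
  also have "\<dots> \<le> exp (- (\<delta> / (2 * C) * t\<^sup>2 / (vmax * (\<Sum>e\<in>E. v e)))) + exp (- (\<delta> / (2 * C) * t\<^sup>2 / (vmax * (\<Sum>e\<in>E. v e))))"
    by (intro add_mono upper_tail assms)
       (use lip * in \<open>auto simp: mean_diff_const abs_minus_commute\<close>)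
  finally show ?thesis by simp
qed

end

section \<open>Densities of rooted graphs\<close>

lemma finite_complete_edges [simp]: "finite (complete_edges n)"
  using finite_configs[of n] by (simp add: configs_def)

lemma card_complete_edges: "card (complete_edges n) = n choose 2"
  unfolding complete_edges_def using n_subsets[of "{1..n}" 2] by simp

definition injs :: "'v set \<Rightarrow> nat \<Rightarrow> ('v \<Rightarrow> nat) set" where
  "injs V n = {\<psi> \<in> V \<rightarrow>\<^sub>E {1..n}. inj_on \<psi> V}"

text \<open>The root is matched as an unordered pair, so both orientations of \<open>e\<close> are
  counted. This is the origin of the factor 2 in \<open>card_rooted\<close>, and of the one in
  \<open>Psi\<close>.\<close>

definition rooted :: "'v set \<Rightarrow> nat \<Rightarrow> 'v set \<Rightarrow> nat set \<Rightarrow> ('v \<Rightarrow> nat) set" where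
  "rooted V n \<alpha> e = {\<psi> \<in> injs V n. \<psi> ` \<alpha> = e}"

text \<open>
  Absent edges get a small weight \<open>\<tau>\<close>, so that densities stay bounded away from \<open>0\<close> and their logarithms are
  smooth; \<open>\<tau> = 0\<close> gives the actual densities.
\<close>

definition wt :: "real \<Rightarrow> 'e set \<Rightarrow> 'e \<Rightarrow> real" where
  "wt \<tau> x e = (if e \<in> x then 1 else \<tau>)"

definition dens :: "'v set \<Rightarrow> nat \<Rightarrow> 'v set \<Rightarrow> 'v set set \<Rightarrow> real \<Rightarrow> nat set set \<Rightarrow> nat set \<Rightarrow> real" where
  "dens V n \<alpha> B \<tau> x e =
     (\<Sum>\<psi>\<in>rooted V n \<alpha> e. \<Prod>b\<in>B. wt \<tau> x (\<psi> ` b)) / card (rooted V n \<alpha> e)"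

text \<open>The partial derivative of \<open>dens\<close> with respect to the weight of \<open>a\<close>.\<close>

definition pder ::
  "'v set \<Rightarrow> nat \<Rightarrow> 'v set \<Rightarrow> 'v set set \<Rightarrow> real \<Rightarrow> nat set set \<Rightarrow> nat set \<Rightarrow> nat set \<Rightarrow> real" where
  "pder V n \<alpha> B \<tau> x e a =
     (\<Sum>\<psi>\<in>rooted V n \<alpha> e. \<Sum>b\<in>{b\<in>B. \<psi> ` b = a}. \<Prod>c\<in>B - {b}. wt \<tau> x (\<psi> ` c))
       / card (rooted V n \<alpha> e)"

lemma wt_bounds: "0 \<le> \<tau> \<Longrightarrow> \<tau> \<le> 1 \<Longrightarrow> \<tau> \<le> wt \<tau> x e" "\<tau> \<le> 1 \<Longrightarrow> wt \<tau> x e \<le> 1"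
  "0 \<le> \<tau> \<Longrightarrow> 0 \<le> wt \<tau> x e"
  by (auto simp: wt_def)

lemma finite_injs: "finite V \<Longrightarrow> finite (injs V n)"
  unfolding injs_def by (simp add: finite_PiE)

lemma finite_rooted: "finite V \<Longrightarrow> finite (rooted V n \<alpha> e)"
  unfolding rooted_def by (simp add: finite_injs)

lemma card_injs: "finite V \<Longrightarrow> card (injs V n) = (\<Prod>j<card V. n - j)"
  unfolding injs_def
  by (subst card_inj_on_subset_funcset) (auto simp: atLeast0LessThan)

lemma image_complete_edges:
  assumes "\<psi> \<in> injs V n" "b \<subseteq> V" "card b = 2"
  shows "\<psi> ` b \<in> complete_edges n"
proof -
  have "card (\<psi> ` b) = 2"
    using assms by (subst card_image) (auto simp: injs_def intro: inj_on_subset)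
  then show ?thesis using assms by (auto simp: complete_edges_def injs_def)
qed

lemma inj_image_edges:
  assumes "\<psi> \<in> injs V n" "b \<subseteq> V" "c \<subseteq> V" "\<psi> ` b = \<psi> ` c"
  shows "b = c"
  using assms inj_on_image_eq_iff[of \<psi> V b c] by (auto simp: injs_def)

text \<open>An injective map sends at most one edge to \<open>a\<close>, so the product is affine in
  the weight of \<open>a\<close>, and the inner sum, its slope, has at most one term.\<close>

lemma prod_wt_flip:
  assumes flip: "\<And>b. b \<noteq> a \<Longrightarrow> b \<in> y \<longleftrightarrow> b \<in> x"
    and \<psi>: "\<psi> \<in> injs V n" and B: "finite B" "B \<subseteq> Pow V"
  shows "(\<Prod>b\<in>B. wt \<tau> y (\<psi> ` b)) = (\<Prod>b\<in>B. wt \<tau> x (\<psi> ` b)) +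
      (wt \<tau> y a - wt \<tau> x a) * (\<Sum>b\<in>{b\<in>B. \<psi> ` b = a}. \<Prod>c\<in>B - {b}. wt \<tau> x (\<psi> ` c))"
proof -
  have w: "wt \<tau> y b = wt \<tau> x b" if "b \<noteq> a" for b
    using flip[OF that] by (simp add: wt_def)
  show ?thesis
  proof (cases "\<exists>b\<in>B. \<psi> ` b = a")
    case False
    then have "{b \<in> B. \<psi> ` b = a} = {}" by auto
    moreover have "(\<Prod>b\<in>B. wt \<tau> y (\<psi> ` b)) = (\<Prod>b\<in>B. wt \<tau> x (\<psi> ` b))"
      using False by (intro prod.cong refl w) blast
    ultimately show ?thesis by (simp only: sum.empty mult_zero_right add_0_right)
  next
    case True
    then obtain b where b: "b \<in> B" "\<psi> ` b = a" by blast
    have uniq: "c = b" if "c \<in> B" "\<psi> ` c = a" for c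
    proof (rule inj_image_edges)
      show "\<psi> \<in> injs V n" by (rule \<psi>)
      show "c \<subseteq> V" "b \<subseteq> V" using that(1) b(1) B(2) by blast+
      show "\<psi> ` c = \<psi> ` b" using that(2) b(2) by simp
    qed
    have "{b \<in> B. \<psi> ` b = a} = {b}" using b uniq by blast
    moreover have "(\<Prod>c\<in>B - {b}. wt \<tau> y (\<psi> ` c)) = (\<Prod>c\<in>B - {b}. wt \<tau> x (\<psi> ` c))"
      using uniq by (intro prod.cong refl w) blast
    moreover have "(\<Prod>c\<in>B. wt \<tau> z (\<psi> ` c)) = wt \<tau> z a * (\<Prod>c\<in>B - {b}. wt \<tau> z (\<psi> ` c))" for z
      using prod.remove[OF B(1) b(1), of "\<lambda>c. wt \<tau> z (\<psi> ` c)"] b(2) by simp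
    ultimately show ?thesis
      by (simp add: left_diff_distrib)
  qed
qed

text \<open>Relabelling of the vertices of the complete graph; \<open>restrict\<close> keeps the
  maps extensional. As permutations act transitively on edges, counts of rooted maps do not depend
  on the root.\<close>

lemma bij_betw_rooted:
  assumes "\<sigma> permutes {1..n}" "\<alpha> \<subseteq> V"
  shows "bij_betw (\<lambda>\<psi>. restrict (\<sigma> \<circ> \<psi>) V) (rooted V n \<alpha> e) (rooted V n \<alpha> (\<sigma> ` e))"
proof -
  have *: "(\<lambda>\<psi>. restrict (\<sigma> \<circ> \<psi>) V) ` rooted V n \<alpha> e \<subseteq> rooted V n \<alpha> (\<sigma> ` e)"
    if \<sigma>: "\<sigma> permutes {1..n}" for \<sigma> :: "nat \<Rightarrow> nat" and e
  proof clarify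
    fix \<psi> assume \<psi>: "\<psi> \<in> rooted V n \<alpha> e"
    have "restrict (\<sigma> \<circ> \<psi>) V ` \<alpha> = \<sigma> ` e"
      using \<psi> assms(2) by (auto simp: rooted_def image_comp subset_eq)
    moreover have "inj_on (restrict (\<sigma> \<circ> \<psi>) V) V"
      using \<psi> permutes_inj[OF \<sigma>] by (auto simp: rooted_def injs_def inj_on_def dest: injD)
    moreover have "restrict (\<sigma> \<circ> \<psi>) V \<in> V \<rightarrow>\<^sub>E {1..n}"
      using \<psi> permutes_in_image[OF \<sigma>] by (auto simp: rooted_def injs_def PiE_iff simp del: atLeastAtMost_iff)
    ultimately show "restrict (\<sigma> \<circ> \<psi>) V \<in> rooted V n \<alpha> (\<sigma> ` e)"
      by (simp add: rooted_def injs_def)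
  qed
  have inv: "inv \<sigma> permutes {1..n}" using assms(1) by (rule permutes_inv)
  have ext: "\<psi> \<in> rooted V n \<alpha> e \<Longrightarrow> restrict \<psi> V = \<psi>" for \<psi> e
    by (auto simp: rooted_def injs_def)
  show ?thesis
  proof (rule bij_betw_byWitness[where f' = "\<lambda>\<psi>. restrict (inv \<sigma> \<circ> \<psi>) V"])
    show "\<forall>\<psi>\<in>rooted V n \<alpha> e. restrict (inv \<sigma> \<circ> restrict (\<sigma> \<circ> \<psi>) V) V = \<psi>"
    proof
      fix \<psi> assume "\<psi> \<in> rooted V n \<alpha> e"
      then have "restrict \<psi> V = \<psi>" by (rule ext)
      moreover have "restrict (inv \<sigma> \<circ> restrict (\<sigma> \<circ> \<psi>) V) V = restrict \<psi> V"
        using permutes_inverses[OF assms(1)] by (auto simp: restrict_def)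
      ultimately show "restrict (inv \<sigma> \<circ> restrict (\<sigma> \<circ> \<psi>) V) V = \<psi>" by simp
    qed
    show "\<forall>\<psi>\<in>rooted V n \<alpha> (\<sigma> ` e). restrict (\<sigma> \<circ> restrict (inv \<sigma> \<circ> \<psi>) V) V = \<psi>"
    proof
      fix \<psi> assume "\<psi> \<in> rooted V n \<alpha> (\<sigma> ` e)"
      then have "restrict \<psi> V = \<psi>" by (rule ext)
      moreover have "restrict (\<sigma> \<circ> restrict (inv \<sigma> \<circ> \<psi>) V) V = restrict \<psi> V"
        using permutes_inverses[OF assms(1)] by (auto simp: restrict_def)
      ultimately show "restrict (\<sigma> \<circ> restrict (inv \<sigma> \<circ> \<psi>) V) V = \<psi>" by simp
    qed
    show "(\<lambda>\<psi>. restrict (\<sigma> \<circ> \<psi>) V) ` rooted V n \<alpha> e \<subseteq> rooted V n \<alpha> (\<sigma> ` e)"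
      by (rule *[OF assms(1)])
    have "inv \<sigma> ` \<sigma> ` e = e"
      using permutes_inverses[OF assms(1)] by (auto simp: image_iff)
    then show "(\<lambda>\<psi>. restrict (inv \<sigma> \<circ> \<psi>) V) ` rooted V n \<alpha> (\<sigma> ` e) \<subseteq> rooted V n \<alpha> e"
      using *[OF inv, of "\<sigma> ` e"] by simp
  qed
qed

lemma edge_transitive:
  assumes "e \<in> complete_edges n" "e' \<in> complete_edges n"
  obtains \<sigma> where "\<sigma> permutes {1..n}" "\<sigma> ` e = e'"
proof -
  obtain a b where e: "e = {a, b}" "a \<noteq> b" "a \<in> {1..n}" "b \<in> {1..n}"
    using assms(1) by (auto simp: complete_edges_def card_2_iff)
  obtain c d where e': "e' = {c, d}" "c \<noteq> d" "c \<in> {1..n}" "d \<in> {1..n}"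
    using assms(2) by (auto simp: complete_edges_def card_2_iff)
  \<comment> \<open>The first transposition sends \<open>a\<close> to \<open>c\<close> and
    \<open>b\<close> to \<open>b'\<close>; the second then sends \<open>b'\<close> to
    \<open>d\<close> and fixes \<open>c\<close>, because \<open>c\<close> differs from both.\<close>
  define b' where "b' = Transposition.transpose a c b"
  have b': "b' \<in> {1..n}" "b' \<noteq> c"
    using e e' by (auto simp: b'_def Transposition.transpose_def)
  show ?thesis
  proof (rule that)
    show "(Transposition.transpose b' d \<circ> Transposition.transpose a c) permutes {1..n}"
      using e e' b' by (intro permutes_compose permutes_swap_id) auto
    show "(Transposition.transpose b' d \<circ> Transposition.transpose a c) ` e = e'"
    proof -
      have "Transposition.transpose b' d c = c"
        using e' b'(2) by (simp add: Transposition.transpose_def)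
      then show ?thesis by (simp add: e(1) e'(1) flip: b'_def)
    qed
  qed
qed

lemma card_rooted_eq:
  assumes "e \<in> complete_edges n" "e' \<in> complete_edges n" "\<alpha> \<subseteq> V"
  shows "card (rooted V n \<alpha> e) = card (rooted V n \<alpha> e')"
proof -
  obtain \<sigma> where \<sigma>: "\<sigma> permutes {1..n}" "\<sigma> ` e = e'"
    using edge_transitive[OF assms(1,2)] by blast
  show ?thesis
    using bij_betw_same_card[OF bij_betw_rooted[OF \<sigma>(1) assms(3), of e]] \<sigma>(2) by simp
qed

lemma sum_rooted:
  assumes "finite V" "\<alpha> \<subseteq> V" "card \<alpha> = 2"
  shows "(\<Sum>e\<in>complete_edges n. \<Sum>\<psi>\<in>rooted V n \<alpha> e. g \<psi>) = (\<Sum>\<psi>\<in>injs V n. g \<psi>)"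
proof -
  have "(\<lambda>\<psi>. \<psi> ` \<alpha>) ` injs V n \<subseteq> complete_edges n"
    using image_complete_edges assms by auto
  then show ?thesis
    using sum.group[OF finite_injs[OF assms(1)] finite_complete_edges, of "\<lambda>\<psi>. \<psi> ` \<alpha>" n n g]
    by (simp add: rooted_def)
qed

text \<open>The number of rooted maps divided by \<open>2 * n ^ (card V - 2)\<close>. It corrects
  for the Hamiltonian being normalised by a power of \<open>n\<close> and not by the number of
  maps.\<close>

definition density_ratio :: "'v set \<Rightarrow> nat \<Rightarrow> real" where
  "density_ratio V n = card (injs V n) / (real n * (real n - 1) * real n ^ (card V - 2))"

lemma card_rooted:
  assumes "finite V" "\<alpha> \<subseteq> V" "card \<alpha> = 2" "e \<in> complete_edges n" "2 \<le> n"
  shows "real (card (rooted V n \<alpha> e)) = 2 * density_ratio V n * real n ^ (card V - 2)"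
proof -
  have "real (card (injs V n)) = (\<Sum>e'\<in>complete_edges n. real (card (rooted V n \<alpha> e')))"
    using sum_rooted[OF assms(1-3), where g = "\<lambda>_. 1 :: real"] by simp
  also have "\<dots> = (\<Sum>e'\<in>complete_edges n. real (card (rooted V n \<alpha> e)))"
    using card_rooted_eq[OF assms(4) _ assms(2)] by simp
  also have "\<dots> = real (n choose 2) * real (card (rooted V n \<alpha> e))"
    by (simp add: card_complete_edges)
  also have "real (n choose 2) = real n * (real n - 1) / 2"
    using assms(5) by (simp add: choose_two real_of_nat_div of_nat_diff)
  finally have "real (card (injs V n)) = real n * (real n - 1) / 2 * real (card (rooted V n \<alpha> e))" .
  moreover have "real n * (real n - 1) * real n ^ (card V - 2) \<noteq> 0" using assms(5) by simp
  ultimately show ?thesis by (simp add: density_ratio_def eq_divide_eq mult_ac)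
qed

lemma density_ratio_tendsto:
  assumes "2 \<le> card V" "finite V"
  shows "(\<lambda>n. density_ratio V n) \<longlonglongrightarrow> 1"
proof -
  define k where "k = card V - 2"
  have V: "card V = Suc (Suc k)" using assms by (simp add: k_def)
  have "(\<lambda>n. \<Prod>j<k. real (n - (j + 2)) / real n) \<longlonglongrightarrow> (\<Prod>j<k. 1)"
  proof (intro tendsto_prod)
    fix j
    have "((\<lambda>n. (real n - real (j + 2)) / real n) \<longlonglongrightarrow> 1) \<longleftrightarrow>
       (\<lambda>n. real (n - (j + 2)) / real n) \<longlonglongrightarrow> 1"
      by (intro filterlim_cong refl eventually_mono[OF eventually_ge_at_top[of "j + 2"]]) (simp add: of_nat_diff)
    moreover have "(\<lambda>n. (real n - real (j + 2)) / real n) \<longlonglongrightarrow> 1"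
      by real_asymp
    ultimately show "(\<lambda>n. real (n - (j + 2)) / real n) \<longlonglongrightarrow> 1" by blast
  qed
  moreover have "\<forall>\<^sub>F n in sequentially. (\<Prod>j<k. real (n - (j + 2)) / real n) = density_ratio V n"
    using eventually_ge_at_top[of 2]
  proof eventually_elim
    case (elim n)
    have "real (card (injs V n)) = real n * (real n - 1) * (\<Prod>j<k. real (n - (j + 2)))"
      unfolding card_injs[OF assms(2)] V prod.lessThan_Suc_shift
      using elim by (simp add: of_nat_diff mult_ac)
    then show ?case
      using elim by (simp add: density_ratio_def k_def[symmetric] prod_dividef)
  qed
  ultimately show ?thesis
    by (simp add: tendsto_cong)
qed

section \<open>Densities as multilinear functions of the edge weights\<close>

locale rooted_graph =
  fixes V :: "'v set" and n :: nat and \<alpha> :: "'v set" and B :: "'v set set"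
  assumes finite_V: "finite V" and \<alpha>: "\<alpha> \<subseteq> V" "card \<alpha> = 2"
    and B: "B \<subseteq> {b. b \<subseteq> V \<and> card b = 2}" "\<alpha> \<notin> B"
    and n: "card V \<le> n" "3 \<le> n"
begin

lemma finite_B: "finite B"
  using B(1) finite_V by (auto intro: finite_subset[of B "Pow V"])

lemma card_rooted_pos:
  assumes "e \<in> complete_edges n"
  shows "0 < card (rooted V n \<alpha> e)"
proof -
  have "0 < card (injs V n)"
    unfolding card_injs[OF finite_V] using n by (auto intro!: prod_pos)
  then have "0 < real (card (rooted V n \<alpha> e))"
    unfolding card_rooted[OF finite_V \<alpha> assms order_trans[OF _ n(2), of 2, simplified]]
    using n by (simp add: density_ratio_def)
  then show ?thesis by simp
qed

lemma rooted_edge: "\<psi> \<in> rooted V n \<alpha> e \<Longrightarrow> b \<in> B \<Longrightarrow> \<psi> ` b \<in> complete_edges n"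
  using image_complete_edges[of \<psi> V n b] B by (auto simp: rooted_def)

lemma rooted_neq: "\<psi> \<in> rooted V n \<alpha> e \<Longrightarrow> b \<in> B \<Longrightarrow> \<psi> ` b \<noteq> e"
  using inj_image_edges[of \<psi> V n b \<alpha>] B \<alpha> by (auto simp: rooted_def)

text \<open>Transpositions of vertices outside \<open>e\<close> preserve the rooted maps, so the
  image of a vertex off the root is uniform on the \<open>n - 2\<close> vertices outside
  \<open>e\<close>.\<close>

lemma card_rooted_vertex:
  assumes e: "e \<in> complete_edges n" and w: "w \<in> V - \<alpha>"
  shows "card {\<psi> \<in> rooted V n \<alpha> e. \<psi> w = u} * (n - 2) \<le> card (rooted V n \<alpha> e)"
proof (cases "u \<in> {1..n} - e")
  case False
  have "{\<psi> \<in> rooted V n \<alpha> e. \<psi> w = u} = {}"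
    using False w \<alpha> by (auto simp: rooted_def injs_def PiE_iff inj_on_def)
  then have "card {\<psi> \<in> rooted V n \<alpha> e. \<psi> w = u} = 0" by (simp only: card.empty)
  then show ?thesis by simp
next
  case True
  have "card {\<psi> \<in> rooted V n \<alpha> e. \<psi> w = u'} = card {\<psi> \<in> rooted V n \<alpha> e. \<psi> w = u}"
    if u': "u' \<in> {1..n} - e" for u'
  proof -
    let ?\<sigma> = "Transposition.transpose u u'" and ?F = "\<lambda>\<psi>. restrict (Transposition.transpose u u' \<circ> \<psi>) V"
    have "?\<sigma> permutes {1..n}" using True u' by (intro permutes_swap_id) auto
    moreover have "?\<sigma> ` e = e" using True u' by (auto simp: Transposition.transpose_def image_iff)
    ultimately have bij: "bij_betw ?F (rooted V n \<alpha> e) (rooted V n \<alpha> e)"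
      using bij_betw_rooted[of ?\<sigma> n \<alpha> V e] \<alpha> by simp
    have "?F \<psi> w = u' \<longleftrightarrow> \<psi> w = u" for \<psi>
      using w by (auto simp: Transposition.transpose_def split: if_splits)
    then have "bij_betw ?F {\<psi> \<in> rooted V n \<alpha> e. \<psi> w = u} {\<psi> \<in> rooted V n \<alpha> e. \<psi> w = u'}"
      by (intro bij_betw_Collect[OF bij]) auto
    then show ?thesis by (simp add: bij_betw_same_card)
  qed
  then have "card {\<psi> \<in> rooted V n \<alpha> e. \<psi> w = u} * card ({1..n} - e) =
      (\<Sum>u'\<in>{1..n} - e. card {\<psi> \<in> rooted V n \<alpha> e. \<psi> w = u'})"
    by simp
  also have "\<dots> = card (\<Union>u'\<in>{1..n} - e. {\<psi> \<in> rooted V n \<alpha> e. \<psi> w = u'})"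
    using finite_rooted[OF finite_V] by (subst card_UN_disjoint) auto
  also have "\<dots> \<le> card (rooted V n \<alpha> e)"
    using finite_rooted[OF finite_V] by (intro card_mono) auto
  also have "card ({1..n} - e) = n - 2"
    using e by (subst card_Diff_subset) (auto simp: complete_edges_def intro: finite_subset)
  finally show ?thesis .
qed

text \<open>An edge other than the root has an end outside \<alpha>, whose image must be one of the
  two ends of \<open>a\<close>.\<close>

lemma card_rooted_edge:
  assumes e: "e \<in> complete_edges n" and b: "b \<in> B"
  shows "real (card {\<psi> \<in> rooted V n \<alpha> e. \<psi> ` b = a}) \<le> 2 / (real n - 2) * card (rooted V n \<alpha> e)"
proof (cases "a \<in> complete_edges n")
  case False
  then have "{\<psi> \<in> rooted V n \<alpha> e. \<psi> ` b = a} = {}"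
    using rooted_edge[OF _ b] by blast
  then have "card {\<psi> \<in> rooted V n \<alpha> e. \<psi> ` b = a} = 0" by (simp only: card.empty)
  then show ?thesis using n by simp
next
  case True
  then obtain u u' where a: "a = {u, u'}" by (auto simp: complete_edges_def card_2_iff)
  have "\<not> b \<subseteq> \<alpha>"
    using b B \<alpha> finite_V by (metis (mono_tags) card_subset_eq finite_subset mem_Collect_eq subset_iff)
  then obtain w where w: "w \<in> b" "w \<in> V - \<alpha>" using b B by blast
  have "card {\<psi> \<in> rooted V n \<alpha> e. \<psi> ` b = a} \<le>
      card ({\<psi> \<in> rooted V n \<alpha> e. \<psi> w = u} \<union> {\<psi> \<in> rooted V n \<alpha> e. \<psi> w = u'})"
    using w a finite_rooted[OF finite_V] by (intro card_mono) auto
  also have "\<dots> \<le> card {\<psi> \<in> rooted V n \<alpha> e. \<psi> w = u} + card {\<psi> \<in> rooted V n \<alpha> e. \<psi> w = u'}"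
    by (rule card_Un_le)
  finally have "card {\<psi> \<in> rooted V n \<alpha> e. \<psi> ` b = a} * (n - 2) \<le> 2 * card (rooted V n \<alpha> e)"
    using card_rooted_vertex[OF e w(2), of u] card_rooted_vertex[OF e w(2), of u']
    by (smt (verit) add_mono distrib_right mult_2 mult_le_mono1 order_trans)
  then have "real (card {\<psi> \<in> rooted V n \<alpha> e. \<psi> ` b = a} * (n - 2)) \<le> real (2 * card (rooted V n \<alpha> e))"
    by (rule of_nat_mono)
  then show ?thesis using n by (simp add: field_simps of_nat_diff)
qed

lemma weighted_avg_bounds:
  assumes e: "e \<in> complete_edges n"
    and "\<And>\<psi>. \<psi> \<in> rooted V n \<alpha> e \<Longrightarrow> l \<le> g \<psi> \<and> g \<psi> \<le> u"
  shows "l \<le> (\<Sum>\<psi>\<in>rooted V n \<alpha> e. g \<psi>) / card (rooted V n \<alpha> e)"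
    "(\<Sum>\<psi>\<in>rooted V n \<alpha> e. g \<psi>) / card (rooted V n \<alpha> e) \<le> (u :: real)"
proof -
  have "l * card (rooted V n \<alpha> e) \<le> (\<Sum>\<psi>\<in>rooted V n \<alpha> e. g \<psi>)"
    using sum_bounded_below[of "rooted V n \<alpha> e" l g] assms(2) by (simp add: mult.commute)
  then show "l \<le> (\<Sum>\<psi>\<in>rooted V n \<alpha> e. g \<psi>) / card (rooted V n \<alpha> e)"
    using card_rooted_pos[OF e] by (simp add: pos_le_divide_eq)
  have "(\<Sum>\<psi>\<in>rooted V n \<alpha> e. g \<psi>) \<le> u * card (rooted V n \<alpha> e)"
    using sum_bounded_above[of "rooted V n \<alpha> e" g u] assms(2) by (simp add: mult.commute)
  then show "(\<Sum>\<psi>\<in>rooted V n \<alpha> e. g \<psi>) / card (rooted V n \<alpha> e) \<le> u"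
    using card_rooted_pos[OF e] by (simp add: pos_divide_le_eq)
qed

lemma prod_wt_bounds:
  assumes "0 \<le> \<tau>" "\<tau> \<le> 1"
  shows "\<tau> ^ card C \<le> (\<Prod>b\<in>C. wt \<tau> x (\<psi> ` b))" "(\<Prod>b\<in>C. wt \<tau> x (\<psi> ` b)) \<le> 1"
    "0 \<le> (\<Prod>b\<in>C. wt \<tau> x (\<psi> ` b))"
proof -
  have "(\<Prod>b\<in>C. \<tau>) \<le> (\<Prod>b\<in>C. wt \<tau> x (\<psi> ` b))"
    using wt_bounds(1)[OF assms] assms by (intro prod_mono) auto
  then show "\<tau> ^ card C \<le> (\<Prod>b\<in>C. wt \<tau> x (\<psi> ` b))" by simp
  show "0 \<le> (\<Prod>b\<in>C. wt \<tau> x (\<psi> ` b))"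
    by (rule prod_nonneg) (simp add: wt_bounds(3) assms)
  show "(\<Prod>b\<in>C. wt \<tau> x (\<psi> ` b)) \<le> 1"
    by (rule prod_le_1) (simp add: wt_bounds assms)
qed

lemma dens_bounds:
  assumes "e \<in> complete_edges n" "0 \<le> \<tau>" "\<tau> \<le> 1"
  shows "\<tau> ^ card B \<le> dens V n \<alpha> B \<tau> x e" "dens V n \<alpha> B \<tau> x e \<le> 1"
proof -
  have *: "\<tau> ^ card B \<le> (\<Prod>b\<in>B. wt \<tau> x (\<psi> ` b)) \<and> (\<Prod>b\<in>B. wt \<tau> x (\<psi> ` b)) \<le> 1"
    for \<psi> :: "'v \<Rightarrow> nat"
    using prod_wt_bounds[OF assms(2,3)] by blast
  show "\<tau> ^ card B \<le> dens V n \<alpha> B \<tau> x e" "dens V n \<alpha> B \<tau> x e \<le> 1"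
    unfolding dens_def
    using weighted_avg_bounds[where g = "\<lambda>\<psi>. \<Prod>b\<in>B. wt \<tau> x (\<psi> ` b)", OF assms(1) *]
    by blast+
qed

text \<open>The products for a single map differ only if it hits an absent edge; then the exact one
  is 0 and the other carries a factor \<tau>.\<close>

lemma dens_0_le:
  assumes e: "e \<in> complete_edges n" and \<tau>: "0 \<le> \<tau>" "\<tau> \<le> 1"
  shows "dens V n \<alpha> B 0 x e \<le> dens V n \<alpha> B \<tau> x e" "dens V n \<alpha> B \<tau> x e \<le> dens V n \<alpha> B 0 x e + \<tau>"
proof -
  have *: "0 \<le> (\<Prod>b\<in>B. wt \<tau> x (\<psi> ` b)) - (\<Prod>b\<in>B. wt 0 x (\<psi> ` b)) \<and>
      (\<Prod>b\<in>B. wt \<tau> x (\<psi> ` b)) - (\<Prod>b\<in>B. wt 0 x (\<psi> ` b)) \<le> \<tau>" for \<psi> :: "'v \<Rightarrow> nat"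
  proof (cases "\<forall>b\<in>B. \<psi> ` b \<in> x")
    case True
    then show ?thesis using \<tau> by (simp add: wt_def)
  next
    case False
    then obtain b where b: "b \<in> B" "\<psi> ` b \<notin> x" by blast
    have "(\<Prod>b\<in>B. wt 0 x (\<psi> ` b)) = 0"
      using b finite_B by (auto simp: wt_def prod_zero_iff)
    moreover have "(\<Prod>b\<in>B. wt \<tau> x (\<psi> ` b)) = \<tau> * (\<Prod>b\<in>B-{b}. wt \<tau> x (\<psi> ` b))"
      using b finite_B by (simp add: prod.remove wt_def)
    moreover have "\<tau> * (\<Prod>b\<in>B-{b}. wt \<tau> x (\<psi> ` b)) \<le> \<tau> * 1"
      using \<tau> by (intro mult_left_mono prod_wt_bounds) auto
    ultimately show ?thesis using \<tau> prod_wt_bounds(3)[OF \<tau>, where C = "B - {b}" and x = x and \<psi> = \<psi>] by simp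
  qed
  have "dens V n \<alpha> B \<tau> x e - dens V n \<alpha> B 0 x e =
     (\<Sum>\<psi>\<in>rooted V n \<alpha> e. (\<Prod>b\<in>B. wt \<tau> x (\<psi> ` b)) - (\<Prod>b\<in>B. wt 0 x (\<psi> ` b))) / card (rooted V n \<alpha> e)"
    by (simp add: dens_def sum_subtractf diff_divide_distrib)
  then show "dens V n \<alpha> B 0 x e \<le> dens V n \<alpha> B \<tau> x e" "dens V n \<alpha> B \<tau> x e \<le> dens V n \<alpha> B 0 x e + \<tau>"
    using weighted_avg_bounds[where g = "\<lambda>\<psi>. (\<Prod>b\<in>B. wt \<tau> x (\<psi> ` b)) - (\<Prod>b\<in>B. wt 0 x (\<psi> ` b))",
        OF e *]
    by simp_all
qed

lemma pder_nonneg: "0 \<le> \<tau> \<Longrightarrow> 0 \<le> pder V n \<alpha> B \<tau> x e a"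
  unfolding pder_def
  by (intro divide_nonneg_nonneg sum_nonneg prod_nonneg) (simp_all add: wt_bounds)

lemma pder_le:
  assumes e: "e \<in> complete_edges n" and \<tau>: "0 \<le> \<tau>" "\<tau> \<le> 1"
  shows "pder V n \<alpha> B \<tau> x e a \<le> 2 * card B / (real n - 2)"
proof -
  have "(\<Sum>\<psi>\<in>rooted V n \<alpha> e. \<Sum>b\<in>{b\<in>B. \<psi> ` b = a}. \<Prod>c\<in>B - {b}. wt \<tau> x (\<psi> ` c))
      \<le> (\<Sum>\<psi>\<in>rooted V n \<alpha> e. \<Sum>b\<in>{b\<in>B. \<psi> ` b = a}. 1)"
    by (intro sum_mono prod_wt_bounds \<tau>)
  also have "\<dots> = (\<Sum>\<psi>\<in>rooted V n \<alpha> e. \<Sum>b\<in>B. if \<psi> ` b = a then 1 else 0)"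
    by (rule sum.cong[OF refl], rule sum.inter_filter[OF finite_B])
  also have "\<dots> = (\<Sum>b\<in>B. \<Sum>\<psi>\<in>rooted V n \<alpha> e. if \<psi> ` b = a then 1 else 0)"
    by (rule sum.swap)
  also have "\<dots> = (\<Sum>b\<in>B. real (card {\<psi> \<in> rooted V n \<alpha> e. \<psi> ` b = a}))"
    using finite_rooted[OF finite_V] by (simp flip: sum.inter_filter)
  also have "\<dots> \<le> (\<Sum>b\<in>B. 2 / (real n - 2) * card (rooted V n \<alpha> e))"
    by (intro sum_mono card_rooted_edge e)
  also have "\<dots> = 2 * card B / (real n - 2) * card (rooted V n \<alpha> e)"
    by simp
  finally show ?thesis
    using card_rooted_pos[OF e] by (simp add: pder_def pos_divide_le_eq)
qed

lemma dens_flip: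
  assumes "\<And>b. b \<noteq> a \<Longrightarrow> b \<in> y \<longleftrightarrow> b \<in> x"
  shows "dens V n \<alpha> B \<tau> y e = dens V n \<alpha> B \<tau> x e + (wt \<tau> y a - wt \<tau> x a) * pder V n \<alpha> B \<tau> x e a"
proof -
  have *: "(\<Prod>b\<in>B. wt \<tau> y (\<psi> ` b)) = (\<Prod>b\<in>B. wt \<tau> x (\<psi> ` b)) +
      (wt \<tau> y a - wt \<tau> x a) * (\<Sum>b\<in>{b\<in>B. \<psi> ` b = a}. \<Prod>c\<in>B - {b}. wt \<tau> x (\<psi> ` c))"
    if "\<psi> \<in> rooted V n \<alpha> e" for \<psi>
    using that B(1) by (intro prod_wt_flip assms finite_B) (auto simp: rooted_def)
  define P where "P z \<psi> = (\<Prod>b\<in>B. wt \<tau> z (\<psi> ` b))" for z and \<psi> :: "'v \<Rightarrow> nat"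
  define D where "D \<psi> = (\<Sum>b\<in>{b\<in>B. \<psi> ` b = a}. \<Prod>c\<in>B - {b}. wt \<tau> x (\<psi> ` c))" for \<psi> :: "'v \<Rightarrow> nat"
  have "(\<Sum>\<psi>\<in>rooted V n \<alpha> e. P y \<psi>) =
      (\<Sum>\<psi>\<in>rooted V n \<alpha> e. P x \<psi> + (wt \<tau> y a - wt \<tau> x a) * D \<psi>)"
    by (rule sum.cong[OF refl]) (simp only: P_def D_def *)
  also have "\<dots> = (\<Sum>\<psi>\<in>rooted V n \<alpha> e. P x \<psi>) + (wt \<tau> y a - wt \<tau> x a) * (\<Sum>\<psi>\<in>rooted V n \<alpha> e. D \<psi>)"
    by (simp add: sum.distrib sum_distrib_left)
  finally show ?thesis
    by (simp add: dens_def pder_def P_def[symmetric] D_def[symmetric] add_divide_distrib)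
qed

text \<open>A map \<psi> and an edge \<open>b\<close> contribute to exactly one \<open>a\<close>,
  the image of \<open>b\<close>, so the sum over \<open>a\<close> collapses.\<close>

lemma sum_pder:
  "(\<Sum>a\<in>complete_edges n. q a * pder V n \<alpha> B \<tau> x e a) =
   (\<Sum>b\<in>B. (\<Sum>\<psi>\<in>rooted V n \<alpha> e. q (\<psi> ` b) * (\<Prod>c\<in>B - {b}. wt \<tau> x (\<psi> ` c))) / card (rooted V n \<alpha> e))"
proof -
  have "(\<Sum>a\<in>complete_edges n. q a * (\<Sum>\<psi>\<in>rooted V n \<alpha> e. \<Sum>b\<in>{b\<in>B. \<psi> ` b = a}. \<Prod>c\<in>B - {b}. wt \<tau> x (\<psi> ` c)))
     = (\<Sum>a\<in>complete_edges n. \<Sum>\<psi>\<in>rooted V n \<alpha> e. \<Sum>b\<in>B.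
          if \<psi> ` b = a then q a * (\<Prod>c\<in>B - {b}. wt \<tau> x (\<psi> ` c)) else 0)"
    unfolding sum_distrib_left
  proof (rule sum.cong[OF refl], rule sum.cong[OF refl])
    fix a \<psi>
    show "(\<Sum>b\<in>{b\<in>B. \<psi> ` b = a}. q a * (\<Prod>c\<in>B - {b}. wt \<tau> x (\<psi> ` c))) =
        (\<Sum>b\<in>B. if \<psi> ` b = a then q a * (\<Prod>c\<in>B - {b}. wt \<tau> x (\<psi> ` c)) else 0)"
      by (rule sum.inter_filter[OF finite_B])
  qed
  also have "\<dots> = (\<Sum>\<psi>\<in>rooted V n \<alpha> e. \<Sum>a\<in>complete_edges n. \<Sum>b\<in>B.
          if \<psi> ` b = a then q a * (\<Prod>c\<in>B - {b}. wt \<tau> x (\<psi> ` c)) else 0)"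
    by (rule sum.swap)
  also have "\<dots> = (\<Sum>\<psi>\<in>rooted V n \<alpha> e. \<Sum>b\<in>B. \<Sum>a\<in>complete_edges n.
          if \<psi> ` b = a then q a * (\<Prod>c\<in>B - {b}. wt \<tau> x (\<psi> ` c)) else 0)"
    by (rule sum.cong[OF refl], rule sum.swap)
  also have "\<dots> = (\<Sum>\<psi>\<in>rooted V n \<alpha> e. \<Sum>b\<in>B. q (\<psi> ` b) * (\<Prod>c\<in>B - {b}. wt \<tau> x (\<psi> ` c)))"
  proof (rule sum.cong[OF refl], rule sum.cong[OF refl])
    fix \<psi> b assume "\<psi> \<in> rooted V n \<alpha> e" "b \<in> B"
    then show "(\<Sum>a\<in>complete_edges n. if \<psi> ` b = a then q a * (\<Prod>c\<in>B - {b}. wt \<tau> x (\<psi> ` c)) else 0) =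
        q (\<psi> ` b) * (\<Prod>c\<in>B - {b}. wt \<tau> x (\<psi> ` c))"
      using rooted_edge[of \<psi> e b] by (subst sum.delta') auto
  qed
  also have "\<dots> = (\<Sum>b\<in>B. \<Sum>\<psi>\<in>rooted V n \<alpha> e. q (\<psi> ` b) * (\<Prod>c\<in>B - {b}. wt \<tau> x (\<psi> ` c)))"
    by (rule sum.swap)
  finally show ?thesis
    by (simp add: pder_def sum_divide_distrib[symmetric])
qed

text \<open>Euler's identity: the density is a homogeneous polynomial of degree
  \<open>card B\<close> in the edge weights.\<close>

lemma sum_wt_pder:
  "(\<Sum>a\<in>complete_edges n. wt \<tau> x a * pder V n \<alpha> B \<tau> x e a) = card B * dens V n \<alpha> B \<tau> x e"
proof -
  have "(\<Sum>a\<in>complete_edges n. wt \<tau> x a * pder V n \<alpha> B \<tau> x e a) = (\<Sum>b\<in>B. dens V n \<alpha> B \<tau> x e)"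
    unfolding sum_pder dens_def
  proof (rule sum.cong[OF refl], rule arg_cong2[where f = "(/)", OF _ refl], rule sum.cong[OF refl])
    fix b \<psi> assume "b \<in> B"
    then show "wt \<tau> x (\<psi> ` b) * (\<Prod>c\<in>B - {b}. wt \<tau> x (\<psi> ` c)) = (\<Prod>b\<in>B. wt \<tau> x (\<psi> ` b))"
      by (simp add: prod.remove[OF finite_B])
  qed
  then show ?thesis by simp
qed

lemma sum_pder_le:
  assumes "0 \<le> \<tau>" "\<And>a. a \<in> complete_edges n \<Longrightarrow> q a \<le> P"
  shows "(\<Sum>a\<in>complete_edges n. q a * pder V n \<alpha> B \<tau> x e a) \<le> P * (\<Sum>b\<in>B. dens V n \<alpha> (B - {b}) \<tau> x e)"
  unfolding sum_pder sum_distrib_left dens_def times_divide_eq_right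
proof (rule sum_mono, rule divide_right_mono, rule sum_mono)
  fix b \<psi> assume "b \<in> B" "\<psi> \<in> rooted V n \<alpha> e"
  then have "q (\<psi> ` b) \<le> P" by (intro assms(2) rooted_edge)
  moreover have "0 \<le> (\<Prod>c\<in>B - {b}. wt \<tau> x (\<psi> ` c))"
    by (rule prod_nonneg) (simp add: wt_bounds assms(1))
  ultimately show "q (\<psi> ` b) * (\<Prod>c\<in>B - {b}. wt \<tau> x (\<psi> ` c)) \<le> P * (\<Prod>c\<in>B - {b}. wt \<tau> x (\<psi> ` c))"
    by (rule mult_right_mono)
qed simp

lemma sum_pder_ge:
  assumes "0 \<le> \<tau>" "\<And>a. a \<in> complete_edges n \<Longrightarrow> P \<le> q a"
  shows "P * (\<Sum>b\<in>B. dens V n \<alpha> (B - {b}) \<tau> x e) \<le> (\<Sum>a\<in>complete_edges n. q a * pder V n \<alpha> B \<tau> x e a)"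
  using sum_pder_le[OF assms(1), of "\<lambda>a. - q a" "- P" x e] assms(2) by (simp add: sum_negf)

lemma pder_self [simp]: "pder V n \<alpha> B \<tau> x e e = 0"
proof -
  have "(\<Sum>b\<in>{b\<in>B. \<psi> ` b = e}. \<Prod>c\<in>B - {b}. wt \<tau> x (\<psi> ` c)) = 0"
    if "\<psi> \<in> rooted V n \<alpha> e" for \<psi>
  proof -
    have "{b \<in> B. \<psi> ` b = e} = {}" using rooted_neq[OF that] by blast
    then show ?thesis by (simp only: sum.empty)
  qed
  then have "(\<Sum>\<psi>\<in>rooted V n \<alpha> e. \<Sum>b\<in>{b\<in>B. \<psi> ` b = e}. \<Prod>c\<in>B - {b}. wt \<tau> x (\<psi> ` c)) = 0"
    by simp
  then show ?thesis by (simp add: pder_def)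
qed

text \<open>The root edge is not in \<open>B\<close>, and injectivity keeps every other edge off
  \<open>e\<close>.\<close>

lemma dens_root_indep: "dens V n \<alpha> B \<tau> (x - {e}) e = dens V n \<alpha> B \<tau> x e"
  using dens_flip[of e "x - {e}" x \<tau> e] by simp

end

section \<open>The conditional field\<close>

definition dPhi :: "real \<Rightarrow> real" where
  "dPhi u = Phi u * (1 - Phi u)"

lemma DERIV_Phi: "(Phi has_real_derivative dPhi u) (at u)"
proof -
  have ne: "1 + exp u \<noteq> 0" by (metis add_pos_pos exp_gt_zero less_irrefl zero_less_one)
  have "((\<lambda>u. exp u / (1 + exp u)) has_real_derivative
      (exp u * (1 + exp u) - exp u * exp u) / ((1 + exp u) * (1 + exp u))) (at u)"
    using ne by (auto intro!: derivative_eq_intros)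
  moreover have "(exp u * (1 + exp u) - exp u * exp u) / ((1 + exp u) * (1 + exp u)) = dPhi u"
    using ne by (simp add: dPhi_def Phi_def field_simps)
  ultimately show ?thesis by (simp add: Phi_def[abs_def])
qed

lemma dPhi_bounds: "0 < dPhi u" "dPhi u \<le> 1"
  using Phi_pos[of u] Phi_less_1[of u] by (auto simp: dPhi_def mult_le_one)

lemma Phi_mono: "u \<le> w \<Longrightarrow> Phi u \<le> Phi w"
proof (erule DERIV_nonneg_imp_nondecreasing)
  fix z
  show "\<exists>y. (Phi has_real_derivative y) (at z) \<and> 0 \<le> y"
    using DERIV_Phi[of z] dPhi_bounds(1)[of z] by (intro exI[of _ "dPhi z"]) simp
qed

lemma Phi_diff_le:
  assumes "u \<le> w" "\<And>z. u \<le> z \<Longrightarrow> z \<le> w \<Longrightarrow> dPhi z \<le> c"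
  shows "Phi w - Phi u \<le> c * (w - u)"
proof (cases "u = w")
  case False
  then obtain z where "u < z" "z < w" "Phi w - Phi u = (w - u) * dPhi z"
    using MVT2[of u w Phi dPhi] assms(1) DERIV_Phi by auto
  then show ?thesis using assms(2)[of z] by (simp add: mult.commute mult_left_mono)
qed simp

lemma Phi_lipschitz: "\<bar>Phi u - Phi w\<bar> \<le> \<bar>u - w\<bar>"
  using Phi_diff_le[of u w 1] Phi_diff_le[of w u 1] Phi_mono[of u w] Phi_mono[of w u] dPhi_bounds(2)
  by (cases "u \<le> w") auto

lemma dPhi_lipschitz: "\<bar>dPhi u - dPhi w\<bar> \<le> \<bar>u - w\<bar>"
proof -
  have "dPhi u - dPhi w = (Phi u - Phi w) * (1 - Phi u - Phi w)"
    by (simp add: dPhi_def algebra_simps)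
  then have "\<bar>dPhi u - dPhi w\<bar> = \<bar>Phi u - Phi w\<bar> * \<bar>1 - Phi u - Phi w\<bar>"
    by (simp add: abs_mult)
  also have "\<dots> \<le> \<bar>u - w\<bar> * 1"
    using Phi_pos[of u] Phi_less_1[of u] Phi_pos[of w] Phi_less_1[of w]
    by (intro mult_mono Phi_lipschitz) auto
  finally show ?thesis by simp
qed

text \<open>\<open>Psi\<close> is nonnegative at nonnegative arguments, so \<open>phi\<close> is at
  least 1/2 there. This later turns additive errors of rates into relative ones and keeps fixed
  points away from 0.\<close>

lemma half_le_Phi: "0 \<le> u \<Longrightarrow> 1 / 2 \<le> Phi u"
  using Phi_mono[of 0 u] by (simp add: Phi_def)

definition dPsi :: "nat \<Rightarrow> (nat \<Rightarrow> 'v sgraph) \<Rightarrow> (nat \<Rightarrow> real) \<Rightarrow> real \<Rightarrow> real" where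
  "dPsi s G \<beta> p =
     (\<Sum>i=1..s. 2 * \<beta> i * card (edges (G i)) * (real (card (edges (G i)) - 1) * p ^ (card (edges (G i)) - 2)))"

lemma DERIV_Psi: "(Psi s G \<beta> has_real_derivative dPsi s G \<beta> p) (at p)"
  unfolding Psi_def[abs_def] dPsi_def
proof (rule DERIV_sum)
  fix i
  have "((\<lambda>p. 2 * \<beta> i * card (edges (G i)) * p ^ k) has_real_derivative
      2 * \<beta> i * card (edges (G i)) * (real k * p ^ (k - 1))) (at p)" for k
    by (auto intro!: derivative_eq_intros)
  from this[of "card (edges (G i)) - 1"]
  show "((\<lambda>p. 2 * \<beta> i * card (edges (G i)) * p ^ (card (edges (G i)) - 1)) has_real_derivative
      2 * \<beta> i * card (edges (G i)) * (real (card (edges (G i)) - 1) * p ^ (card (edges (G i)) - 2))) (at p)"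
    by (simp only: diff_diff_left one_add_one)
qed

lemma DERIV_phi: "(phi s G \<beta> has_real_derivative dPhi (Psi s G \<beta> p) * dPsi s G \<beta> p) (at p)"
  unfolding phi_def[abs_def] by (rule DERIV_chain2[OF DERIV_Phi DERIV_Psi])

section \<open>The field at an edge as a sum of rooted densities\<close>

locale ergm_size =
  fixes s :: nat and G :: "nat \<Rightarrow> 'v sgraph" and \<beta> :: "nat \<Rightarrow> real" and n :: nat
  assumes G: "\<And>i. i \<in> {1..s} \<Longrightarrow> finite_simple_graph (G i)"
    and \<beta>: "\<And>i. i \<in> {1..s} \<Longrightarrow> \<beta> i > 0"
    and size: "\<And>i. i \<in> {1..s} \<Longrightarrow> card (verts (G i)) \<le> n" "3 \<le> n"
begin

abbreviation "CE \<equiv> complete_edges n"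

abbreviation "vs i \<equiv> verts (G i)"

definition valid :: "nat \<Rightarrow> 'v set \<Rightarrow> 'v set set \<Rightarrow> bool" where
  "valid i \<alpha> B \<longleftrightarrow> i \<in> {1..s} \<and> \<alpha> \<in> edges (G i) \<and> B \<subseteq> edges (G i) - {\<alpha>}"

definition field :: "nat set \<Rightarrow> nat set set \<Rightarrow> real" where
  "field a x = hamiltonian s G \<beta> n (insert a x) - hamiltonian s G \<beta> n (x - {a})"

lemma finite_edges: "i \<in> {1..s} \<Longrightarrow> finite (edges (G i))"
  using G[of i] finite_subset[of "edges (G i)" "Pow (vs i)"]
  unfolding finite_simple_graph_def by blast

lemma edgeD: "i \<in> {1..s} \<Longrightarrow> \<alpha> \<in> edges (G i) \<Longrightarrow> finite (vs i) \<and> \<alpha> \<subseteq> vs i \<and> card \<alpha> = 2"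
  using G[of i] by (auto simp: finite_simple_graph_def)

lemma rooted_graph: "valid i \<alpha> B \<Longrightarrow> rooted_graph (vs i) n \<alpha> B"
  using G[of i] size(1)[of i] size(2)
  unfolding rooted_graph_def valid_def finite_simple_graph_def by blast

lemma valid_full: "i \<in> {1..s} \<Longrightarrow> \<alpha> \<in> edges (G i) \<Longrightarrow> valid i \<alpha> (edges (G i) - {\<alpha>})"
  by (simp add: valid_def)

lemma valid_remove: "valid i \<alpha> B \<Longrightarrow> valid i \<alpha> (B - C)"
  by (auto simp: valid_def)

lemma card_verts_ge_2: "i \<in> {1..s} \<Longrightarrow> \<alpha> \<in> edges (G i) \<Longrightarrow> 2 \<le> card (vs i)"
  using edgeD[of i \<alpha>] card_mono[of "vs i" \<alpha>] by auto

lemma prod_of_bool: "(\<Prod>e\<in>A. of_bool (\<psi> ` e \<in> x)) = (\<Prod>e\<in>A. wt 0 x (\<psi> ` e))"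
  by (rule prod.cong) (auto simp: wt_def)

text \<open>Presence of \<open>a\<close> matters only for embeddings that send some edge \<alpha> to
  \<open>a\<close>. Sorting these by \<alpha>, which is unique, gives the maps rooted at \<alpha>,
  and the remaining edges give the density.\<close>

lemma embedding_count_flip:
  assumes i: "i \<in> {1..s}" and a: "a \<in> CE"
  shows "embedding_count n (G i) (insert a x) - embedding_count n (G i) (x - {a}) =
    (\<Sum>\<alpha>\<in>edges (G i). card (rooted (vs i) n \<alpha> a) * dens (vs i) n \<alpha> (edges (G i) - {\<alpha>}) 0 x a)"
proof -
  let ?E = "edges (G i)" and ?V = "vs i"
  have V: "finite ?V" using G[OF i] by (simp add: finite_simple_graph_def)
  have E: "finite ?E" "?E \<subseteq> Pow ?V" using finite_edges[OF i] G[OF i] by (auto simp: finite_simple_graph_def)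
  define P where "P \<psi> \<alpha> = (\<Prod>c\<in>?E - {\<alpha>}. wt 0 (x - {a}) (\<psi> ` c))" for \<psi> :: "'v \<Rightarrow> nat" and \<alpha>
  have "embedding_count n (G i) (insert a x) - embedding_count n (G i) (x - {a}) =
      (\<Sum>\<psi>\<in>injs ?V n. (\<Prod>b\<in>?E. wt 0 (insert a x) (\<psi> ` b)) - (\<Prod>b\<in>?E. wt 0 (x - {a}) (\<psi> ` b)))"
    unfolding embedding_count_def prod_of_bool injs_def sum_subtractf ..
  also have "\<dots> = (\<Sum>\<psi>\<in>injs ?V n. \<Sum>\<alpha>\<in>{\<alpha>\<in>?E. \<psi> ` \<alpha> = a}. P \<psi> \<alpha>)"
  proof (rule sum.cong[OF refl])
    fix \<psi> assume "\<psi> \<in> injs ?V n"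
    from prod_wt_flip[OF _ this E, of a "insert a x" "x - {a}" 0]
    show "(\<Prod>b\<in>?E. wt 0 (insert a x) (\<psi> ` b)) - (\<Prod>b\<in>?E. wt 0 (x - {a}) (\<psi> ` b)) =
        (\<Sum>\<alpha>\<in>{\<alpha>\<in>?E. \<psi> ` \<alpha> = a}. P \<psi> \<alpha>)"
      by (simp add: wt_def[of 0 "insert a x" a] wt_def[of 0 "x - {a}" a] P_def)
  qed
  also have "\<dots> = (\<Sum>\<psi>\<in>injs ?V n. \<Sum>\<alpha>\<in>?E. if \<psi> ` \<alpha> = a then P \<psi> \<alpha> else 0)"
    by (rule sum.cong[OF refl], rule sum.inter_filter[OF E(1)])
  also have "\<dots> = (\<Sum>\<alpha>\<in>?E. \<Sum>\<psi>\<in>injs ?V n. if \<psi> ` \<alpha> = a then P \<psi> \<alpha> else 0)"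
    by (rule sum.swap)
  also have "\<dots> = (\<Sum>\<alpha>\<in>?E. \<Sum>\<psi>\<in>rooted ?V n \<alpha> a. P \<psi> \<alpha>)"
    unfolding rooted_def
    by (rule sum.cong[OF refl], rule sum.inter_filter[OF finite_injs[OF V], symmetric])
  also have "\<dots> = (\<Sum>\<alpha>\<in>?E. card (rooted ?V n \<alpha> a) * dens ?V n \<alpha> (?E - {\<alpha>}) 0 x a)"
  proof (rule sum.cong[OF refl])
    fix \<alpha> assume \<alpha>: "\<alpha> \<in> ?E"
    interpret rooted_graph ?V n \<alpha> "?E - {\<alpha>}"
      by (rule rooted_graph[OF valid_full[OF i \<alpha>]])
    show "(\<Sum>\<psi>\<in>rooted ?V n \<alpha> a. P \<psi> \<alpha>) = card (rooted ?V n \<alpha> a) * dens ?V n \<alpha> (?E - {\<alpha>}) 0 x a"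
      using card_rooted_pos[OF a] dens_root_indep[of 0 x a] by (simp add: dens_def P_def)
  qed
  finally show ?thesis .
qed

lemma field_eq:
  assumes a: "a \<in> CE"
  shows "field a x = (\<Sum>i=1..s. 2 * \<beta> i * density_ratio (vs i) n *
    (\<Sum>\<alpha>\<in>edges (G i). dens (vs i) n \<alpha> (edges (G i) - {\<alpha>}) 0 x a))"
proof -
  have "\<beta> i * embedding_count n (G i) (insert a x) / real n powi (int (card (vs i)) - 2) -
      \<beta> i * embedding_count n (G i) (x - {a}) / real n powi (int (card (vs i)) - 2) =
      2 * \<beta> i * density_ratio (vs i) n *
      (\<Sum>\<alpha>\<in>edges (G i). dens (vs i) n \<alpha> (edges (G i) - {\<alpha>}) 0 x a)" if i: "i \<in> {1..s}" for i
  proof -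
    let ?N = "real n powi (int (card (vs i)) - 2)"
    have "card (rooted (vs i) n \<alpha> a) / ?N = 2 * density_ratio (vs i) n"
      if \<alpha>: "\<alpha> \<in> edges (G i)" for \<alpha>
    proof -
      \<comment> \<open>A graph with an edge has at least two vertices, so the integer exponent
        agrees with the truncated one. Graphs without edges contribute an empty sum.\<close>
      have "int (card (vs i)) - 2 = int (card (vs i) - 2)"
        using card_verts_ge_2[OF i \<alpha>] by simp
      then have N: "?N = real n ^ (card (vs i) - 2)" by (simp only: power_int_of_nat)
      have "real (card (rooted (vs i) n \<alpha> a)) =
          2 * density_ratio (vs i) n * real n ^ (card (vs i) - 2)"
        using edgeD[OF i \<alpha>] a size(2) by (intro card_rooted) auto
      then show ?thesis
        unfolding N using size(2) by simp
    qed
    then have "(\<Sum>\<alpha>\<in>edges (G i). card (rooted (vs i) n \<alpha> a) * dens (vs i) n \<alpha> (edges (G i) - {\<alpha>}) 0 x a / ?N)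
       = (\<Sum>\<alpha>\<in>edges (G i). 2 * density_ratio (vs i) n * dens (vs i) n \<alpha> (edges (G i) - {\<alpha>}) 0 x a)"
      by (intro sum.cong refl) (simp only: times_divide_eq_left[symmetric])
    then have "(embedding_count n (G i) (insert a x) - embedding_count n (G i) (x - {a})) / ?N =
       2 * density_ratio (vs i) n * (\<Sum>\<alpha>\<in>edges (G i). dens (vs i) n \<alpha> (edges (G i) - {\<alpha>}) 0 x a)"
      unfolding embedding_count_flip[OF i a] by (simp add: sum_divide_distrib sum_distrib_left)
    then have "\<beta> i * ((embedding_count n (G i) (insert a x) - embedding_count n (G i) (x - {a})) / ?N) =
       \<beta> i * (2 * density_ratio (vs i) n * (\<Sum>\<alpha>\<in>edges (G i). dens (vs i) n \<alpha> (edges (G i) - {\<alpha>}) 0 x a))"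
      by (rule arg_cong)
    moreover have "\<beta> i * ((u - w) / ?N) = \<beta> i * u / ?N - \<beta> i * w / ?N" for u w
      by (simp only: right_diff_distrib diff_divide_distrib times_divide_eq_right)
    ultimately show ?thesis by (simp only: mult_ac)
  qed
  then show ?thesis
    unfolding field_def hamiltonian_def sum_subtractf[symmetric] by (intro sum.cong refl)
qed

lemma field_insert:
  assumes a: "a \<in> CE" and e: "e \<notin> x"
  shows "field a (insert e x) - field a x = (\<Sum>i=1..s. 2 * \<beta> i * density_ratio (vs i) n *
    (\<Sum>\<alpha>\<in>edges (G i). pder (vs i) n \<alpha> (edges (G i) - {\<alpha>}) 0 x a e))"
proof -
  have "dens (vs i) n \<alpha> (edges (G i) - {\<alpha>}) 0 (insert e x) a - dens (vs i) n \<alpha> (edges (G i) - {\<alpha>}) 0 x a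
      = pder (vs i) n \<alpha> (edges (G i) - {\<alpha>}) 0 x a e"
    if i: "i \<in> {1..s}" and \<alpha>: "\<alpha> \<in> edges (G i)" for i \<alpha>
  proof -
    interpret rooted_graph "vs i" n \<alpha> "edges (G i) - {\<alpha>}"
      by (rule rooted_graph[OF valid_full[OF i \<alpha>]])
    have "wt 0 (insert e x) e - wt 0 x e = 1" using e by (simp add: wt_def)
    moreover have "b \<in> insert e x \<longleftrightarrow> b \<in> x" if "b \<noteq> e" for b using that by simp
    ultimately show ?thesis using dens_flip[of e "insert e x" x 0 a] by simp
  qed
  then have "(\<Sum>\<alpha>\<in>edges (G i). dens (vs i) n \<alpha> (edges (G i) - {\<alpha>}) 0 (insert e x) a) -
     (\<Sum>\<alpha>\<in>edges (G i). dens (vs i) n \<alpha> (edges (G i) - {\<alpha>}) 0 x a) =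
     (\<Sum>\<alpha>\<in>edges (G i). pder (vs i) n \<alpha> (edges (G i) - {\<alpha>}) 0 x a e)" if "i \<in> {1..s}" for i
    unfolding sum_subtractf[symmetric] using that by (intro sum.cong refl)
  then show ?thesis
    unfolding field_eq[OF a] sum_subtractf[symmetric] right_diff_distrib[symmetric]
    by (intro sum.cong refl) simp
qed

lemma density_ratio_pos: "i \<in> {1..s} \<Longrightarrow> 0 < density_ratio (vs i) n"
proof -
  assume i: "i \<in> {1..s}"
  have "0 < card (injs (vs i) n)"
    using G[OF i] size(1)[OF i] by (subst card_injs) (auto simp: finite_simple_graph_def intro!: prod_pos)
  then show ?thesis using size(2) by (simp add: density_ratio_def)
qed

lemma field_mono:
  assumes "a \<in> CE"
  shows "field a x \<le> field a (insert e x)"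
proof (cases "e \<in> x")
  case False
  have "0 \<le> (\<Sum>i=1..s. 2 * \<beta> i * density_ratio (vs i) n *
    (\<Sum>\<alpha>\<in>edges (G i). pder (vs i) n \<alpha> (edges (G i) - {\<alpha>}) 0 x a e))"
  proof (rule sum_nonneg)
    fix i assume i: "i \<in> {1..s}"
    have "0 \<le> (\<Sum>\<alpha>\<in>edges (G i). pder (vs i) n \<alpha> (edges (G i) - {\<alpha>}) 0 x a e)"
      by (rule sum_nonneg, rule rooted_graph.pder_nonneg[OF rooted_graph[OF valid_full[OF i]]]) simp_all
    then show "0 \<le> 2 * \<beta> i * density_ratio (vs i) n *
      (\<Sum>\<alpha>\<in>edges (G i). pder (vs i) n \<alpha> (edges (G i) - {\<alpha>}) 0 x a e)"
      using \<beta>[OF i] density_ratio_pos[OF i] by simp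
  qed
  then show ?thesis using field_insert[OF assms False] by linarith
qed (simp add: insert_absorb)

text \<open>Double counting of the ordered pairs of distinct edges of \<open>G i\<close> mapped to \<open>(a, e)\<close>.\<close>

lemma sum_pder_swap:
  assumes i: "i \<in> {1..s}" and e: "e \<in> CE"
  shows "(\<Sum>a\<in>CE. \<Sum>\<alpha>\<in>edges (G i). pder (vs i) n \<alpha> (edges (G i) - {\<alpha>}) 0 x a e) =
    (\<Sum>b\<in>edges (G i). \<Sum>\<alpha>\<in>edges (G i) - {b}. dens (vs i) n b (edges (G i) - {b} - {\<alpha>}) 0 x e)"
proof (cases "edges (G i) = {}")
  case False
  let ?E = "edges (G i)" and ?V = "vs i"
  have V: "finite ?V" using G[OF i] by (simp add: finite_simple_graph_def)
  have E: "finite ?E" using finite_edges[OF i] .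
  \<comment> \<open>The number of rooted maps is the same for every root edge of \<open>G i\<close>
    and every image, so the densities on both sides have this common denominator.\<close>
  define R where "R = 2 * density_ratio ?V n * real n ^ (card ?V - 2)"
  have R: "real (card (rooted ?V n \<alpha> a)) = R" if "\<alpha> \<in> ?E" "a \<in> CE" for \<alpha> a
    using card_rooted[of ?V \<alpha> a n] edgeD[OF i that(1)] that(2) size(2) by (simp add: R_def)
  have R0: "R \<noteq> 0" using density_ratio_pos[OF i] size(2) by (simp add: R_def)
  define P where "P \<psi> \<alpha> b = (\<Prod>c\<in>?E - {\<alpha>} - {b}. wt 0 x (\<psi> ` c))" for \<psi> :: "'v \<Rightarrow> nat" and \<alpha> b
  have P_commute: "P \<psi> \<alpha> b = P \<psi> b \<alpha>" for \<psi> \<alpha> b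
    by (simp add: P_def Diff_insert2[symmetric] insert_commute)
  have "(\<Sum>a\<in>CE. \<Sum>\<alpha>\<in>?E. pder ?V n \<alpha> (?E - {\<alpha>}) 0 x a e) =
     (\<Sum>\<alpha>\<in>?E. \<Sum>a\<in>CE. pder ?V n \<alpha> (?E - {\<alpha>}) 0 x a e)"
    by (rule sum.swap)
  also have "\<dots> = (\<Sum>\<alpha>\<in>?E. (\<Sum>\<psi>\<in>injs ?V n. \<Sum>b\<in>?E - {\<alpha>}. if \<psi> ` b = e then P \<psi> \<alpha> b else 0) / R)"
  proof (rule sum.cong[OF refl])
    fix \<alpha> assume \<alpha>: "\<alpha> \<in> ?E"
    have "(\<Sum>a\<in>CE. pder ?V n \<alpha> (?E - {\<alpha>}) 0 x a e) =
       (\<Sum>a\<in>CE. (\<Sum>\<psi>\<in>rooted ?V n \<alpha> a. \<Sum>b\<in>?E - {\<alpha>}. if \<psi> ` b = e then P \<psi> \<alpha> b else 0) / R)"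
    proof (rule sum.cong[OF refl])
      fix a assume "a \<in> CE"
      have "(\<Sum>b\<in>{b \<in> ?E - {\<alpha>}. \<psi> ` b = e}. P \<psi> \<alpha> b) =
          (\<Sum>b\<in>?E - {\<alpha>}. if \<psi> ` b = e then P \<psi> \<alpha> b else 0)" for \<psi>
        using E by (intro sum.inter_filter) simp
      then show "pder ?V n \<alpha> (?E - {\<alpha>}) 0 x a e =
          (\<Sum>\<psi>\<in>rooted ?V n \<alpha> a. \<Sum>b\<in>?E - {\<alpha>}. if \<psi> ` b = e then P \<psi> \<alpha> b else 0) / R"
        by (simp only: pder_def P_def[symmetric] R[OF \<alpha> \<open>a \<in> CE\<close>])
    qed
    also have "\<dots> = (\<Sum>\<psi>\<in>injs ?V n. \<Sum>b\<in>?E - {\<alpha>}. if \<psi> ` b = e then P \<psi> \<alpha> b else 0) / R"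
      using edgeD[OF i \<alpha>] by (subst sum_rooted[symmetric, of ?V \<alpha>]) (simp_all add: sum_divide_distrib)
    finally show "(\<Sum>a\<in>CE. pder ?V n \<alpha> (?E - {\<alpha>}) 0 x a e) = \<dots>" .
  qed
  also have "\<dots> = (\<Sum>\<alpha>\<in>?E. \<Sum>b\<in>?E - {\<alpha>}. (\<Sum>\<psi>\<in>injs ?V n. if \<psi> ` b = e then P \<psi> \<alpha> b else 0) / R)"
    by (rule sum.cong[OF refl], subst sum.swap, simp add: sum_divide_distrib)
  also have "\<dots> = (\<Sum>\<alpha>\<in>?E. \<Sum>b\<in>?E - {\<alpha>}. dens ?V n b (?E - {b} - {\<alpha>}) 0 x e)"
  proof (rule sum.cong[OF refl], rule sum.cong[OF refl])
    fix \<alpha> b assume "b \<in> ?E - {\<alpha>}"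
    then have b: "b \<in> ?E" by simp
    have "(\<Sum>\<psi>\<in>injs ?V n. if \<psi> ` b = e then P \<psi> \<alpha> b else 0) = (\<Sum>\<psi>\<in>rooted ?V n b e. P \<psi> \<alpha> b)"
      unfolding rooted_def by (rule sum.inter_filter[OF finite_injs[OF V], symmetric])
    then show "(\<Sum>\<psi>\<in>injs ?V n. if \<psi> ` b = e then P \<psi> \<alpha> b else 0) / R = dens ?V n b (?E - {b} - {\<alpha>}) 0 x e"
      by (simp only: dens_def R[OF b e] P_commute[of _ \<alpha> b]) (simp only: P_def)
  qed
  also have "\<dots> = (\<Sum>b\<in>?E. \<Sum>\<alpha>\<in>?E - {b}. dens ?V n b (?E - {b} - {\<alpha>}) 0 x e)"
  proof -
    define h where "h \<alpha> b = dens ?V n b (?E - {b} - {\<alpha>}) 0 x e" for \<alpha> b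
    have E1: "?E - {\<alpha>} = {b \<in> ?E. \<alpha> \<noteq> b}" and E2: "?E - {\<alpha>} = {b \<in> ?E. b \<noteq> \<alpha>}" for \<alpha> by auto
    have "(\<Sum>\<alpha>\<in>?E. \<Sum>b\<in>?E - {\<alpha>}. h \<alpha> b) = (\<Sum>\<alpha>\<in>?E. \<Sum>b\<in>?E. if \<alpha> \<noteq> b then h \<alpha> b else 0)"
      unfolding E1 by (rule sum.cong[OF refl], rule sum.inter_filter[OF E])
    also have "\<dots> = (\<Sum>b\<in>?E. \<Sum>\<alpha>\<in>?E. if \<alpha> \<noteq> b then h \<alpha> b else 0)" by (rule sum.swap)
    also have "\<dots> = (\<Sum>b\<in>?E. \<Sum>\<alpha>\<in>?E - {b}. h \<alpha> b)"
      unfolding E2 by (rule sum.cong[OF refl], rule sum.inter_filter[OF E, symmetric])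
    finally show ?thesis by (simp only: h_def)
  qed
  finally show ?thesis .
qed simp

end

section \<open>Rates, influences and drifts under control of the densities\<close>

context ergm_size
begin

lemma CE_ne: "CE \<noteq> {}"
proof -
  have "{1, 2} \<in> CE" using size(2) by (simp add: complete_edges_def)
  then show ?thesis by blast
qed

sublocale glauber CE "hamiltonian s G \<beta> n"
  by unfold_locales (simp_all add: CE_ne)

lemma rate_eq: "rate a x = Phi (field a x)"
  by (simp add: rate_def field_def)

lemma rate_mono: "a \<in> CE \<Longrightarrow> rate a x \<le> rate a (insert e x)"
  unfolding rate_eq by (intro Phi_mono field_mono)

text \<open>Compares every density with its value in a random graph whose independent edges have
  probability \<open>r\<close> or \<open>R\<close>.\<close>

definition controlled :: "real \<Rightarrow> real \<Rightarrow> real \<Rightarrow> nat set set \<Rightarrow> bool" where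
  "controlled \<tau> r R x \<longleftrightarrow> (\<forall>i \<alpha> B e. valid i \<alpha> B \<longrightarrow> e \<in> CE \<longrightarrow>
     r ^ card B \<le> dens (vs i) n \<alpha> B \<tau> x e \<and> dens (vs i) n \<alpha> B \<tau> x e \<le> R ^ card B)"

text \<open>Restricted to graphs with an edge: with fewer than two vertices the ratio tends to 0,
  but such graphs do not enter the field.\<close>

definition ratio_close :: "real \<Rightarrow> bool" where
  "ratio_close \<tau> \<longleftrightarrow> (\<forall>i\<in>{1..s}. edges (G i) \<noteq> {} \<longrightarrow> \<bar>density_ratio (vs i) n - 1\<bar> \<le> \<tau>)"

lemma controlledD:
  assumes "controlled \<tau> r R x" "valid i \<alpha> B" "e \<in> CE"
  shows "r ^ card B \<le> dens (vs i) n \<alpha> B \<tau> x e" "dens (vs i) n \<alpha> B \<tau> x e \<le> R ^ card B"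
  using assms by (auto simp: controlled_def)

lemma Psi_1: "Psi s G \<beta> 1 = (\<Sum>i=1..s. 2 * \<beta> i * card (edges (G i)))"
  by (simp add: Psi_def)

text \<open>Each edge of a \<open>G i\<close> costs an error of at most \<open>2 * \<tau>\<close>:
  one \<tau> for the density ratio, one for passing between actual and regularised densities. The
  coefficients of these errors add up to \<open>Psi s G \<beta> 1\<close>.\<close>

lemma field_bounds:
  assumes ctrl: "controlled \<tau> r R x" and ratio: "ratio_close \<tau>" and \<tau>: "0 \<le> \<tau>" "\<tau> \<le> 1" and a: "a \<in> CE"
  shows "field a x \<le> Psi s G \<beta> R + 2 * \<tau> * Psi s G \<beta> 1" "Psi s G \<beta> r - 2 * \<tau> * Psi s G \<beta> 1 \<le> field a x"
proof -
  let ?d = "\<lambda>i \<tau> \<alpha>. dens (vs i) n \<alpha> (edges (G i) - {\<alpha>}) \<tau> x a"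
  let ?\<rho> = "\<lambda>i. density_ratio (vs i) n"
  have *: "r ^ (card (edges (G i)) - 1) - 2 * \<tau> \<le> ?\<rho> i * ?d i 0 \<alpha> \<and>
      ?\<rho> i * ?d i 0 \<alpha> \<le> R ^ (card (edges (G i)) - 1) + 2 * \<tau>"
    if i: "i \<in> {1..s}" and \<alpha>: "\<alpha> \<in> edges (G i)" for i \<alpha>
  proof -
    interpret rooted_graph "vs i" n \<alpha> "edges (G i) - {\<alpha>}"
      by (rule rooted_graph[OF valid_full[OF i \<alpha>]])
    have card: "card (edges (G i) - {\<alpha>}) = card (edges (G i)) - 1"
      using that(2) finite_edges[OF i] by simp
    have d0: "0 \<le> ?d i 0 \<alpha>" "?d i 0 \<alpha> \<le> 1"
      using dens_bounds[OF a, of 0 x] by (auto intro: order_trans[rotated])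
    have "\<bar>?\<rho> i - 1\<bar> \<le> \<tau>" using ratio that by (auto simp: ratio_close_def)
    then have "\<bar>(?\<rho> i - 1) * ?d i 0 \<alpha>\<bar> \<le> \<tau> * 1"
      unfolding abs_mult using d0 \<tau> by (intro mult_mono) auto
    then have "\<bar>?\<rho> i * ?d i 0 \<alpha> - ?d i 0 \<alpha>\<bar> \<le> \<tau>" by (simp add: left_diff_distrib)
    moreover have "?d i 0 \<alpha> \<le> ?d i \<tau> \<alpha>" "?d i \<tau> \<alpha> \<le> ?d i 0 \<alpha> + \<tau>"
      using dens_0_le[OF a \<tau>, of x] by auto
    moreover have "r ^ (card (edges (G i)) - 1) \<le> ?d i \<tau> \<alpha>" "?d i \<tau> \<alpha> \<le> R ^ (card (edges (G i)) - 1)"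
      using controlledD[OF ctrl valid_full[OF that] a] by (simp_all add: card)
    ultimately show ?thesis by linarith
  qed
  have "2 * \<beta> i * ?\<rho> i * (\<Sum>\<alpha>\<in>edges (G i). ?d i 0 \<alpha>) \<le>
      2 * \<beta> i * (card (edges (G i)) * (R ^ (card (edges (G i)) - 1) + 2 * \<tau>)) \<and>
      2 * \<beta> i * (card (edges (G i)) * (r ^ (card (edges (G i)) - 1) - 2 * \<tau>)) \<le>
      2 * \<beta> i * ?\<rho> i * (\<Sum>\<alpha>\<in>edges (G i). ?d i 0 \<alpha>)" if i: "i \<in> {1..s}" for i
  proof -
    have "(\<Sum>\<alpha>\<in>edges (G i). ?\<rho> i * ?d i 0 \<alpha>) \<le> card (edges (G i)) * (R ^ (card (edges (G i)) - 1) + 2 * \<tau>)"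
      using *[OF i] by (intro sum_bounded_above) blast
    moreover have "card (edges (G i)) * (r ^ (card (edges (G i)) - 1) - 2 * \<tau>) \<le> (\<Sum>\<alpha>\<in>edges (G i). ?\<rho> i * ?d i 0 \<alpha>)"
      using *[OF i] by (intro sum_bounded_below) blast
    ultimately show ?thesis
      using \<beta>[OF i] unfolding mult.assoc sum_distrib_left[symmetric]
      by (intro conjI mult_left_mono) auto
  qed
  then have "field a x \<le> (\<Sum>i=1..s. 2 * \<beta> i * (card (edges (G i)) * (R ^ (card (edges (G i)) - 1) + 2 * \<tau>)))"
    "(\<Sum>i=1..s. 2 * \<beta> i * (card (edges (G i)) * (r ^ (card (edges (G i)) - 1) - 2 * \<tau>))) \<le> field a x"
    unfolding field_eq[OF a] by (auto intro!: sum_mono)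
  then show "field a x \<le> Psi s G \<beta> R + 2 * \<tau> * Psi s G \<beta> 1" "Psi s G \<beta> r - 2 * \<tau> * Psi s G \<beta> 1 \<le> field a x"
    unfolding Psi_1 by (simp_all add: Psi_def sum_distrib_left algebra_simps sum.distrib sum_subtractf)
qed

text \<open>The total influence of \<open>e\<close>: double counting turns it into densities rooted
  at \<open>e\<close> with two edges of \<open>G i\<close> removed, one for the root and one for the
  affected edge. The \<open>k * (k - 1)\<close> choices and the power \<open>R ^ (k - 2)\<close>
  produce the derivative of \<open>Psi\<close>.\<close>

lemma sum_field_gradient:
  assumes ctrl: "controlled \<tau> r R x" and ratio: "ratio_close \<tau>" and \<tau>: "0 \<le> \<tau>" "\<tau> \<le> 1" and R: "0 \<le> R"
    and e: "e \<in> CE" "e \<notin> x"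
  shows "(\<Sum>a\<in>CE. field a (insert e x) - field a x) \<le> (1 + \<tau>) * dPsi s G \<beta> R"
proof -
  let ?S = "\<lambda>i. \<Sum>b\<in>edges (G i). \<Sum>\<alpha>\<in>edges (G i) - {b}. dens (vs i) n b (edges (G i) - {b} - {\<alpha>}) 0 x e"
  have S: "?S i \<le> card (edges (G i)) * (real (card (edges (G i)) - 1) * R ^ (card (edges (G i)) - 2))" (is "_ \<le> _ * ?t")
    if i: "i \<in> {1..s}" for i
  proof (rule sum_bounded_above)
    fix b assume b: "b \<in> edges (G i)"
    have card: "card (edges (G i) - {b}) = card (edges (G i)) - 1"
      using b finite_edges[OF i] by simp
    have "(\<Sum>\<alpha>\<in>edges (G i) - {b}. dens (vs i) n b (edges (G i) - {b} - {\<alpha>}) 0 x e)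
        \<le> real (card (edges (G i) - {b})) * R ^ (card (edges (G i)) - 2)"
    proof (rule sum_bounded_above)
      fix \<alpha> assume \<alpha>: "\<alpha> \<in> edges (G i) - {b}"
      have v: "valid i b (edges (G i) - {b} - {\<alpha>})"
        by (rule valid_remove[OF valid_full[OF i b]])
      have "card (edges (G i) - {b} - {\<alpha>}) = card (edges (G i)) - 2"
        using \<alpha> b finite_edges[OF i] by simp
      then show "dens (vs i) n b (edges (G i) - {b} - {\<alpha>}) 0 x e \<le> R ^ (card (edges (G i)) - 2)"
        using rooted_graph.dens_0_le(1)[OF rooted_graph[OF v] e(1) \<tau>, of x] controlledD(2)[OF ctrl v e(1)]
        by simp
    qed
    then show "(\<Sum>\<alpha>\<in>edges (G i) - {b}. dens (vs i) n b (edges (G i) - {b} - {\<alpha>}) 0 x e) \<le> ?t"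
      by (simp only: card)
  qed
  have "(\<Sum>a\<in>CE. field a (insert e x) - field a x) =
      (\<Sum>a\<in>CE. \<Sum>i=1..s. 2 * \<beta> i * density_ratio (vs i) n *
        (\<Sum>\<alpha>\<in>edges (G i). pder (vs i) n \<alpha> (edges (G i) - {\<alpha>}) 0 x a e))"
    by (rule sum.cong[OF refl]) (rule field_insert[OF _ e(2)])
  also have "\<dots> = (\<Sum>i=1..s. 2 * \<beta> i * density_ratio (vs i) n * ?S i)"
    by (subst sum.swap) (intro sum.cong refl, simp only: sum_distrib_left[symmetric] sum_pder_swap[OF _ e(1)])
  also have "\<dots> \<le> (\<Sum>i=1..s. (1 + \<tau>) * (2 * \<beta> i * card (edges (G i)) *
      (real (card (edges (G i)) - 1) * R ^ (card (edges (G i)) - 2))))"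
  proof (rule sum_mono)
    fix i assume i: "i \<in> {1..s}"
    show "2 * \<beta> i * density_ratio (vs i) n * ?S i \<le> (1 + \<tau>) * (2 * \<beta> i * card (edges (G i)) *
      (real (card (edges (G i)) - 1) * R ^ (card (edges (G i)) - 2)))"
    proof (cases "edges (G i) = {}")
      case False
      then have "density_ratio (vs i) n \<le> 1 + \<tau>"
        using ratio i by (auto simp: ratio_close_def abs_le_iff)
      then have "density_ratio (vs i) n * ?S i \<le>
          (1 + \<tau>) * (card (edges (G i)) * (real (card (edges (G i)) - 1) * R ^ (card (edges (G i)) - 2)))"
        using S[OF i] density_ratio_pos[OF i] R \<tau>
        by (intro mult_mono' order_trans[OF mult_left_mono[OF S[OF i]] mult_right_mono]) (auto intro!: mult_nonneg_nonneg)
      then have "2 * \<beta> i * (density_ratio (vs i) n * ?S i) \<le>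
          2 * \<beta> i * ((1 + \<tau>) * (card (edges (G i)) * (real (card (edges (G i)) - 1) * R ^ (card (edges (G i)) - 2))))"
        using \<beta>[OF i] by (intro mult_left_mono) auto
      then show ?thesis by (simp only: mult_ac)
    qed simp
  qed
  finally show ?thesis by (simp only: dPsi_def sum_distrib_left)
qed

text \<open>The 8 collects the 2 in the field, the bound 2 for the density ratio and the 2 in
  \<open>pder_le\<close>.\<close>

definition gradient_const :: real where
  "gradient_const = (\<Sum>i=1..s. 8 * \<beta> i * (card (edges (G i)))\<^sup>2)"

lemma field_gradient_le:
  assumes ratio: "ratio_close 1" and a: "a \<in> CE" and e: "e \<notin> x"
  shows "field a (insert e x) - field a x \<le> gradient_const / (real n - 2)"
proof -
  have "2 * \<beta> i * density_ratio (vs i) n *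
      (\<Sum>\<alpha>\<in>edges (G i). pder (vs i) n \<alpha> (edges (G i) - {\<alpha>}) 0 x a e)
      \<le> 8 * \<beta> i * (card (edges (G i)))\<^sup>2 / (real n - 2)" if i: "i \<in> {1..s}" for i
  proof (cases "edges (G i) = {}")
    case False
    then have "density_ratio (vs i) n \<le> 2"
      using ratio i by (auto simp: ratio_close_def abs_le_iff)
    have "(\<Sum>\<alpha>\<in>edges (G i). pder (vs i) n \<alpha> (edges (G i) - {\<alpha>}) 0 x a e)
        \<le> card (edges (G i)) * (2 * card (edges (G i)) / (real n - 2))"
    proof (rule sum_bounded_above)
      fix \<alpha> assume \<alpha>: "\<alpha> \<in> edges (G i)"
      have "pder (vs i) n \<alpha> (edges (G i) - {\<alpha>}) 0 x a e \<le> 2 * card (edges (G i) - {\<alpha>}) / (real n - 2)"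
        by (rule rooted_graph.pder_le[OF rooted_graph[OF valid_full[OF i \<alpha>]] a]) simp_all
      also have "\<dots> \<le> 2 * card (edges (G i)) / (real n - 2)"
        using size(2) finite_edges[OF i] by (intro divide_right_mono) (auto simp: card_Diff1_le)
      finally show "pder (vs i) n \<alpha> (edges (G i) - {\<alpha>}) 0 x a e \<le> 2 * card (edges (G i)) / (real n - 2)" .
    qed
    then have "density_ratio (vs i) n * (\<Sum>\<alpha>\<in>edges (G i). pder (vs i) n \<alpha> (edges (G i) - {\<alpha>}) 0 x a e)
        \<le> 2 * (card (edges (G i)) * (2 * card (edges (G i)) / (real n - 2)))"
      using \<open>density_ratio (vs i) n \<le> 2\<close> size(2)
      by (intro mult_mono sum_nonneg rooted_graph.pder_nonneg[OF rooted_graph[OF valid_full[OF i]]]) auto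
    then have "2 * \<beta> i * (density_ratio (vs i) n * (\<Sum>\<alpha>\<in>edges (G i). pder (vs i) n \<alpha> (edges (G i) - {\<alpha>}) 0 x a e))
        \<le> 2 * \<beta> i * (2 * (card (edges (G i)) * (2 * card (edges (G i)) / (real n - 2))))"
      using \<beta>[OF i] by (intro mult_left_mono) auto
    then show ?thesis by (simp add: power2_eq_square mult.assoc)
  qed simp
  then show ?thesis
    unfolding field_insert[OF a e] gradient_const_def sum_divide_distrib by (rule sum_mono)
qed

text \<open>The generator applied to a density, that is \<open>card CE\<close> times its expected
  change in one step.\<close>

definition drift :: "'v set \<Rightarrow> 'v set \<Rightarrow> 'v set set \<Rightarrow> real \<Rightarrow> nat set set \<Rightarrow> nat set \<Rightarrow> real" where
  "drift V \<alpha> B \<tau> x e = (\<Sum>a\<in>CE. upd a (\<lambda>y. dens V n \<alpha> B \<tau> y e) x - dens V n \<alpha> B \<tau> x e)"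

lemma upd_dens:
  assumes "valid i \<alpha> B"
  shows "upd a (\<lambda>y. dens (vs i) n \<alpha> B \<tau> y e) x - dens (vs i) n \<alpha> B \<tau> x e =
    (rate a x + (1 - rate a x) * \<tau> - wt \<tau> x a) * pder (vs i) n \<alpha> B \<tau> x e a"
proof -
  interpret rooted_graph "vs i" n \<alpha> B by (rule rooted_graph[OF assms])
  have 1: "dens (vs i) n \<alpha> B \<tau> (insert a x) e = dens (vs i) n \<alpha> B \<tau> x e +
      (1 - wt \<tau> x a) * pder (vs i) n \<alpha> B \<tau> x e a"
    using dens_flip[of a "insert a x" x \<tau> e] by (simp add: wt_def[of \<tau> "insert a x"])
  have 2: "dens (vs i) n \<alpha> B \<tau> (x - {a}) e = dens (vs i) n \<alpha> B \<tau> x e +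
      (\<tau> - wt \<tau> x a) * pder (vs i) n \<alpha> B \<tau> x e a"
    using dens_flip[of a "x - {a}" x \<tau> e] by (simp add: wt_def[of \<tau> "x - {a}"])
  show ?thesis unfolding upd_def 1 2 by (simp add: algebra_simps)
qed

lemma drift_eq:
  assumes v: "valid i \<alpha> B"
  shows "drift (vs i) \<alpha> B \<tau> x e =
    (\<Sum>a\<in>CE. (rate a x + (1 - rate a x) * \<tau>) * pder (vs i) n \<alpha> B \<tau> x e a)
    - card B * dens (vs i) n \<alpha> B \<tau> x e"
  unfolding drift_def upd_dens[OF v] left_diff_distrib sum_subtractf
    rooted_graph.sum_wt_pder[OF rooted_graph[OF v]] ..

text \<open>By Euler's identity a density is lost at rate \<open>card B\<close>. The gain has one
  term per edge \<open>b\<close> of \<open>B\<close>: a density without \<open>b\<close> times the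
  probability that the image of \<open>b\<close> gets added, where the weight of absent edges raises
  this probability by at most \<tau>.\<close>

lemma drift_bounds:
  assumes ctrl: "controlled \<tau> r R x" and \<tau>: "0 \<le> \<tau>" "\<tau> \<le> 1" and v: "valid i \<alpha> B" and e: "e \<in> CE"
    and P: "\<And>a. a \<in> CE \<Longrightarrow> rate a x + \<tau> \<le> P" "\<And>a. a \<in> CE \<Longrightarrow> p \<le> rate a x" "0 \<le> p"
  shows "drift (vs i) \<alpha> B \<tau> x e \<le> card B * (P * R ^ (card B - 1) - dens (vs i) n \<alpha> B \<tau> x e)"
    "card B * (p * r ^ (card B - 1) - dens (vs i) n \<alpha> B \<tau> x e) \<le> drift (vs i) \<alpha> B \<tau> x e"
proof -
  interpret rooted_graph "vs i" n \<alpha> B by (rule rooted_graph[OF v])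
  have P0: "0 \<le> P"
    using P(1) CE_ne \<tau> rate_pos by (meson add_nonneg_nonneg ex_in_conv less_imp_le order_trans)
  have q: "rate a x + (1 - rate a x) * \<tau> \<le> P" "p \<le> rate a x + (1 - rate a x) * \<tau>" if "a \<in> CE" for a
  proof -
    have "0 \<le> (1 - rate a x) * \<tau>" "(1 - rate a x) * \<tau> \<le> \<tau>"
      using \<tau> rate_pos[of a x] rate_less_1[of a x] mult_right_mono[of "1 - rate a x" 1 \<tau>] by auto
    then show "rate a x + (1 - rate a x) * \<tau> \<le> P" "p \<le> rate a x + (1 - rate a x) * \<tau>"
      using P that by fastforce+
  qed
  have card: "card (B - {b}) = card B - 1" if "b \<in> B" for b
    using that finite_B by simp
  have "(\<Sum>b\<in>B. dens (vs i) n \<alpha> (B - {b}) \<tau> x e) \<le> card B * R ^ (card B - 1)"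
    by (rule sum_bounded_above) (use controlledD(2)[OF ctrl valid_remove[OF v] e] card in metis)
  then have "P * (\<Sum>b\<in>B. dens (vs i) n \<alpha> (B - {b}) \<tau> x e) \<le> P * (card B * R ^ (card B - 1))"
    using P0 by (rule mult_left_mono)
  moreover have "(\<Sum>a\<in>CE. (rate a x + (1 - rate a x) * \<tau>) * pder (vs i) n \<alpha> B \<tau> x e a)
      \<le> P * (\<Sum>b\<in>B. dens (vs i) n \<alpha> (B - {b}) \<tau> x e)"
    by (rule sum_pder_le) (use \<tau> q in auto)
  ultimately show "drift (vs i) \<alpha> B \<tau> x e \<le> card B * (P * R ^ (card B - 1) - dens (vs i) n \<alpha> B \<tau> x e)"
    unfolding drift_eq[OF v] by (simp add: right_diff_distrib mult_ac)
  have "card B * r ^ (card B - 1) \<le> (\<Sum>b\<in>B. dens (vs i) n \<alpha> (B - {b}) \<tau> x e)"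
    by (rule sum_bounded_below) (use controlledD(1)[OF ctrl valid_remove[OF v] e] card in metis)
  then have "p * (card B * r ^ (card B - 1)) \<le> p * (\<Sum>b\<in>B. dens (vs i) n \<alpha> (B - {b}) \<tau> x e)"
    using P(3) by (rule mult_left_mono)
  moreover have "p * (\<Sum>b\<in>B. dens (vs i) n \<alpha> (B - {b}) \<tau> x e) \<le>
      (\<Sum>a\<in>CE. (rate a x + (1 - rate a x) * \<tau>) * pder (vs i) n \<alpha> B \<tau> x e a)"
    by (rule sum_pder_ge) (use \<tau> q in auto)
  ultimately show "card B * (p * r ^ (card B - 1) - dens (vs i) n \<alpha> B \<tau> x e) \<le> drift (vs i) \<alpha> B \<tau> x e"
    unfolding drift_eq[OF v] by (simp add: right_diff_distrib mult_ac)
qed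

end

section \<open>A Lyapunov weight\<close>

lemma exp_le_quadratic:
  fixes w :: real
  assumes "\<bar>w\<bar> \<le> 1"
  shows "exp w \<le> 1 + w + w\<^sup>2"
proof (cases "0 \<le> w")
  case True
  then show ?thesis using exp_bound[of w] assms by simp
next
  case False
  define v where "v = - w"
  have v: "0 < v" "v \<le> 1" using False assms by (auto simp: v_def)
  \<comment> \<open>The product equals \<open>1 + v ^ 3\<close>.\<close>
  have "1 \<le> (1 - v + v\<^sup>2) * (1 + v)"
    using v by (simp add: algebra_simps power2_eq_square)
  also have "\<dots> \<le> (1 - v + v\<^sup>2) * exp v"
  proof (rule mult_left_mono[OF exp_ge_add_one_self])
    show "0 \<le> 1 - v + v\<^sup>2" using v by (simp add: add_nonneg_nonneg)
  qed
  finally have "exp (- v) \<le> 1 - v + v\<^sup>2"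
    by (simp add: exp_minus divide_simps)
  then show ?thesis by (simp add: v_def)
qed

text \<open>Measures how a relative change \<open>s\<close> of a density acts on its power of
  exponent \<mu>. The 6 is 2 from replacing \<open>ln (1 + s)\<close> by \<open>s\<close> plus 4
  from the square in the exponential; \<open>\<bar>\<mu>\<bar> \<ge> 1\<close> absorbs the former
  into \<mu> squared.\<close>

lemma exp_ln_expansion:
  fixes \<mu> s :: real
  assumes "1 \<le> \<bar>\<mu>\<bar>" "\<bar>\<mu> * s\<bar> \<le> 1 / 4"
  shows "exp (\<mu> * ln (1 + s)) \<le> 1 + \<mu> * s + 6 * \<mu>\<^sup>2 * s\<^sup>2"
proof -
  have "\<bar>s\<bar> \<le> \<bar>\<mu>\<bar> * \<bar>s\<bar>"
    using assms(1) mult_right_mono[of 1 "\<bar>\<mu>\<bar>" "\<bar>s\<bar>"] by simp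
  then have s: "\<bar>s\<bar> \<le> 1 / 4" using assms(2) by (simp add: abs_mult)
  define r where "r = ln (1 + s) - s"
  have r: "\<bar>r\<bar> \<le> 2 * s\<^sup>2"
    using abs_ln_one_plus_x_minus_x_bound[of s] s by (simp add: r_def)
  define w where "w = \<mu> * ln (1 + s)"
  have w: "w = \<mu> * s + \<mu> * r" by (simp add: w_def r_def algebra_simps)
  have mr: "\<bar>\<mu> * r\<bar> \<le> 2 * \<mu>\<^sup>2 * s\<^sup>2"
  proof -
    have "\<bar>\<mu>\<bar> * 1 \<le> \<bar>\<mu>\<bar> * \<bar>\<mu>\<bar>" using assms(1) by (intro mult_left_mono) auto
    then have "\<bar>\<mu>\<bar> * \<bar>r\<bar> \<le> (\<bar>\<mu>\<bar> * \<bar>\<mu>\<bar>) * (2 * s\<^sup>2)"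
      using r by (intro mult_mono) auto
    then show ?thesis by (simp add: abs_mult power2_eq_square mult_ac)
  qed
  have ms: "(\<mu> * s)\<^sup>2 \<le> \<bar>\<mu> * s\<bar> * (1 / 4)"
    using mult_left_mono[OF assms(2), of "\<bar>\<mu> * s\<bar>"] by (simp add: power2_eq_square abs_mult mult_ac)
  have w2: "\<bar>w\<bar> \<le> 2 * \<bar>\<mu> * s\<bar>"
    using mr ms unfolding w by (simp add: power_mult_distrib)
  then have "w\<^sup>2 \<le> (2 * \<bar>\<mu> * s\<bar>)\<^sup>2"
    by (metis abs_ge_zero power2_abs power_mono)
  then have w3: "w\<^sup>2 \<le> 4 * \<mu>\<^sup>2 * s\<^sup>2"
    by (simp add: power_mult_distrib)
  have "exp w \<le> 1 + w + w\<^sup>2"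
    using w2 assms(2) by (intro exp_le_quadratic) auto
  also have "\<dots> \<le> 1 + \<mu> * s + 6 * \<mu>\<^sup>2 * s\<^sup>2"
    using w3 mr w by (simp add: abs_le_iff)
  finally show ?thesis by (simp add: w_def)
qed

text \<open>Concavity: the tangent at \<open>Z\<close> lies above the power. It reduces the drift of
  \<open>W\<close> to that of the soft maximum inside.\<close>

lemma powr_tangent:
  fixes z Z \<kappa> :: real
  assumes "0 < Z" "0 < z" "0 \<le> \<kappa>" "\<kappa> \<le> 1"
  shows "z powr \<kappa> \<le> Z powr \<kappa> + \<kappa> * (Z powr \<kappa> / Z) * (z - Z)"
proof -
  have "(z / Z) powr \<kappa> * 1 powr (1 - \<kappa>) \<le> \<kappa> * (z / Z) + (1 - \<kappa>) * 1"
    using assms by (intro Youngs_inequality_0) auto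
  then have "Z powr \<kappa> * (z / Z) powr \<kappa> \<le> Z powr \<kappa> * (\<kappa> * (z / Z) + (1 - \<kappa>))"
    by (intro mult_left_mono) auto
  moreover have "Z powr \<kappa> * (z / Z) powr \<kappa> = z powr \<kappa>"
    using assms by (simp add: powr_divide)
  ultimately show ?thesis using assms by (simp add: field_simps)
qed

text \<open>Indices more than \<eta> below \<rho> have normalised weight at most
  \<open>exp (- (l * \<eta>))\<close>. The summand 1 of \<open>Z\<close> acts as one more index with
  value 0 and \<open>g = 0\<close>; for negative \<open>N\<close> it has to be far from the top as
  well, hence the alternative \<open>\<eta> \<le> \<rho>\<close>.\<close>

lemma soft_max_average:
  fixes y g :: "'j \<Rightarrow> real" and J :: "'j set" and Z l :: real
  defines "Z \<equiv> 1 + (\<Sum>j\<in>J. exp (l * y j))"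
  assumes J: "finite J" and l: "0 \<le> l"
    and y: "\<And>j. j \<in> J \<Longrightarrow> y j \<le> \<rho>" "exp (l * \<rho>) \<le> Z"
    and near: "\<And>j. j \<in> J \<Longrightarrow> \<rho> - \<eta> \<le> y j \<Longrightarrow> g j \<le> N"
    and far: "\<And>j. j \<in> J \<Longrightarrow> g j \<le> M" "0 \<le> M"
    and N: "0 \<le> N \<or> \<eta> \<le> \<rho>"
  shows "(\<Sum>j\<in>J. exp (l * y j) / Z * g j) \<le> N + (\<bar>N\<bar> + M) * ((card J + 1) * exp (- (l * \<eta>)))"
proof -
  have Z: "0 < Z" unfolding Z_def by (intro add_pos_nonneg sum_nonneg) auto
  have one: "exp (l * y j) / Z * g j \<le> exp (l * y j) / Z * N + (\<bar>N\<bar> + M) * exp (- (l * \<eta>))"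
    if j: "j \<in> J" for j
  proof (cases "\<rho> - \<eta> \<le> y j")
    case True
    then have "exp (l * y j) / Z * g j \<le> exp (l * y j) / Z * N"
      using near[OF j] Z by (intro mult_left_mono) auto
    moreover have "0 \<le> (\<bar>N\<bar> + M) * exp (- (l * \<eta>))" using far(2) by simp
    ultimately show ?thesis by linarith
  next
    case False
    then have "l * y j \<le> l * (\<rho> - \<eta>)" using l by (intro mult_left_mono) auto
    then have "exp (l * y j) \<le> exp (l * \<rho>) * exp (- (l * \<eta>))"
      by (simp add: right_diff_distrib flip: exp_add)
    also have "\<dots> \<le> Z * exp (- (l * \<eta>))" using y(2) by (intro mult_right_mono) auto
    finally have "exp (l * y j) / Z \<le> exp (- (l * \<eta>))" using Z by (simp add: field_simps)
    then have "(\<bar>N\<bar> + M) * (exp (l * y j) / Z) \<le> (\<bar>N\<bar> + M) * exp (- (l * \<eta>))"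
      using far(2) by (intro mult_left_mono) auto
    moreover have "exp (l * y j) / Z * (g j - N) \<le> exp (l * y j) / Z * (\<bar>N\<bar> + M)"
      using far(1)[OF j] Z by (intro mult_left_mono) auto
    ultimately have "exp (l * y j) / Z * g j - exp (l * y j) / Z * N \<le> (\<bar>N\<bar> + M) * exp (- (l * \<eta>))"
      unfolding right_diff_distrib mult.commute[of "exp (l * y j) / Z" "\<bar>N\<bar> + M"] by (rule order_trans[rotated])
    then show ?thesis by (simp only: diff_le_eq add.commute)
  qed
  have "(\<Sum>j\<in>J. exp (l * y j) / Z * g j) \<le>
      (\<Sum>j\<in>J. exp (l * y j) / Z * N + (\<bar>N\<bar> + M) * exp (- (l * \<eta>)))"
    by (rule sum_mono) (rule one)
  also have "\<dots> = (\<Sum>j\<in>J. exp (l * y j)) / Z * N + card J * ((\<bar>N\<bar> + M) * exp (- (l * \<eta>)))"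
    by (simp add: sum.distrib sum_distrib_right sum_divide_distrib)
  also have "(\<Sum>j\<in>J. exp (l * y j)) / Z = 1 - 1 / Z"
    using Z by (simp add: Z_def field_simps)
  also have "(1 - 1 / Z) * N \<le> N + \<bar>N\<bar> * exp (- (l * \<eta>))"
  proof (cases "0 \<le> N")
    case True
    then have "0 \<le> 1 / Z * N" "0 \<le> \<bar>N\<bar> * exp (- (l * \<eta>))" using Z by auto
    then show ?thesis unfolding left_diff_distrib by linarith
  next
    case False
    then have "l * \<eta> \<le> l * \<rho>" using N l by (intro mult_left_mono) auto
    then have "exp (l * \<eta>) \<le> Z" using y(2) by (meson exp_le_cancel_iff order_trans)
    then have "1 / Z \<le> exp (- (l * \<eta>))"
      using Z by (simp add: exp_minus field_simps)
    then have "1 / Z * (- N) \<le> exp (- (l * \<eta>)) * (- N)"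
      using False by (intro mult_right_mono) auto
    moreover have "\<bar>N\<bar> = - N" using False by simp
    ultimately show ?thesis unfolding left_diff_distrib by (simp add: mult.commute)
  qed
  also have "N + \<bar>N\<bar> * exp (- (l * \<eta>)) + card J * ((\<bar>N\<bar> + M) * exp (- (l * \<eta>))) \<le>
      N + (\<bar>N\<bar> + M) * ((card J + 1) * exp (- (l * \<eta>)))"
    using far(2) by (simp add: algebra_simps)
  finally show ?thesis by simp
qed

text \<open>A crude common bound for the degrees of all densities. The added 1 keeps it positive, so
  that \<open>l\<close> is at least 1.\<close>

definition max_degree :: "nat \<Rightarrow> (nat \<Rightarrow> 'v sgraph) \<Rightarrow> nat" where
  "max_degree s G = 1 + (\<Sum>i=1..s. card (edges (G i)))"

text \<open>\<open>log_slope s G \<tau> / (n - 2)\<close> bounds the change of the logarithm of a density under a flip.\<close>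

definition log_slope :: "nat \<Rightarrow> (nat \<Rightarrow> 'v sgraph) \<Rightarrow> real \<Rightarrow> real" where
  "log_slope s G \<tau> = 2 * max_degree s G / \<tau> ^ max_degree s G"

section \<open>Smoothness and generator of the weight\<close>

locale lyapunov = ergm_size s G \<beta> n
  for s :: nat and G :: "nat \<Rightarrow> 'v sgraph" and \<beta> :: "nat \<Rightarrow> real" and n :: nat +
  fixes \<tau> p l K :: real
  assumes \<tau>: "0 < \<tau>" "\<tau> \<le> 1" and p: "0 < p" and K: "0 < K" "K \<le> l"
    and l: "max_degree s G \<le> l" "l * (log_slope s G \<tau> / (real n - 2)) \<le> 1 / 4"
begin

definition patterns :: "(nat \<times> 'v set \<times> 'v set set) set" where
  "patterns = {(i, \<alpha>, B). valid i \<alpha> B \<and> B \<noteq> {}}"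

text \<open>The signs make both an excess and a deficit of a density count as a deviation.\<close>

definition indices :: "((nat \<times> 'v set \<times> 'v set set) \<times> nat set \<times> real) set" where
  "indices = patterns \<times> CE \<times> {1, - 1}"

fun density :: "(nat \<times> 'v set \<times> 'v set set) \<times> nat set \<times> real \<Rightarrow> nat set set \<Rightarrow> real" where
  "density ((i, \<alpha>, B), e, \<sigma>) x = dens (vs i) n \<alpha> B \<tau> x e"

fun slope :: "(nat \<times> 'v set \<times> 'v set set) \<times> nat set \<times> real \<Rightarrow> nat set set \<Rightarrow> nat set \<Rightarrow> real" where
  "slope ((i, \<alpha>, B), e, \<sigma>) x a = pder (vs i) n \<alpha> B \<tau> x e a"

fun expo :: "(nat \<times> 'v set \<times> 'v set set) \<times> nat set \<times> real \<Rightarrow> real" where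
  "expo ((i, \<alpha>, B), e, \<sigma>) = \<sigma> / card B"

fun dev :: "(nat \<times> 'v set \<times> 'v set set) \<times> nat set \<times> real \<Rightarrow> nat set set \<Rightarrow> real" where
  "dev ((i, \<alpha>, B), e, \<sigma>) x = \<sigma> * (ln (dens (vs i) n \<alpha> B \<tau> x e) / card B - ln p)"

definition Z :: "nat set set \<Rightarrow> real" where
  "Z x = 1 + (\<Sum>j\<in>indices. exp (l * dev j x))"

text \<open>
  A power of a soft maximum of the deviations \<open>\<bar>ln (dens / p ^ k)\<bar> / k\<close>. Since \<open>l\<close> will be \<open>sqrt n\<close>, it is both
  dominated by the largest deviation (there are only \<open>O(n\<^sup>2)\<close> of them) and smooth: a flip changes \<open>l * dev\<close> by \<open>O(l / n)\<close>.
\<close>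

definition W :: "nat set set \<Rightarrow> real" where
  "W x = Z x powr (K / l)"

definition \<epsilon> :: real where
  "\<epsilon> = log_slope s G \<tau> / (real n - 2)"

lemma finite_patterns: "finite patterns"
proof -
  have "patterns \<subseteq> (\<Union>i\<in>{1..s}. {i} \<times> edges (G i) \<times> Pow (edges (G i)))"
    by (auto simp: patterns_def valid_def)
  then show ?thesis
    by (rule finite_subset) (simp add: finite_edges)
qed

lemma finite_indices: "finite indices"
  by (simp add: indices_def finite_patterns)

lemma card_indices: "card indices = 2 * card patterns * card CE"
  by (simp add: indices_def card_cartesian_product card_insert_if)

lemma card_le_max_degree: "valid i \<alpha> B \<Longrightarrow> card B \<le> max_degree s G"
proof -
  assume v: "valid i \<alpha> B"
  then have i: "i \<in> {1..s}" by (simp add: valid_def)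
  have "card B \<le> card (edges (G i))"
    using v finite_edges[OF i] by (intro card_mono) (auto simp: valid_def)
  also have "\<dots> \<le> (\<Sum>i=1..s. card (edges (G i)))"
    using i by (intro member_le_sum) auto
  finally show ?thesis by (simp add: max_degree_def)
qed

lemma card_pos: "valid i \<alpha> B \<Longrightarrow> B \<noteq> {} \<Longrightarrow> 0 < card B"
  using rooted_graph.finite_B[OF rooted_graph] by (simp add: card_gt_0_iff)

lemma dens_ge:
  assumes "valid i \<alpha> B" "e \<in> CE"
  shows "\<tau> ^ max_degree s G \<le> dens (vs i) n \<alpha> B \<tau> x e"
    "\<tau> ^ card B \<le> dens (vs i) n \<alpha> B \<tau> x e" "0 < dens (vs i) n \<alpha> B \<tau> x e"
    "dens (vs i) n \<alpha> B \<tau> x e \<le> 1"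
proof -
  show 1: "\<tau> ^ card B \<le> dens (vs i) n \<alpha> B \<tau> x e" "dens (vs i) n \<alpha> B \<tau> x e \<le> 1"
    using rooted_graph.dens_bounds[OF rooted_graph[OF assms(1)] assms(2), of \<tau> x] \<tau> by auto
  then show "0 < dens (vs i) n \<alpha> B \<tau> x e"
    using \<tau> zero_less_power[of \<tau> "card B"] by linarith
  have "\<tau> ^ max_degree s G \<le> \<tau> ^ card B"
    using \<tau> by (intro power_decreasing card_le_max_degree[OF assms(1)]) auto
  then show "\<tau> ^ max_degree s G \<le> dens (vs i) n \<alpha> B \<tau> x e" using 1 by linarith
qed

lemma indicesE:
  assumes "j \<in> indices"
  obtains i \<alpha> B e \<sigma> where "j = ((i, \<alpha>, B), e, \<sigma>)" "valid i \<alpha> B" "B \<noteq> {}" "e \<in> CE" "\<sigma> = 1 \<or> \<sigma> = - 1"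
proof -
  obtain i \<alpha> B e \<sigma> where j: "j = ((i, \<alpha>, B), e, \<sigma>)" by (metis prod.exhaust)
  show thesis
    by (rule that[OF j]) (use assms in \<open>simp_all add: j indices_def patterns_def\<close>)
qed

lemma density_pos: "j \<in> indices \<Longrightarrow> 0 < density j x"
  by (erule indicesE) (simp add: dens_ge)

lemma slope_nonneg: "j \<in> indices \<Longrightarrow> 0 \<le> slope j x a"
  by (erule indicesE) (use \<tau> in \<open>simp add: rooted_graph.pder_nonneg[OF rooted_graph]\<close>)

lemma slope_le:
  assumes "j \<in> indices"
  shows "slope j x a / density j x \<le> \<epsilon>"
  using assms
proof (rule indicesE)
  fix i \<alpha> B e \<sigma>
  assume j: "j = ((i, \<alpha>, B), e, \<sigma>)" "valid i \<alpha> B" "B \<noteq> {}" "e \<in> CE"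
  have "pder (vs i) n \<alpha> B \<tau> x e a \<le> 2 * card B / (real n - 2)"
    using \<tau> by (intro rooted_graph.pder_le[OF rooted_graph] j) auto
  also have "\<dots> \<le> 2 * max_degree s G / (real n - 2)"
    using size(2) card_le_max_degree[OF j(2)] by (intro divide_right_mono) auto
  finally have "slope j x a / density j x \<le> 2 * max_degree s G / (real n - 2) / \<tau> ^ max_degree s G"
    unfolding j slope.simps density.simps
    using dens_ge[OF j(2,4), of x] \<tau> size(2) by (intro frac_le) auto
  then show ?thesis by (simp add: \<epsilon>_def log_slope_def mult.commute)
qed

lemma sum_slope_le:
  assumes "j \<in> indices"
  shows "(\<Sum>a\<in>CE. slope j x a / density j x) \<le> log_slope s G \<tau>"
  using assms
proof (rule indicesE)
  fix i \<alpha> B e \<sigma>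
  assume j: "j = ((i, \<alpha>, B), e, \<sigma>)" "valid i \<alpha> B" "B \<noteq> {}" "e \<in> CE"
  interpret rg: rooted_graph "vs i" n \<alpha> B by (rule rooted_graph[OF j(2)])
  have "(\<Sum>a\<in>CE. 1 * pder (vs i) n \<alpha> B \<tau> x e a) \<le> 1 * (\<Sum>b\<in>B. dens (vs i) n \<alpha> (B - {b}) \<tau> x e)"
    using \<tau> by (intro rg.sum_pder_le) auto
  also have "\<dots> \<le> card B"
    using sum_bounded_above[of B "\<lambda>b. dens (vs i) n \<alpha> (B - {b}) \<tau> x e" 1]
      dens_ge(4)[OF valid_remove[OF j(2)] j(4)] by simp
  also have "\<dots> \<le> 2 * max_degree s G" using card_le_max_degree[OF j(2)] by simp
  finally have "(\<Sum>a\<in>CE. slope j x a) \<le> 2 * max_degree s G" by (simp add: j)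
  then have "(\<Sum>a\<in>CE. slope j x a) / density j x \<le> 2 * max_degree s G / \<tau> ^ max_degree s G"
    using dens_ge[OF j(2,4), of x] \<tau> unfolding j(1) density.simps by (intro frac_le) auto
  then show ?thesis by (simp add: log_slope_def sum_divide_distrib)
qed

lemma n_gt: "0 < real n - 2" using size(2) by simp

lemma \<epsilon>_nonneg: "0 \<le> \<epsilon>" and l_pos: "1 \<le> l" and l\<epsilon>: "l * \<epsilon> \<le> 1 / 4"
proof -
  show "0 \<le> \<epsilon>" using n_gt \<tau> by (simp add: \<epsilon>_def log_slope_def)
  have "1 \<le> real (max_degree s G)" by (simp add: max_degree_def sum_nonneg)
  then show "1 \<le> l" using l(1) by linarith
  show "l * \<epsilon> \<le> 1 / 4" using l(2) by (simp only: \<epsilon>_def)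
qed

lemma expo_bounds:
  assumes "j \<in> indices"
  shows "1 \<le> \<bar>l * expo j\<bar>" "\<bar>l * expo j\<bar> \<le> l"
  using assms
proof (rule_tac [!] indicesE)
  fix i \<alpha> B e \<sigma>
  assume j: "j = ((i, \<alpha>, B), e, \<sigma>)" "valid i \<alpha> B" "B \<noteq> {}" "\<sigma> = 1 \<or> \<sigma> = - 1"
  have k: "0 < card B" "card B \<le> l"
    using card_pos[OF j(2,3)] card_le_max_degree[OF j(2)] l(1) by auto
  have e: "\<bar>l * expo j\<bar> = l / card B" using j l_pos by (auto simp: abs_mult)
  show "1 \<le> \<bar>l * expo j\<bar>" "\<bar>l * expo j\<bar> \<le> l"
    unfolding e using k l_pos by (simp_all add: le_divide_eq divide_le_eq)
qed

text \<open>Symmetric and satisfied when the update changes nothing, so one upper bound for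
  \<open>W\<close> also yields the lower bound.\<close>

definition is_flip :: "nat set \<Rightarrow> nat set set \<Rightarrow> nat set set \<Rightarrow> bool" where
  "is_flip a x y \<longleftrightarrow> y = insert a x \<or> y = x - {a} \<or> x = insert a y \<or> x = y - {a}"

text \<open>The first bound keeps the linear term, which averages to the drift; the second is the
  crude smoothness estimate. Its 3 covers 1 from the linear term and 6/4 from the quadratic one, as
  \<open>l * \<epsilon> \<le> 1 / 4\<close>.\<close>

lemma exp_dev_flip:
  assumes j: "j \<in> indices" and y: "is_flip a x y"
  shows "exp (l * dev j y) \<le> exp (l * dev j x) *
      (1 + l * expo j * ((density j y - density j x) / density j x) + 6 * l\<^sup>2 * (slope j x a / density j x)\<^sup>2)"
    "exp (l * dev j y) \<le> exp (l * dev j x) * (1 + 3 * (l * \<epsilon>))"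
proof -
  define q where "q = (density j y - density j x) / density j x"
  let ?\<mu> = "l * expo j"
  have pos: "0 < density j x" "0 < density j y" using j by (auto simp: density_pos)
  have dy: "density j y = density j x * (1 + q)" using pos by (simp add: q_def field_simps)
  then have q1: "0 < 1 + q" using pos zero_less_mult_pos by metis
  have "\<bar>density j y - density j x\<bar> \<le> slope j x a"
    using j
  proof (rule indicesE)
    fix i \<alpha> B e \<sigma>
    assume j: "j = ((i, \<alpha>, B), e, \<sigma>)" "valid i \<alpha> B" "B \<noteq> {}" "e \<in> CE"
    interpret rg: rooted_graph "vs i" n \<alpha> B by (rule rooted_graph[OF j(2)])
    have "density j y - density j x = (wt \<tau> y a - wt \<tau> x a) * slope j x a"
      using y unfolding j(1) density.simps slope.simps is_flip_def
      by (subst rg.dens_flip[of a y x]) auto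
    moreover have "\<bar>wt \<tau> y a - wt \<tau> x a\<bar> \<le> 1" using \<tau> by (auto simp: wt_def)
    ultimately show ?thesis
      using slope_nonneg[OF assms(1), of x a] mult_right_mono[of "\<bar>wt \<tau> y a - wt \<tau> x a\<bar>" 1 "slope j x a"]
      by (simp add: abs_mult)
  qed
  then have q2: "\<bar>q\<bar> \<le> slope j x a / density j x"
    using pos by (simp add: q_def divide_right_mono)
  then have q3: "\<bar>q\<bar> \<le> \<epsilon>" using slope_le[OF j, of x a] by linarith
  have "l * dev j y = l * dev j x + ?\<mu> * ln (1 + q)"
    using j
  proof (rule indicesE)
    fix i \<alpha> B e \<sigma>
    assume j: "j = ((i, \<alpha>, B), e, \<sigma>)" "valid i \<alpha> B" "B \<noteq> {}" "e \<in> CE"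
    have "ln (density j y) = ln (density j x) + ln (1 + q)"
      unfolding dy using pos q1 by (simp add: ln_mult)
    then show ?thesis using card_pos[OF j(2,3)] by (simp add: j(1) field_simps)
  qed
  then have e: "exp (l * dev j y) = exp (l * dev j x) * exp (?\<mu> * ln (1 + q))"
    by (simp add: exp_add)
  have \<mu>q: "\<bar>?\<mu> * q\<bar> \<le> l * \<epsilon>"
    unfolding abs_mult using expo_bounds[OF j] q3 l_pos by (intro mult_mono) (auto simp: abs_mult)
  have main: "exp (?\<mu> * ln (1 + q)) \<le> 1 + ?\<mu> * q + 6 * ?\<mu>\<^sup>2 * q\<^sup>2"
    using expo_bounds[OF j] \<mu>q l\<epsilon> by (intro exp_ln_expansion) auto
  have "?\<mu>\<^sup>2 \<le> l\<^sup>2"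
    using expo_bounds(2)[OF j] l_pos by (metis abs_ge_zero power2_abs power_mono)
  moreover have "q\<^sup>2 \<le> (slope j x a / density j x)\<^sup>2"
    using q2 by (metis abs_ge_zero power2_abs power_mono)
  ultimately have "?\<mu>\<^sup>2 * q\<^sup>2 \<le> l\<^sup>2 * (slope j x a / density j x)\<^sup>2"
    by (intro mult_mono) auto
  then have "exp (?\<mu> * ln (1 + q)) \<le> 1 + ?\<mu> * q + 6 * l\<^sup>2 * (slope j x a / density j x)\<^sup>2"
    using main by simp
  then show "exp (l * dev j y) \<le> exp (l * dev j x) *
      (1 + l * expo j * ((density j y - density j x) / density j x) + 6 * l\<^sup>2 * (slope j x a / density j x)\<^sup>2)"
    unfolding e q_def[symmetric] by (intro mult_left_mono) auto
  have "?\<mu>\<^sup>2 * q\<^sup>2 = \<bar>?\<mu> * q\<bar> * \<bar>?\<mu> * q\<bar>"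
    by (simp add: power2_eq_square mult_ac flip: abs_mult)
  also have "\<dots> \<le> (l * \<epsilon>) * (1 / 4)"
    using \<mu>q l\<epsilon> by (intro mult_mono) auto
  finally have "exp (?\<mu> * ln (1 + q)) \<le> 1 + 3 * (l * \<epsilon>)"
    using main \<mu>q by (simp add: abs_le_iff)
  then show "exp (l * dev j y) \<le> exp (l * dev j x) * (1 + 3 * (l * \<epsilon>))"
    unfolding e by (intro mult_left_mono) auto
qed

lemma Z_ge_1: "1 \<le> Z x"
  unfolding Z_def by (simp add: sum_nonneg)

lemma W_ge_1: "1 \<le> W x"
  unfolding W_def using Z_ge_1 K l_pos by (intro ge_one_powr_ge_zero) auto

lemma Z_flip: "is_flip a x y \<Longrightarrow> Z y \<le> Z x * (1 + 3 * (l * \<epsilon>))"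
proof -
  assume y: "is_flip a x y"
  have "(\<Sum>j\<in>indices. exp (l * dev j y)) \<le> (\<Sum>j\<in>indices. exp (l * dev j x) * (1 + 3 * (l * \<epsilon>)))"
    by (rule sum_mono) (rule exp_dev_flip(2)[OF _ y])
  moreover have "0 \<le> l * \<epsilon>" using l_pos \<epsilon>_nonneg by simp
  ultimately show ?thesis
    by (simp add: Z_def distrib_right flip: sum_distrib_right)
qed

lemma \<kappa>: "0 \<le> K / l" "K / l \<le> 1"
  using K l_pos by auto

text \<open>The exponent \<open>K / l\<close> cancels the factor \<open>l\<close> in the relative
  change of \<open>Z\<close>, so the relative change of \<open>W\<close> is of order
  \<open>K / n\<close> however large \<open>l\<close> is.\<close>

lemma W_flip:
  assumes "is_flip a x y"
  shows "W y \<le> (1 + 3 * K * \<epsilon>) * W x"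
proof -
  have "W y \<le> W x + K / l * (W x / Z x) * (Z y - Z x)"
    unfolding W_def using Z_ge_1[of x] Z_ge_1[of y] \<kappa> by (intro powr_tangent) auto
  also have "\<dots> \<le> W x + K / l * (W x / Z x) * (Z x * (3 * (l * \<epsilon>)))"
    using Z_flip[OF assms] Z_ge_1[of x] W_ge_1[of x] \<kappa>
    by (intro add_left_mono mult_left_mono mult_nonneg_nonneg) (auto simp: algebra_simps)
  also have "\<dots> = (1 + 3 * K * \<epsilon>) * W x"
    using Z_ge_1[of x] l_pos by (simp add: field_simps)
  finally show ?thesis .
qed

lemma is_flip_sym: "is_flip a x y \<Longrightarrow> is_flip a y x"
  by (auto simp: is_flip_def)

lemma W_flip_ge:
  assumes "is_flip a x y"
  shows "(1 - 3 * K * \<epsilon>) * W x \<le> W y"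
proof -
  have u: "0 \<le> 3 * K * \<epsilon>" using K \<epsilon>_nonneg by simp
  have "W x \<le> (1 + 3 * K * \<epsilon>) * W y" by (rule W_flip[OF is_flip_sym[OF assms]])
  show ?thesis
  proof (cases "3 * K * \<epsilon> \<le> 1")
    case True
    then have "(1 - 3 * K * \<epsilon>) * W x \<le> (1 - 3 * K * \<epsilon>) * ((1 + 3 * K * \<epsilon>) * W y)"
      using \<open>W x \<le> _\<close> by (intro mult_left_mono) auto
    also have "\<dots> = (1 - (3 * K * \<epsilon>)\<^sup>2) * W y" by (simp add: algebra_simps power2_eq_square)
    also have "\<dots> \<le> 1 * W y" using W_ge_1[of y] by (intro mult_right_mono) auto
    finally show ?thesis by simp
  next
    case False
    then have "(1 - 3 * K * \<epsilon>) * W x \<le> 0" using W_ge_1[of x] by (intro mult_nonpos_nonneg) auto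
    then show ?thesis using W_ge_1[of y] by linarith
  qed
qed

text \<open>To first order the drift of \<open>dev\<close>, since the logarithm divides the drift of
  the density by the density.\<close>

fun rel_drift :: "(nat \<times> 'v set \<times> 'v set set) \<times> nat set \<times> real \<Rightarrow> nat set set \<Rightarrow> real" where
  "rel_drift ((i, \<alpha>, B), e, \<sigma>) x =
     \<sigma> / card B * (drift (vs i) \<alpha> B \<tau> x e / dens (vs i) n \<alpha> B \<tau> x e)"

lemma generator_exp_dev:
  assumes j: "j \<in> indices"
  shows "(\<Sum>a\<in>CE. upd a (\<lambda>y. exp (l * dev j y)) x - exp (l * dev j x)) \<le>
    exp (l * dev j x) * (l * rel_drift j x + 6 * l\<^sup>2 * (\<epsilon> * log_slope s G \<tau>))"
proof -
  let ?g = "exp (l * dev j x)" and ?s = "\<lambda>a. slope j x a / density j x"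
  have one: "upd a (\<lambda>y. exp (l * dev j y)) x - ?g \<le>
      ?g * (l * expo j * ((upd a (density j) x - density j x) / density j x) + 6 * l\<^sup>2 * (?s a)\<^sup>2)" for a
  proof -
    have r: "0 \<le> rate a x" "0 \<le> 1 - rate a x" using rate_pos[of a x] rate_less_1[of a x] by auto
    have "upd a (\<lambda>y. exp (l * dev j y)) x \<le>
       rate a x * (?g * (1 + l * expo j * ((density j (insert a x) - density j x) / density j x) + 6 * l\<^sup>2 * (?s a)\<^sup>2)) +
       (1 - rate a x) * (?g * (1 + l * expo j * ((density j (x - {a}) - density j x) / density j x) + 6 * l\<^sup>2 * (?s a)\<^sup>2))"
      unfolding upd_def
      by (intro add_mono mult_left_mono r exp_dev_flip(1)[OF j]) (auto simp: is_flip_def)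
    also have "\<dots> = ?g + ?g * (l * expo j * ((upd a (density j) x - density j x) / density j x) + 6 * l\<^sup>2 * (?s a)\<^sup>2)"
      unfolding upd_def by (simp add: algebra_simps add_divide_distrib diff_divide_distrib)
    finally show ?thesis by simp
  qed
  \<comment> \<open>The largest slope times their sum: although there are of order n squared edges,
    the slopes have a bounded sum, so the squares only sum to order \<open>1 / n\<close>.\<close>
  have sq: "(\<Sum>a\<in>CE. (?s a)\<^sup>2) \<le> \<epsilon> * log_slope s G \<tau>"
  proof -
    have "(\<Sum>a\<in>CE. (?s a)\<^sup>2) \<le> (\<Sum>a\<in>CE. \<epsilon> * ?s a)"
      unfolding power2_eq_square
      using slope_le[OF j] slope_nonneg[OF j] density_pos[OF j, of x]
      by (intro sum_mono mult_right_mono) (auto intro: divide_nonneg_pos)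
    also have "\<dots> \<le> \<epsilon> * log_slope s G \<tau>"
      unfolding sum_distrib_left[symmetric]
      by (intro mult_left_mono sum_slope_le[OF j] \<epsilon>_nonneg)
    finally show ?thesis .
  qed
  have dr: "l * expo j * ((\<Sum>a\<in>CE. upd a (density j) x - density j x) / density j x) = l * rel_drift j x"
    using j
  proof (rule indicesE)
    fix i \<alpha> B e \<sigma> assume "j = ((i, \<alpha>, B), e, \<sigma>)"
    moreover have "density ((i, \<alpha>, B), e, \<sigma>) = (\<lambda>y. dens (vs i) n \<alpha> B \<tau> y e)" by auto
    ultimately show ?thesis by (simp add: drift_def)
  qed
  have "(\<Sum>a\<in>CE. upd a (\<lambda>y. exp (l * dev j y)) x - ?g) \<le>
      (\<Sum>a\<in>CE. ?g * (l * expo j * ((upd a (density j) x - density j x) / density j x) + 6 * l\<^sup>2 * (?s a)\<^sup>2))"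
    by (rule sum_mono) (rule one)
  also have "\<dots> = ?g * (l * expo j * ((\<Sum>a\<in>CE. upd a (density j) x - density j x) / density j x) + 6 * l\<^sup>2 * (\<Sum>a\<in>CE. (?s a)\<^sup>2))"
    by (simp only: sum_distrib_left[symmetric] sum.distrib sum_divide_distrib[symmetric])
  also have "\<dots> \<le> ?g * (l * rel_drift j x + 6 * l\<^sup>2 * (\<epsilon> * log_slope s G \<tau>))"
    unfolding dr using sq by (intro mult_left_mono add_left_mono) auto
  finally show ?thesis .
qed

text \<open>The tangent inequality passes from \<open>W\<close> to \<open>Z\<close>, where the
  generator acts on each exponential separately. The prefactor \<open>K / l\<close> turns
  \<open>l * rel_drift\<close> into \<open>K\<close> times an average of the relative drifts in
  which large deviations dominate.\<close>

lemma generator_W: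
  "(\<Sum>a\<in>CE. upd a W x - W x) \<le> W x * (K * (\<Sum>j\<in>indices. exp (l * dev j x) / Z x * rel_drift j x)
     + 6 * K * l * \<epsilon> * log_slope s G \<tau>)"
proof -
  let ?c = "6 * l\<^sup>2 * (\<epsilon> * log_slope s G \<tau>)"
  have c: "0 \<le> ?c" using \<epsilon>_nonneg \<tau> by (simp add: log_slope_def)
  have Z: "1 \<le> Z x" by (rule Z_ge_1)
  have one: "upd a W x - W x \<le> K / l * (W x / Z x) * (upd a Z x - Z x)" for a
  proof -
    have r: "0 \<le> rate a x" "0 \<le> 1 - rate a x" using rate_pos[of a x] rate_less_1[of a x] by auto
    have t: "W y \<le> W x + K / l * (W x / Z x) * (Z y - Z x)" for y
      unfolding W_def using Z_ge_1[of x] Z_ge_1[of y] \<kappa> by (intro powr_tangent) auto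
    have "upd a W x \<le> rate a x * (W x + K / l * (W x / Z x) * (Z (insert a x) - Z x)) +
       (1 - rate a x) * (W x + K / l * (W x / Z x) * (Z (x - {a}) - Z x))"
      unfolding upd_def by (intro add_mono mult_left_mono r t)
    also have "\<dots> = W x + K / l * (W x / Z x) * (upd a Z x - Z x)"
    proof -
      have "r * (w + c * (z1 - z)) + (1 - r) * (w + c * (z2 - z)) = w + c * (r * z1 + (1 - r) * z2 - z)"
        for r w c z z1 z2 :: real
        by (simp add: algebra_simps)
      then show ?thesis unfolding upd_def .
    qed
    finally show ?thesis by simp
  qed
  have upd_Z: "upd a Z x - Z x = (\<Sum>j\<in>indices. upd a (\<lambda>y. exp (l * dev j y)) x - exp (l * dev j x))" for a
    unfolding upd_def Z_def
    by (simp add: sum.distrib sum_subtractf sum_distrib_left algebra_simps)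
  have "(\<Sum>a\<in>CE. upd a Z x - Z x) =
      (\<Sum>j\<in>indices. \<Sum>a\<in>CE. upd a (\<lambda>y. exp (l * dev j y)) x - exp (l * dev j x))"
    unfolding upd_Z by (rule sum.swap)
  also have "\<dots> \<le> (\<Sum>j\<in>indices. exp (l * dev j x) * (l * rel_drift j x + ?c))"
    by (rule sum_mono) (rule generator_exp_dev)
  also have "\<dots> = l * (\<Sum>j\<in>indices. exp (l * dev j x) * rel_drift j x) + ?c * (\<Sum>j\<in>indices. exp (l * dev j x))"
    by (simp add: distrib_left sum.distrib sum_distrib_left mult_ac)
  also have "\<dots> \<le> l * (\<Sum>j\<in>indices. exp (l * dev j x) * rel_drift j x) + ?c * Z x"
    using c by (intro add_left_mono mult_left_mono) (auto simp: Z_def)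
  finally have gz: "(\<Sum>a\<in>CE. upd a Z x - Z x) \<le>
    l * (\<Sum>j\<in>indices. exp (l * dev j x) * rel_drift j x) + ?c * Z x" .
  have "(\<Sum>a\<in>CE. upd a W x - W x) \<le> (\<Sum>a\<in>CE. K / l * (W x / Z x) * (upd a Z x - Z x))"
    by (rule sum_mono) (rule one)
  also have "\<dots> = K / l * (W x / Z x) * (\<Sum>a\<in>CE. upd a Z x - Z x)"
    by (simp only: sum_distrib_left)
  also have "\<dots> \<le> K / l * (W x / Z x) * (l * (\<Sum>j\<in>indices. exp (l * dev j x) * rel_drift j x) + ?c * Z x)"
    using gz \<kappa> W_ge_1[of x] Z by (intro mult_left_mono mult_nonneg_nonneg) auto
  also have "\<dots> = W x * (K * ((\<Sum>j\<in>indices. exp (l * dev j x) * rel_drift j x) / Z x)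
     + 6 * K * l * \<epsilon> * log_slope s G \<tau>)"
    using Z l_pos by (simp add: field_simps power2_eq_square)
  finally show ?thesis by (simp add: sum_divide_distrib)
qed

end

lemma Psi_nonneg: "(\<And>i. i \<in> {1..s} \<Longrightarrow> \<beta> i > 0) \<Longrightarrow> 0 \<le> u \<Longrightarrow> 0 \<le> Psi s G \<beta> u"
  unfolding Psi_def by (intro sum_nonneg mult_nonneg_nonneg) (auto intro: less_imp_le)

lemma Psi_mono:
  assumes "\<And>i. i \<in> {1..s} \<Longrightarrow> \<beta> i > 0" "0 \<le> u" "u \<le> w"
  shows "Psi s G \<beta> u \<le> Psi s G \<beta> w"
  unfolding Psi_def using assms less_imp_le
  by (intro sum_mono mult_left_mono power_mono mult_nonneg_nonneg) auto

lemma half_le_phi: "(\<And>i. i \<in> {1..s} \<Longrightarrow> \<beta> i > 0) \<Longrightarrow> 0 \<le> u \<Longrightarrow> 1 / 2 \<le> phi s G \<beta> u"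
  unfolding phi_def by (intro half_le_Phi Psi_nonneg)

lemma dPsi_nonneg: "(\<And>i. i \<in> {1..s} \<Longrightarrow> \<beta> i > 0) \<Longrightarrow> 0 \<le> u \<Longrightarrow> 0 \<le> dPsi s G \<beta> u"
  unfolding dPsi_def by (intro sum_nonneg mult_nonneg_nonneg) (auto intro: less_imp_le)

lemma dPsi_mono:
  assumes "\<And>i. i \<in> {1..s} \<Longrightarrow> \<beta> i > 0" "0 \<le> u" "u \<le> w"
  shows "dPsi s G \<beta> u \<le> dPsi s G \<beta> w"
  unfolding dPsi_def using assms less_imp_le
  by (intro sum_mono mult_left_mono power_mono mult_nonneg_nonneg) auto

section \<open>Drift of the extremal densities\<close>

context lyapunov
begin

text \<open>The inserted 0 matches the summand 1 of \<open>Z\<close> and covers the case without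
  indices, when no \<open>G i\<close> has two edges.\<close>

definition \<rho> :: "nat set set \<Rightarrow> real" where
  "\<rho> x = Max (insert 0 ((\<lambda>j. dev j x) ` indices))"

abbreviation "upper x \<equiv> p * exp (\<rho> x)"
abbreviation "lower x \<equiv> p * exp (- \<rho> x)"

lemma dev_le: "j \<in> indices \<Longrightarrow> dev j x \<le> \<rho> x" and \<rho>_nonneg: "0 \<le> \<rho> x"
  unfolding \<rho>_def using finite_indices by (auto intro!: Max_ge)

lemma exp_\<rho>_le: "exp (l * \<rho> x) \<le> Z x"
proof -
  have "\<rho> x \<in> insert 0 ((\<lambda>j. dev j x) ` indices)"
    unfolding \<rho>_def using finite_indices by (intro Max_in) auto
  then consider "\<rho> x = 0" | j where "j \<in> indices" "\<rho> x = dev j x" by blast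
  then show ?thesis
  proof cases
    case 1
    then show ?thesis using Z_ge_1[of x] by simp
  next
    case (2 j)
    have "exp (l * dev j x) \<le> (\<Sum>j\<in>indices. exp (l * dev j x))"
      using 2 finite_indices by (intro member_le_sum) auto
    then show ?thesis by (simp add: 2 Z_def)
  qed
qed

lemma power_exp: "(p * exp u) ^ k = exp (real k * (ln p + u))"
  using p by (simp add: exp_add exp_of_nat_mult)

lemma controlled_\<rho>: "controlled \<tau> (lower x) (upper x) x"
  unfolding controlled_def
proof (intro allI impI)
  fix i \<alpha> B e assume v: "valid i \<alpha> B" and e: "e \<in> CE"
  let ?T = "dens (vs i) n \<alpha> B \<tau> x e"
  show "lower x ^ card B \<le> ?T \<and> ?T \<le> upper x ^ card B"
  proof (cases "B = {}")
    case True
    then show ?thesis using dens_ge(2,4)[OF v e, of x] by simp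
  next
    case False
    have T: "0 < ?T" by (rule dens_ge[OF v e])
    have k: "0 < real (card B)" using card_pos[OF v False] by simp
    have "((i, \<alpha>, B), e, 1) \<in> indices" "((i, \<alpha>, B), e, - 1) \<in> indices"
      using v e False by (auto simp: indices_def patterns_def)
    from this[THEN dev_le, of x] have "ln ?T / card B - ln p \<le> \<rho> x" "ln p - ln ?T / card B \<le> \<rho> x"
      by simp_all
    then have "card B * (ln p + - \<rho> x) \<le> ln ?T" "ln ?T \<le> card B * (ln p + \<rho> x)"
      using k by (simp_all add: field_simps)
    then show ?thesis
      unfolding power_exp using T by (metis exp_le_cancel_iff exp_ln)
  qed
qed

text \<open>The a priori control that holds at every configuration; an empty \<open>B\<close> fits
  because \<open>0 ^ 0 = 1\<close>.\<close>

lemma controlled_trivial: "controlled \<tau> 0 1 x"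
  unfolding controlled_def
proof (intro allI impI)
  fix i \<alpha> B e assume v: "valid i \<alpha> B" and e: "e \<in> CE"
  show "0 ^ card B \<le> dens (vs i) n \<alpha> B \<tau> x e \<and> dens (vs i) n \<alpha> B \<tau> x e \<le> 1 ^ card B"
  proof (cases "B = {}")
    case True
    then show ?thesis using dens_ge(2,4)[OF v e, of x] by simp
  next
    case False
    then show ?thesis using dens_ge(3,4)[OF v e, of x] card_pos[OF v False] by (simp add: zero_power)
  qed
qed

lemma rel_drift_le:
  assumes j: "j \<in> indices"
  shows "rel_drift j x \<le> 2 / \<tau> ^ max_degree s G"
  using j
proof (rule indicesE)
  fix i \<alpha> B e \<sigma>
  assume j: "j = ((i, \<alpha>, B), e, \<sigma>)" "valid i \<alpha> B" "B \<noteq> {}" "e \<in> CE" "\<sigma> = 1 \<or> \<sigma> = - 1"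
  let ?T = "dens (vs i) n \<alpha> B \<tau> x e" and ?D = "drift (vs i) \<alpha> B \<tau> x e"
  have T: "0 < ?T" "\<tau> ^ max_degree s G \<le> ?T" "?T \<le> 1" by (rule dens_ge[OF j(2,4)])+
  have k: "0 < real (card B)" using card_pos[OF j(2,3)] by simp
  have r: "rate a x + \<tau> \<le> 2" "0 \<le> rate a x" for a
    using rate_less_1[of a x] rate_pos[of a x] \<tau> by linarith+
  have "?D \<le> card B * (2 * 1 ^ (card B - 1) - ?T)" "card B * (0 * 0 ^ (card B - 1) - ?T) \<le> ?D"
    using drift_bounds[OF controlled_trivial less_imp_le[OF \<tau>(1)] \<tau>(2) j(2,4), where P = 2 and p = 0, of x] r
    by simp_all
  then have "?D / card B \<le> 2 - ?T" "- (?D / card B) \<le> ?T"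
    using k by (simp_all add: field_simps)
  then have "\<sigma> / card B * ?D \<le> 2"
    using j(5) T(1,3) by auto
  then have "(\<sigma> / card B * ?D) / ?T \<le> 2 / ?T" using T by (intro divide_right_mono) auto
  also have "\<dots> \<le> 2 / \<tau> ^ max_degree s G" using T \<tau> by (intro divide_left_mono) auto
  finally show ?thesis by (simp add: j(1))
qed

text \<open>Twice the additive error of a rate, \<open>2 * \<tau> * Psi s G \<beta> 1\<close> from
  the field plus \<tau> from the weight of absent edges. As \<open>phi\<close> is at least 1/2 at
  the arguments in question, the doubled error is a relative one.\<close>

definition \<omega> :: real where
  "\<omega> = 2 * (2 * \<tau> * Psi s G \<beta> 1 + \<tau>)"

lemma Psi_1_nonneg: "0 \<le> Psi s G \<beta> 1"
  using Psi_nonneg[of s \<beta> 1 G] \<beta> by simp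

lemma lower_pos: "0 < lower x" and upper_pos: "0 < upper x"
  using p by auto

lemma half_le_phi_bounds: "1 / 2 \<le> phi s G \<beta> (upper x)" "1 / 2 \<le> phi s G \<beta> (lower x)"
  using half_le_phi[of s \<beta> "upper x" G] half_le_phi[of s \<beta> "lower x" G] upper_pos[of x] lower_pos[of x] \<beta>
  by simp_all

lemma rate_bounds:
  assumes "ratio_close \<tau>" "a \<in> CE"
  shows "rate a x + \<tau> \<le> phi s G \<beta> (upper x) * (1 + \<omega>)" "phi s G \<beta> (lower x) * (1 - \<omega>) \<le> rate a x"
proof -
  let ?t = "2 * \<tau> * Psi s G \<beta> 1"
  have t: "0 \<le> ?t" using \<tau> Psi_1_nonneg by simp
  have "rate a x \<le> Phi (Psi s G \<beta> (upper x) + ?t)"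
    unfolding rate_eq using \<tau> by (intro Phi_mono field_bounds(1)[OF controlled_\<rho> assms(1) _ _ assms(2)]) auto
  also have "\<dots> \<le> phi s G \<beta> (upper x) + ?t"
    using Phi_lipschitz[of "Psi s G \<beta> (upper x) + ?t" "Psi s G \<beta> (upper x)"] t by (simp add: phi_def)
  finally have 1: "rate a x + \<tau> \<le> phi s G \<beta> (upper x) + \<omega> / 2"
    by (simp add: \<omega>_def add_divide_distrib)
  have \<omega>: "0 \<le> \<omega>" using t \<tau> by (simp add: \<omega>_def)
  have "1 / 2 * \<omega> \<le> phi s G \<beta> (upper x) * \<omega>"
    by (rule mult_right_mono[OF half_le_phi_bounds(1) \<omega>])
  then show "rate a x + \<tau> \<le> phi s G \<beta> (upper x) * (1 + \<omega>)"
    using 1 by (simp add: distrib_left)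
  have "phi s G \<beta> (lower x) - ?t \<le> Phi (Psi s G \<beta> (lower x) - ?t)"
    using Phi_lipschitz[of "Psi s G \<beta> (lower x) - ?t" "Psi s G \<beta> (lower x)"] t by (simp add: phi_def)
  also have "\<dots> \<le> rate a x"
    unfolding rate_eq using \<tau> by (intro Phi_mono field_bounds(2)[OF controlled_\<rho> assms(1) _ _ assms(2)]) auto
  finally have 2: "phi s G \<beta> (lower x) - \<omega> / 2 \<le> rate a x"
    using \<tau> by (simp add: \<omega>_def add_divide_distrib)
  have "1 / 2 * \<omega> \<le> phi s G \<beta> (lower x) * \<omega>"
    by (rule mult_right_mono[OF half_le_phi_bounds(2) \<omega>])
  then show "phi s G \<beta> (lower x) * (1 - \<omega>) \<le> rate a x"
    using 2 by (simp add: right_diff_distrib)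
qed

text \<open>For sign 1 the density is within a factor \<open>exp (k * \<eta>)\<close> of
  \<open>upper x ^ k\<close>, so dividing the gain by the density leaves
  \<open>phi / upper x\<close> up to errors, and the \<open>k\<close> of the drift cancels against
  \<open>expo\<close>. Sign -1 gives the second alternative in the same way.\<close>

lemma rel_drift_near:
  fixes \<eta> :: real
  assumes ratio: "ratio_close \<tau>" and \<omega>: "\<omega> \<le> 1" and j: "j \<in> indices"
    and \<eta>: "0 \<le> \<eta>" "\<rho> x - \<eta> \<le> dev j x"
  shows "rel_drift j x \<le> (1 + \<omega>) * exp (max_degree s G * \<eta>) * (phi s G \<beta> (upper x) / upper x) - 1 \<or>
    rel_drift j x \<le> 1 - (1 - \<omega>) * exp (- (max_degree s G * \<eta>)) * (phi s G \<beta> (lower x) / lower x)"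
  using j
proof (rule indicesE)
  fix i \<alpha> B e \<sigma>
  assume j: "j = ((i, \<alpha>, B), e, \<sigma>)" "valid i \<alpha> B" "B \<noteq> {}" "e \<in> CE" "\<sigma> = 1 \<or> \<sigma> = - 1"
  let ?T = "dens (vs i) n \<alpha> B \<tau> x e" and ?D = "drift (vs i) \<alpha> B \<tau> x e"
  let ?k = "card B" and ?R = "upper x" and ?r = "lower x" and ?d = "max_degree s G"
  let ?P = "phi s G \<beta> ?R * (1 + \<omega>)" and ?Q = "phi s G \<beta> ?r * (1 - \<omega>)"
  have T: "0 < ?T" by (rule dens_ge[OF j(2,4)])
  have k: "0 < ?k" using card_pos[OF j(2,3)] .
  have \<omega>0: "0 \<le> \<omega>" using \<tau> Psi_1_nonneg by (simp add: \<omega>_def)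
  have ph: "0 \<le> phi s G \<beta> ?R" "0 \<le> phi s G \<beta> ?r"
    using half_le_phi_bounds[of x] by linarith+
  have PQ: "0 \<le> ?P" "0 \<le> ?Q" using ph \<omega> \<omega>0 by auto
  have D: "?D \<le> ?k * (?P * ?R ^ (?k - 1) - ?T)" "?k * (?Q * ?r ^ (?k - 1) - ?T) \<le> ?D"
    using drift_bounds[OF controlled_\<rho> less_imp_le[OF \<tau>(1)] \<tau>(2) j(2,4) rate_bounds[OF ratio] PQ(2)]
    by simp_all
  have kd: "exp (?k * \<eta>) \<le> exp (?d * \<eta>)"
    using card_le_max_degree[OF j(2)] \<eta>(1) by (simp add: mult_right_mono)
  from j(5) show ?thesis
  proof
    assume \<sigma>: "\<sigma> = 1"
    then have "\<rho> x - \<eta> \<le> ln ?T / ?k - ln p" using \<eta>(2) by (simp add: j(1))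
    then have "?k * (ln p + (\<rho> x - \<eta>)) \<le> ln ?T" using k by (simp add: field_simps)
    then have "exp (?k * (ln p + (\<rho> x - \<eta>))) \<le> ?T"
      using T by (simp only: ln_ge_iff)
    moreover have "?k * (ln p + (\<rho> x - \<eta>)) = ?k * (ln p + \<rho> x) - ?k * \<eta>"
      by (simp add: algebra_simps)
    ultimately have "exp (?k * (ln p + \<rho> x) - ?k * \<eta>) \<le> ?T" by simp
    then have "?R ^ ?k \<le> ?T * exp (?k * \<eta>)"
      unfolding power_exp by (simp add: exp_diff field_simps)
    also have "\<dots> \<le> ?T * exp (?d * \<eta>)" using kd T by simp
    finally have "?R ^ (?k - 1) \<le> ?T * exp (?d * \<eta>) / ?R"
      using k upper_pos[of x] by (simp add: pos_le_divide_eq flip: power_Suc2)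
    then have "?P * ?R ^ (?k - 1) \<le> ?P * (?T * exp (?d * \<eta>) / ?R)"
      by (rule mult_left_mono[OF _ PQ(1)])
    moreover have "?D / ?k \<le> ?P * ?R ^ (?k - 1) - ?T"
      using D(1) k by (simp only: pos_divide_le_eq of_nat_0_less_iff mult.commute)
    ultimately have "?D / ?k \<le> ?P * (?T * exp (?d * \<eta>) / ?R) - ?T" by linarith
    then have "?D / ?k / ?T \<le> (?P * (?T * exp (?d * \<eta>) / ?R) - ?T) / ?T"
      using T by (intro divide_right_mono) auto
    also have "\<dots> = (1 + \<omega>) * exp (?d * \<eta>) * (phi s G \<beta> ?R / ?R) - 1"
      using T by (simp add: diff_divide_distrib)
    finally show ?thesis by (simp add: j(1) \<sigma>)
  next
    assume \<sigma>: "\<sigma> = - 1"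
    then have "ln ?T / ?k - ln p \<le> - \<rho> x + \<eta>" using \<eta>(2) by (simp add: j(1))
    then have "ln ?T \<le> ?k * (ln p + (- \<rho> x + \<eta>))" using k by (simp add: field_simps)
    then have "exp (ln ?T) \<le> exp (?k * (ln p + (- \<rho> x + \<eta>)))" by simp
    moreover have "?k * (ln p + (- \<rho> x + \<eta>)) = ?k * (ln p + - \<rho> x) + ?k * \<eta>"
      by (simp add: algebra_simps)
    ultimately have "?T \<le> exp (?k * (ln p + - \<rho> x) + ?k * \<eta>)" using T by simp
    also have "\<dots> = ?r ^ ?k * exp (?k * \<eta>)"
      unfolding power_exp by (simp add: exp_add)
    also have "\<dots> \<le> ?r ^ ?k * exp (?d * \<eta>)" using kd lower_pos[of x] by simp
    finally have "?T * exp (- (?d * \<eta>)) \<le> ?r ^ ?k"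
      by (simp add: exp_minus field_simps)
    then have "?T * exp (- (?d * \<eta>)) / ?r \<le> ?r ^ (?k - 1)"
      using k lower_pos[of x] by (simp add: pos_divide_le_eq flip: power_Suc2)
    then have "?Q * (?T * exp (- (?d * \<eta>)) / ?r) \<le> ?Q * ?r ^ (?k - 1)"
      by (rule mult_left_mono[OF _ PQ(2)])
    moreover have "?Q * ?r ^ (?k - 1) - ?T \<le> ?D / ?k"
      using D(2) k by (simp only: pos_le_divide_eq of_nat_0_less_iff mult.commute)
    ultimately have "- (?D / ?k) \<le> ?T - ?Q * (?T * exp (- (?d * \<eta>)) / ?r)" by linarith
    then have "- (?D / ?k) / ?T \<le> (?T - ?Q * (?T * exp (- (?d * \<eta>)) / ?r)) / ?T"
      using T by (intro divide_right_mono) auto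
    also have "\<dots> = 1 - (1 - \<omega>) * exp (- (?d * \<eta>)) * (phi s G \<beta> ?r / ?r)"
      using T by (simp add: diff_divide_distrib)
    finally show ?thesis by (simp add: j(1) \<sigma>)
  qed
qed

end

section \<open>Contraction of the weight\<close>

context lyapunov
begin

text \<open>Here the positive \<tau> is essential: a density with \<open>k\<close> edges is at least
  \<open>\<tau> ^ k\<close>, which bounds the normalised logarithm uniformly in \<open>n\<close> and
  \<open>x\<close>.\<close>

lemma dev_le_const:
  assumes "j \<in> indices"
  shows "dev j x \<le> \<bar>ln p\<bar> + \<bar>ln \<tau>\<bar>"
  using assms
proof (rule indicesE)
  fix i \<alpha> B e \<sigma>
  assume j: "j = ((i, \<alpha>, B), e, \<sigma>)" "valid i \<alpha> B" "B \<noteq> {}" "e \<in> CE" "\<sigma> = 1 \<or> \<sigma> = - 1"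
  let ?T = "dens (vs i) n \<alpha> B \<tau> x e"
  have T: "0 < ?T" "?T \<le> 1" "\<tau> ^ card B \<le> ?T" by (rule dens_ge[OF j(2,4)])+
  have k: "0 < real (card B)" using card_pos[OF j(2,3)] by simp
  have "ln ?T \<le> 0" using T by simp
  then have 1: "ln ?T / card B \<le> 0" using k by (simp add: divide_nonpos_pos)
  have "ln (\<tau> ^ card B) \<le> ln ?T" using T \<tau> by (subst ln_le_cancel_iff) auto
  then have "card B * ln \<tau> \<le> ln ?T" using \<tau> by (simp add: ln_realpow)
  then have 2: "ln \<tau> \<le> ln ?T / card B" using k by (simp add: pos_le_divide_eq mult.commute)
  from j(5) show ?thesis
    using 1 2 by (auto simp: j(1))
qed

text \<open>By the assumption, the number of indices contributes a factor of at most
  \<open>exp (l * \<eta>)\<close> to \<open>Z\<close>, which the exponent \<open>K / l\<close>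
  reduces to \<open>exp (K * \<eta>)\<close>.\<close>

lemma W_le:
  assumes "(card indices + 1) * exp (- (l * \<eta>)) \<le> 1"
  shows "W x \<le> exp (K * (\<bar>ln p\<bar> + \<bar>ln \<tau>\<bar> + \<eta>))"
proof -
  let ?B = "\<bar>ln p\<bar> + \<bar>ln \<tau>\<bar>"
  have "Z x \<le> 1 + card indices * exp (l * ?B)"
    unfolding Z_def
    using sum_bounded_above[of indices "\<lambda>j. exp (l * dev j x)" "exp (l * ?B)"] dev_le_const l_pos
    by simp
  also have "\<dots> \<le> (card indices + 1) * exp (l * ?B)"
    using l_pos by (simp add: distrib_right)
  also have "\<dots> \<le> exp (l * \<eta>) * exp (l * ?B)"
    using assms by (intro mult_right_mono) (simp_all add: exp_minus field_simps)
  also have "\<dots> = exp (l * (?B + \<eta>))" by (simp add: distrib_left flip: exp_add)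
  finally have "W x \<le> exp (l * (?B + \<eta>)) powr (K / l)"
    unfolding W_def using Z_ge_1[of x] \<kappa> by (intro powr_mono2) auto
  also have "\<dots> = exp (K * (?B + \<eta>))"
    using l_pos by (simp add: powr_def)
  finally show ?thesis .
qed

text \<open>Valid at every configuration, since \<open>Phi\<close> is 1-Lipschitz and densities are
  at most 1, but the bound may exceed 1.\<close>

lemma sum_rate_gradient:
  assumes ratio: "ratio_close \<tau>" and e: "e \<in> CE" "e \<notin> x"
  shows "(\<Sum>a\<in>CE. rate a (insert e x) - rate a x) \<le> 2 * dPsi s G \<beta> 1"
proof -
  have "(\<Sum>a\<in>CE. rate a (insert e x) - rate a x) \<le> (\<Sum>a\<in>CE. field a (insert e x) - field a x)"
  proof (rule sum_mono)
    fix a assume "a \<in> CE"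
    then show "rate a (insert e x) - rate a x \<le> field a (insert e x) - field a x"
      unfolding rate_eq using Phi_diff_le[of "field a x" "field a (insert e x)" 1] field_mono dPhi_bounds(2) by simp
  qed
  also have "\<dots> \<le> (1 + \<tau>) * dPsi s G \<beta> 1"
    using \<tau> by (intro sum_field_gradient[OF controlled_trivial ratio _ _ _ e]) auto
  also have "\<dots> \<le> 2 * dPsi s G \<beta> 1"
    using \<tau> dPsi_nonneg[of s \<beta> 1 G] \<beta> by (intro mult_right_mono) auto
  finally show ?thesis .
qed

text \<open>All fields before and after inserting \<open>e\<close> stay within \<theta> of
  \<open>Psi s G \<beta> p\<close>: \<theta>/4 for the range of densities, \<theta>/4 for the errors
  of \<open>field_bounds\<close>, \<theta>/2 for the insertion. So \<open>dPhi\<close> is within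
  \<theta> of its value at the fixed point.\<close>

lemma sum_rate_gradient_near:
  assumes ratio: "ratio_close \<tau>" and e: "e \<in> CE" "e \<notin> x"
    and \<rho>: "\<rho> x \<le> r"
    and r: "Psi s G \<beta> (p * exp r) \<le> Psi s G \<beta> p + \<theta> / 4" "Psi s G \<beta> p - \<theta> / 4 \<le> Psi s G \<beta> (p * exp (- r))"
    and \<theta>: "2 * \<tau> * Psi s G \<beta> 1 \<le> \<theta> / 4" "\<tau> \<le> \<theta>" "gradient_const / (real n - 2) \<le> \<theta> / 2" "0 < \<theta>"
  shows "(\<Sum>a\<in>CE. rate a (insert e x) - rate a x) \<le>
    (dPhi (Psi s G \<beta> p) + \<theta>) * ((1 + \<theta>) * dPsi s G \<beta> (p * exp r))"
proof -
  let ?c = "dPhi (Psi s G \<beta> p) + \<theta>"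
  have up: "Psi s G \<beta> (upper x) \<le> Psi s G \<beta> (p * exp r)"
    using \<rho> p \<beta> by (intro Psi_mono) auto
  have lo: "Psi s G \<beta> (p * exp (- r)) \<le> Psi s G \<beta> (lower x)"
    using \<rho> p \<beta> by (intro Psi_mono) auto
  have c: "0 \<le> ?c" using dPhi_bounds(1)[of "Psi s G \<beta> p"] \<theta>(4) by simp
  have ratio1: "ratio_close 1" using ratio \<tau> by (fastforce simp: ratio_close_def)
  have "(\<Sum>a\<in>CE. rate a (insert e x) - rate a x) \<le> (\<Sum>a\<in>CE. ?c * (field a (insert e x) - field a x))"
  proof (rule sum_mono)
    fix a assume a: "a \<in> CE"
    have "field a x \<le> Psi s G \<beta> (upper x) + 2 * \<tau> * Psi s G \<beta> 1"
      "Psi s G \<beta> (lower x) - 2 * \<tau> * Psi s G \<beta> 1 \<le> field a x"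
      using \<tau> field_bounds[OF controlled_\<rho> ratio _ _ a] by auto
    moreover have "field a (insert e x) - field a x \<le> \<theta> / 2"
      using field_gradient_le[OF ratio1 a e(2)] \<theta>(3) by linarith
    ultimately have "Psi s G \<beta> p - \<theta> \<le> field a x" "field a (insert e x) \<le> Psi s G \<beta> p + \<theta>"
      using up lo r \<theta>(1,4) by linarith+
    then have "dPhi z \<le> ?c" if "field a x \<le> z" "z \<le> field a (insert e x)" for z
      using dPhi_lipschitz[of z "Psi s G \<beta> p"] that by linarith
    then show "rate a (insert e x) - rate a x \<le> ?c * (field a (insert e x) - field a x)"
      unfolding rate_eq by (intro Phi_diff_le field_mono a)
  qed
  also have "\<dots> = ?c * (\<Sum>a\<in>CE. field a (insert e x) - field a x)"
    by (simp only: sum_distrib_left)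
  also have "\<dots> \<le> ?c * ((1 + \<tau>) * dPsi s G \<beta> (upper x))"
    using \<tau> upper_pos[of x] by (intro mult_left_mono c sum_field_gradient[OF controlled_\<rho> ratio _ _ _ e]) auto
  also have "\<dots> \<le> ?c * ((1 + \<theta>) * dPsi s G \<beta> (p * exp r))"
    using \<tau> \<theta> \<rho> p \<beta> dPsi_nonneg[of s \<beta> "upper x" G] upper_pos[of x]
    by (intro mult_left_mono c mult_mono dPsi_mono) auto
  finally show ?thesis .
qed

text \<open>Near the fixed point the influences sum to at most \<open>1 - 6 * \<delta>\<close>, and
  five errors of size \<delta> are allowed: \<open>K * h\<close>, the far indices of the soft
  maximum, the second-order term of the generator, the omitted update at \<open>e\<close>, and the
  replacement of \<open>W (insert e x - {a})\<close> by \<open>W x\<close>. Away from it the drift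
  \<open>- K * c / 2\<close> cancels the influences altogether, and four errors remain, which
  \<open>5 * \<delta> \<le> 1\<close> permits.\<close>

lemma W_contraction:
  fixes \<delta> \<theta> r c h \<eta> :: real
  assumes fixed: "\<And>u. p \<le> u \<Longrightarrow> phi s G \<beta> u \<le> u" "\<And>u. 0 < u \<Longrightarrow> u \<le> p \<Longrightarrow> u \<le> phi s G \<beta> u"
    and gap: "\<And>u. p * exp r \<le> u \<Longrightarrow> phi s G \<beta> u \<le> (1 - c) * u"
      "\<And>u. 0 < u \<Longrightarrow> u \<le> p * exp (- r) \<Longrightarrow> (1 + c) * u \<le> phi s G \<beta> u" "0 < c" "c \<le> 1"
    and near: "(dPhi (Psi s G \<beta> p) + \<theta>) * ((1 + \<theta>) * dPsi s G \<beta> (p * exp r)) \<le> 1 - 6 * \<delta>"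
    and r: "Psi s G \<beta> (p * exp r) \<le> Psi s G \<beta> p + \<theta> / 4" "Psi s G \<beta> p - \<theta> / 4 \<le> Psi s G \<beta> (p * exp (- r))"
    and \<theta>: "2 * \<tau> * Psi s G \<beta> 1 \<le> \<theta> / 4" "\<tau> \<le> \<theta>" "gradient_const / (real n - 2) \<le> \<theta> / 2" "0 < \<theta>"
    and h: "(1 + \<omega>) * exp (max_degree s G * \<eta>) \<le> 1 + h" "1 - h \<le> (1 - \<omega>) * exp (- (max_degree s G * \<eta>))"
      "\<omega> \<le> 1" "0 \<le> h" "K * h \<le> \<delta>" "h \<le> c / 4"
    and \<eta>: "0 \<le> \<eta>" "\<eta> \<le> r"
    and K_large: "2 * dPsi s G \<beta> 1 \<le> K * (c / 2)"
    and ratio: "ratio_close \<tau>"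
    and small: "K * ((1 + 2 / \<tau> ^ max_degree s G) * ((card indices + 1) * exp (- (l * \<eta>)))) \<le> \<delta>"
      "6 * K * l * \<epsilon> * log_slope s G \<tau> \<le> \<delta>" "3 * K * \<epsilon> \<le> \<delta>" "9 * K * \<epsilon> * (2 * dPsi s G \<beta> 1) \<le> \<delta>"
    and \<delta>: "0 < \<delta>" "5 * \<delta> \<le> 1"
    and e: "e \<in> CE" and x: "x \<subseteq> CE - {e}"
  shows "(\<Sum>a\<in>CE - {e}. upd a W x - W x) +
       (\<Sum>a\<in>CE - {e}. (rate a (insert e x) - rate a x) * W (insert e x - {a}))
       \<le> (1 - \<delta>) * W x"
proof -
  have ex: "e \<notin> x" using x by blast
  define u where "u = 3 * K * \<epsilon>"
  have u: "0 \<le> u" "u \<le> \<delta>" "u \<le> 1" using K \<epsilon>_nonneg small(3) \<delta> by (auto simp: u_def)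
  define S where "S = (\<Sum>a\<in>CE. rate a (insert e x) - rate a x)"
  define A where "A = (\<Sum>j\<in>indices. exp (l * dev j x) / Z x * rel_drift j x)"
  have W: "0 < W x" using W_ge_1[of x] by linarith
  have S: "0 \<le> S" "S \<le> 2 * dPsi s G \<beta> 1"
    using sum_rate_gradient[OF ratio e ex] rate_mono unfolding S_def by (auto intro!: sum_nonneg)
  \<comment> \<open>Two flips, inserting \<open>e\<close> and removing \<open>a\<close>, cost a
    factor \<open>(1 + u)\<^sup>2\<close>, at most \<open>1 + 3 * u\<close>; with
    \<open>u = 3 * K * \<epsilon>\<close> this is the 9 in the last smallness condition.\<close>
  have second: "(\<Sum>a\<in>CE - {e}. (rate a (insert e x) - rate a x) * W (insert e x - {a})) \<le> (S + \<delta>) * W x"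
  proof -
    have "(\<Sum>a\<in>CE - {e}. (rate a (insert e x) - rate a x) * W (insert e x - {a})) \<le>
        (\<Sum>a\<in>CE - {e}. (rate a (insert e x) - rate a x) * ((1 + u)\<^sup>2 * W x))"
    proof (intro sum_mono mult_left_mono)
      fix a assume "a \<in> CE - {e}"
      have "W (insert e x - {a}) \<le> (1 + u) * W (insert e x)"
        unfolding u_def by (rule W_flip[of a]) (simp add: is_flip_def)
      also have "\<dots> \<le> (1 + u) * ((1 + u) * W x)"
        using u unfolding u_def by (intro mult_left_mono W_flip[of e]) (auto simp: is_flip_def)
      finally show "W (insert e x - {a}) \<le> (1 + u)\<^sup>2 * W x" by (simp add: power2_eq_square mult.assoc)
    qed (use rate_mono in auto)
    also have "\<dots> = (\<Sum>a\<in>CE - {e}. rate a (insert e x) - rate a x) * ((1 + u)\<^sup>2 * W x)"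
      by (simp only: sum_distrib_right)
    also have "\<dots> \<le> S * ((1 + u)\<^sup>2 * W x)"
      unfolding S_def using W rate_mono by (intro mult_right_mono sum_mono2) auto
    also have "\<dots> = S * (1 + u)\<^sup>2 * W x" by simp
    also have "\<dots> \<le> (S + \<delta>) * W x"
    proof (rule mult_right_mono)
      have "(1 + u)\<^sup>2 \<le> 1 + 3 * u"
        using u mult_left_mono[of u 1 u] by (simp add: power2_eq_square algebra_simps)
      then have "S * (1 + u)\<^sup>2 \<le> S * (1 + 3 * u)" using S by (intro mult_left_mono) auto
      also have "\<dots> = S + 3 * u * S" by (simp add: algebra_simps)
      also have "3 * u * S \<le> 3 * u * (2 * dPsi s G \<beta> 1)" using S u by (intro mult_left_mono) auto
      also have "\<dots> \<le> \<delta>" using small(4) by (simp add: u_def)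
      finally show "S * (1 + u)\<^sup>2 \<le> S + \<delta>" by simp
    qed (use W in simp)
    finally show ?thesis .
  qed
  \<comment> \<open>The generator runs over all edges, so the term \<open>a = e\<close> is added
    back; a single flip can lower \<open>W\<close> by at most a fraction \<open>u\<close>.\<close>
  have first: "(\<Sum>a\<in>CE - {e}. upd a W x - W x) \<le> (K * A + 2 * \<delta>) * W x"
  proof -
    have "(1 - u) * W x \<le> W (insert e x)" "(1 - u) * W x \<le> W (x - {e})"
      unfolding u_def by (rule W_flip_ge[of e]; simp add: is_flip_def)+
    then have "rate e x * ((1 - u) * W x) + (1 - rate e x) * ((1 - u) * W x) \<le> upd e W x"
      unfolding upd_def using rate_pos[of e x] rate_less_1[of e x] by (intro add_mono mult_left_mono) auto
    then have "- (u * W x) \<le> upd e W x - W x" by (simp add: algebra_simps)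
    moreover have "u * W x \<le> \<delta> * W x" using u W by (intro mult_right_mono) auto
    moreover have "(\<Sum>a\<in>CE. upd a W x - W x) = (upd e W x - W x) + (\<Sum>a\<in>CE - {e}. upd a W x - W x)"
      using e by (intro sum.remove) auto
    moreover have "(\<Sum>a\<in>CE. upd a W x - W x) \<le> W x * (K * A + \<delta>)"
      unfolding A_def using W small(2) by (intro order_trans[OF generator_W] mult_left_mono add_left_mono) auto
    ultimately show ?thesis by (simp add: algebra_simps)
  qed
  have avg: "K * A \<le> K * N + \<delta>" if N: "\<bar>N\<bar> \<le> 1" "0 \<le> N \<or> \<eta> \<le> \<rho> x"
    and g: "\<And>j. j \<in> indices \<Longrightarrow> \<rho> x - \<eta> \<le> dev j x \<Longrightarrow> rel_drift j x \<le> N" for N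
  proof -
    let ?M = "2 / \<tau> ^ max_degree s G" and ?\<theta> = "(card indices + 1) * exp (- (l * \<eta>))"
    have "A \<le> N + (\<bar>N\<bar> + ?M) * ?\<theta>"
      unfolding A_def Z_def
    proof (rule soft_max_average[OF finite_indices])
      show "exp (l * \<rho> x) \<le> 1 + (\<Sum>j\<in>indices. exp (l * dev j x))"
        using exp_\<rho>_le[of x] by (simp only: Z_def)
    qed (use l_pos \<tau> dev_le g rel_drift_le N(2) in \<open>simp_all\<close>)
    also have "\<dots> \<le> N + (1 + ?M) * ?\<theta>"
      using N(1) by (intro add_left_mono mult_right_mono) auto
    finally have "K * A \<le> K * (N + (1 + ?M) * ?\<theta>)" using K by (intro mult_left_mono) auto
    then show ?thesis using small(1) by (simp add: distrib_left)
  qed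
  define b where "b = (1 + \<omega>) * exp (max_degree s G * \<eta>)"
  define b' where "b' = (1 - \<omega>) * exp (- (max_degree s G * \<eta>))"
  have b: "0 \<le> b" "b \<le> 1 + h" "1 - h \<le> b'"
    using h \<tau> Psi_1_nonneg by (auto simp: b_def b'_def \<omega>_def)
  have h1: "h \<le> 1" using h gap by linarith
  have drift: "rel_drift j x \<le> b * (phi s G \<beta> (upper x) / upper x) - 1 \<or>
      rel_drift j x \<le> 1 - b' * (phi s G \<beta> (lower x) / lower x)"
    if "j \<in> indices" "\<rho> x - \<eta> \<le> dev j x" for j
    using rel_drift_near[OF ratio h(3) that(1) \<eta>(1) that(2)] by (simp add: b_def b'_def)
  have "K * A + 2 * \<delta> + (S + \<delta>) \<le> 1 - \<delta>"
  proof (cases "\<rho> x \<le> r")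
    case True
    have "phi s G \<beta> (upper x) / upper x \<le> 1"
      using fixed(1)[of "upper x"] upper_pos[of x] p \<rho>_nonneg[of x] by (simp add: divide_le_eq_1)
    then have 1: "b * (phi s G \<beta> (upper x) / upper x) \<le> b * 1" using b by (intro mult_left_mono) auto
    have "1 \<le> phi s G \<beta> (lower x) / lower x"
      using fixed(2)[of "lower x"] lower_pos[of x] p \<rho>_nonneg[of x] by (simp add: le_divide_eq_1)
    then have 2: "(1 - h) * 1 \<le> b' * (phi s G \<beta> (lower x) / lower x)"
      using b h1 by (intro mult_mono) auto
    have "K * A \<le> K * h + \<delta>"
      \<comment> \<open>Here \<open>N = h\<close>: by \<open>fixed\<close>, extremal densities do
        not move outwards except for the errors \<omega> and \<eta> that \<open>h\<close>
        bounds.\<close>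
      by (rule avg) (use h h1 drift b 1 2 in \<open>fastforce+\<close>)
    moreover have "S \<le> 1 - 6 * \<delta>"
      using sum_rate_gradient_near[OF ratio e ex True r \<theta>] near unfolding S_def by linarith
    ultimately show ?thesis using h(5) by linarith
  next
    case False
    have "p * exp r \<le> upper x" "lower x \<le> p * exp (- r)" using False p by auto
    then have "phi s G \<beta> (upper x) / upper x \<le> 1 - c" "1 + c \<le> phi s G \<beta> (lower x) / lower x"
      using gap(1)[of "upper x"] gap(2)[of "lower x"] upper_pos[of x] lower_pos[of x]
      by (simp_all only: pos_divide_le_eq pos_le_divide_eq)
    then have "b * (phi s G \<beta> (upper x) / upper x) \<le> (1 + h) * (1 - c)"
      "(1 - h) * (1 + c) \<le> b' * (phi s G \<beta> (lower x) / lower x)"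
      using b h1 gap(3,4) half_le_phi_bounds[of x] upper_pos[of x]
      by (intro mult_mono; simp)+
    moreover have "(1 + h) * (1 - c) \<le> 1 - c / 2" "1 + c / 2 \<le> (1 - h) * (1 + c)"
    proof -
      define q where "q = h * c"
      have "h * c \<le> c / 4 * 1" using h gap by (intro mult_mono) auto
      then have q: "0 \<le> q" "q \<le> c / 4" using h gap by (simp_all add: q_def)
      have "(1 + h) * (1 - c) = 1 + h - c - q" "(1 - h) * (1 + c) = 1 - h + c - q"
        by (simp_all add: q_def algebra_simps)
      then show "(1 + h) * (1 - c) \<le> 1 - c / 2" "1 + c / 2 \<le> (1 - h) * (1 + c)"
        using q h(6) gap(3) by simp_all
    qed
    ultimately have "rel_drift j x \<le> - (c / 2)" if "j \<in> indices" "\<rho> x - \<eta> \<le> dev j x" for j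
      using drift[OF that] by linarith
    \<comment> \<open>\<open>N\<close> is negative, so the soft maximum needs
      \<open>\<eta> \<le> \<rho> x\<close>, which follows from
      \<open>\<eta> \<le> r < \<rho> x\<close>.\<close>
    then have "K * A \<le> K * (- (c / 2)) + \<delta>"
      using gap(3,4) \<eta> False by (intro avg) auto
    then show ?thesis using S(2) K_large \<delta> by simp
  qed
  then have "(K * A + 2 * \<delta> + (S + \<delta>)) * W x \<le> (1 - \<delta>) * W x"
    using W by (intro mult_right_mono) auto
  then show ?thesis using first second by (simp add: distrib_right)
qed

end

section \<open>The high temperature phase\<close>

lemma continuous_positive_lower_bound:
  fixes g :: "real \<Rightarrow> real"
  assumes "compact S" "continuous_on S g" "\<And>u. u \<in> S \<Longrightarrow> 0 < g u"
  obtains m where "0 < m" "\<And>u. u \<in> S \<Longrightarrow> m \<le> g u"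
proof (cases "S = {}")
  case False
  then obtain u0 where "u0 \<in> S" "\<And>u. u \<in> S \<Longrightarrow> g u0 \<le> g u"
    using continuous_attains_inf[OF assms(1) False assms(2)] by blast
  then show ?thesis using assms(3) that by blast
qed (use that[of 1] in auto)

lemma isCont_Psi: "isCont (Psi s G \<beta>) u"
  by (rule DERIV_isCont[OF DERIV_Psi])

lemma isCont_phi: "isCont (phi s G \<beta>) u"
  by (rule DERIV_isCont[OF DERIV_phi])

lemma isCont_dPsi: "isCont (dPsi s G \<beta>) u"
  unfolding dPsi_def[abs_def] by (intro continuous_intros)

lemma phi_less_1: "phi s G \<beta> u < 1"
  by (simp add: phi_def Phi_less_1)

text \<open>\<open>phi u - u\<close> cannot change sign on either side of its only zero. The signs
  are read off at \<open>max u 1\<close>, because \<open>phi\<close> is below 1, and at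
  \<open>min u (1 / 4)\<close>, because \<open>phi\<close> is at least 1/2.\<close>

lemma phi_unique_fixed_point:
  assumes \<beta>: "\<And>i. i \<in> {1..s} \<Longrightarrow> \<beta> i > 0"
    and p: "0 < p" "phi s G \<beta> p = p" "\<And>q. 0 < q \<Longrightarrow> phi s G \<beta> q = q \<Longrightarrow> q = p"
  shows "p < u \<Longrightarrow> phi s G \<beta> u < u" "0 < u \<Longrightarrow> u < p \<Longrightarrow> u < phi s G \<beta> u"
proof -
  let ?g = "\<lambda>u. phi s G \<beta> u - u"
  have cont: "isCont ?g u" for u by (intro continuous_intros isCont_phi)
  show "phi s G \<beta> u < u" if "p < u"
  proof (rule ccontr)
    assume "\<not> phi s G \<beta> u < u"
    then have "0 \<le> ?g u" by simp
    moreover have "?g (max u 1) \<le> 0" using phi_less_1[of s G \<beta> "max u 1"] by (simp add: max_def split: if_splits)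
    ultimately obtain w where w: "u \<le> w" "?g w = 0"
      using IVT2[of ?g "max u 1" 0 u] cont by auto
    then have "w = p" using p(1) that by (intro p(3)) auto
    then show False using w(1) that by simp
  qed
  show "u < phi s G \<beta> u" if "0 < u" "u < p"
  proof (rule ccontr)
    assume "\<not> u < phi s G \<beta> u"
    then have "?g u \<le> 0" by simp
    moreover have "0 \<le> ?g (min u (1 / 4))"
      using half_le_phi[of s \<beta> "min u (1 / 4)" G] \<beta> that by simp
    ultimately obtain w where w: "min u (1 / 4) \<le> w" "w \<le> u" "?g w = 0"
      using IVT2[of ?g u 0 "min u (1 / 4)"] cont by auto
    then have "w = p" using that by (intro p(3)) (auto simp: min_def split: if_splits)
    then show False using w(2) that by simp
  qed
qed

text \<open>Compactness makes the strict inequalities uniform on \<open>{p * exp r..2}\<close> and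
  on \<open>{1 / 4..p * exp (- r)}\<close>. Beyond 2 and below 1/4 the bounds \<open>phi < 1\<close>
  and \<open>phi \<ge> 1 / 2\<close> suffice, as \<open>c \<le> 1 / 2\<close>.\<close>

lemma phi_gap:
  assumes \<beta>: "\<And>i. i \<in> {1..s} \<Longrightarrow> \<beta> i > 0"
    and p: "0 < p" "phi s G \<beta> p = p" "\<And>q. 0 < q \<Longrightarrow> phi s G \<beta> q = q \<Longrightarrow> q = p"
    and r: "0 < r"
  obtains c where "0 < c" "c \<le> 1" "\<And>u. p * exp r \<le> u \<Longrightarrow> phi s G \<beta> u \<le> (1 - c) * u"
    "\<And>u. 0 < u \<Longrightarrow> u \<le> p * exp (- r) \<Longrightarrow> (1 + c) * u \<le> phi s G \<beta> u"
proof -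
  have fp: "phi s G \<beta> u < u" if "p < u" for u
    by (rule phi_unique_fixed_point(1)[of s \<beta> p G]) (use \<beta> p that in blast)+
  have fp': "u < phi s G \<beta> u" if "0 < u" "u < p" for u
    by (rule phi_unique_fixed_point(2)[of s \<beta> p G]) (use \<beta> p that in blast)+
  have up: "p < p * exp r" and lo: "p * exp (- r) < p" using p(1) r by auto
  have cont: "continuous_on S (\<lambda>u. (u - phi s G \<beta> u) / u)" "continuous_on S (\<lambda>u. (phi s G \<beta> u - u) / u)"
    if "\<And>u. u \<in> S \<Longrightarrow> u \<noteq> 0" for S
    using that by (auto intro!: continuous_at_imp_continuous_on continuous_divide continuous_diff isCont_phi)
  obtain c1 where c1: "0 < c1" "\<And>u. u \<in> {p * exp r..2} \<Longrightarrow> c1 \<le> (u - phi s G \<beta> u) / u"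
  proof (rule continuous_positive_lower_bound[of "{p * exp r..2}" "\<lambda>u. (u - phi s G \<beta> u) / u"])
    show "continuous_on {p * exp r..2} (\<lambda>u. (u - phi s G \<beta> u) / u)"
    proof (rule cont)
      fix u assume "u \<in> {p * exp r..2}"
      then have "p * exp r \<le> u" by simp
      then show "u \<noteq> 0" using p(1) up by linarith
    qed
    fix u assume "u \<in> {p * exp r..2}"
    then have "p * exp r \<le> u" by simp
    then have "p < u" using up by linarith
    moreover from this have "phi s G \<beta> u < u" by (rule fp)
    ultimately show "0 < (u - phi s G \<beta> u) / u" using p(1) by (intro divide_pos_pos) linarith+
  next
    show "compact {p * exp r..2}" by (rule compact_Icc)
  qed (rule that)
  obtain c2 where c2: "0 < c2" "\<And>u. u \<in> {1 / 4..p * exp (- r)} \<Longrightarrow> c2 \<le> (phi s G \<beta> u - u) / u"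
  proof (rule continuous_positive_lower_bound[of "{1 / 4..p * exp (- r)}" "\<lambda>u. (phi s G \<beta> u - u) / u"])
    show "continuous_on {1 / 4..p * exp (- r)} (\<lambda>u. (phi s G \<beta> u - u) / u)"
      by (intro cont) auto
    fix u assume "u \<in> {1 / 4..p * exp (- r)}"
    then have "0 < u" "u \<le> p * exp (- r)" by auto
    then have "0 < u" "u < p" using lo by linarith+
    moreover from this have "u < phi s G \<beta> u" by (rule fp')
    ultimately show "0 < (phi s G \<beta> u - u) / u" by (intro divide_pos_pos) linarith+
  next
    show "compact {1 / 4..p * exp (- r)}" by (rule compact_Icc)
  qed (rule that)
  define c where "c = min (1 / 2) (min c1 c2)"
  show ?thesis
  proof (rule that)
    show "0 < c" "c \<le> 1" using c1 c2 by (auto simp: c_def)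
    show "phi s G \<beta> u \<le> (1 - c) * u" if u: "p * exp r \<le> u" for u
    proof (cases "u \<le> 2")
      case True
      have u0: "0 < u" using u up p(1) by linarith
      have "c1 \<le> (u - phi s G \<beta> u) / u" using True u by (intro c1(2)) simp
      then have "c \<le> (u - phi s G \<beta> u) / u" by (simp add: c_def)
      then have "c * u \<le> u - phi s G \<beta> u" using u0 by (simp add: pos_le_divide_eq)
      then show ?thesis by (simp add: left_diff_distrib)
    next
      case False
      have "1 / 2 * u \<le> (1 - c) * u" using False by (intro mult_right_mono) (auto simp: c_def)
      then show ?thesis using False phi_less_1[of s G \<beta> u] by linarith
    qed
    show "(1 + c) * u \<le> phi s G \<beta> u" if u: "0 < u" "u \<le> p * exp (- r)" for u
    proof (cases "1 / 4 \<le> u")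
      case True
      have "c2 \<le> (phi s G \<beta> u - u) / u" using True u by (intro c2(2)) simp
      then have "c \<le> (phi s G \<beta> u - u) / u" by (simp add: c_def)
      then have "c * u \<le> phi s G \<beta> u - u" using u by (simp add: pos_le_divide_eq)
      then show ?thesis by (simp add: distrib_right)
    next
      case False
      have "(1 + c) * u \<le> 2 * (1 / 4)" using False u c1 c2 by (intro mult_mono) (auto simp: c_def)
      then show ?thesis using half_le_phi[of s \<beta> u G] \<beta> u by simp
    qed
  qed
qed

section \<open>Choice of the constants and transfer to the random graph\<close>

lemma eventually_at_right_obtain:
  assumes "eventually P (at_right (0::real))"
  obtains t where "0 < t" "P t"
proof -
  have "eventually (\<lambda>t. P t \<and> 0 < t) (at_right 0)"
    by (rule eventually_conj[OF assms eventually_at_right_less])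
  then have "\<exists>t. P t \<and> 0 < t"
    by (rule eventually_happens'[OF trivial_limit_at_right_real])
  then show ?thesis using that by blast
qed

lemma prob_ergm:
  assumes "3 \<le> n"
  shows "\<P>(x in ergm s G \<beta> n. Q x) = (\<Sum>x | x \<subseteq> complete_edges n \<and> Q x. glauber.gibbs (complete_edges n) (hamiltonian s G \<beta> n) x)"
    "(\<integral>x. f x \<partial>ergm s G \<beta> n) = glauber.mean (complete_edges n) (hamiltonian s G \<beta> n) f"
proof -
  have "{1, 2} \<in> complete_edges n" using assms by (simp add: complete_edges_def)
  then interpret glauber "complete_edges n" "hamiltonian s G \<beta> n" by unfold_locales auto
  have gibbs: "exp (hamiltonian s G \<beta> n x) / partition_function s G \<beta> n = gibbs x" for x
    by (simp add: gibbs_def partition_function_def configs_def)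
  have space: "space (ergm s G \<beta> n) = Pow (complete_edges n)"
    by (simp add: ergm_def space_point_measure configs_def)
  have set: "{x \<in> space (ergm s G \<beta> n). Q x} = {x. x \<subseteq> complete_edges n \<and> Q x}"
    unfolding space by auto
  have "emeasure (ergm s G \<beta> n) {x. x \<subseteq> complete_edges n \<and> Q x} =
      (\<Sum>x | x \<subseteq> complete_edges n \<and> Q x. ennreal (gibbs x))"
    unfolding ergm_def gibbs by (subst emeasure_point_measure_finite) (auto simp: configs_def)
  also have "\<dots> = ennreal (\<Sum>x | x \<subseteq> complete_edges n \<and> Q x. gibbs x)"
    by (intro sum_ennreal less_imp_le gibbs_pos)
  finally show "\<P>(x in ergm s G \<beta> n. Q x) = (\<Sum>x | x \<subseteq> complete_edges n \<and> Q x. gibbs x)"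
    unfolding set by (simp add: measure_def sum_nonneg less_imp_le[OF gibbs_pos])
  show "(\<integral>x. f x \<partial>ergm s G \<beta> n) = mean f"
    unfolding ergm_def gibbs mean_def
    by (subst lebesgue_integral_point_measure_finite)
       (auto simp: configs_def less_imp_le[OF gibbs_pos])
qed

lemma Lip_flip:
  assumes f: "f \<in> Lip n v" and e: "e \<in> complete_edges n" and x: "x \<subseteq> complete_edges n - {e}"
  shows "\<bar>f (insert e x) - f x\<bar> \<le> v e"
proof -
  have "\<bar>f (insert e x) - f x\<bar> \<le>
      (\<Sum>a\<in>complete_edges n. v a * of_bool ((a \<in> insert e x) \<noteq> (a \<in> x)))"
    using f e x unfolding Lip_def configs_def by blast
  also have "\<dots> = (\<Sum>a\<in>complete_edges n. if a = e then v a else 0)"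
    using x by (intro sum.cong) auto
  also have "\<dots> = v e" using e by simp
  finally show ?thesis .
qed

lemma subcritical_neighbourhood:
  assumes \<beta>: "\<And>i. i \<in> {1..s} \<Longrightarrow> \<beta> i > 0" and p: "0 < p"
    and deriv: "deriv (phi s G \<beta>) p < 1"
  obtains \<delta> \<theta> r where "0 < \<delta>" "5 * \<delta> \<le> 1" "0 < \<theta>" "0 < r"
    "Psi s G \<beta> (p * exp r) \<le> Psi s G \<beta> p + \<theta> / 4" "Psi s G \<beta> p - \<theta> / 4 \<le> Psi s G \<beta> (p * exp (- r))"
    "(dPhi (Psi s G \<beta> p) + \<theta>) * ((1 + \<theta>) * dPsi s G \<beta> (p * exp r)) \<le> 1 - 6 * \<delta>"
proof -
  define D0 where "D0 = dPhi (Psi s G \<beta> p) * dPsi s G \<beta> p"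
  have D0: "D0 < 1" "0 \<le> D0"
    using deriv DERIV_imp_deriv[OF DERIV_phi, of s G \<beta> p] dPsi_nonneg[of s \<beta> p G] \<beta> p
      dPhi_bounds(1)[of "Psi s G \<beta> p"] by (auto simp: D0_def)
  \<comment> \<open>\<open>D0\<close> is the derivative of \<open>phi\<close> at \<open>p\<close>,
    so \<open>6 * \<delta>\<close> is half of its distance from 1; the other half is room for the
    continuity argument.\<close>
  define \<delta> where "\<delta> = (1 - D0) / 12"
  have \<delta>: "0 < \<delta>" "5 * \<delta> \<le> 1" "D0 < 1 - 6 * \<delta>" using D0 by (simp_all add: \<delta>_def field_simps)

  \<comment> \<open>One variable \<open>t\<close> stands for both \<theta> and \<open>r\<close>;
    afterwards \<open>r < \<theta>\<close> is chosen, and monotonicity of \<open>dPsi\<close> allows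
    the smaller radius.\<close>
  have "((\<lambda>t. (dPhi (Psi s G \<beta> p) + t) * ((1 + t) * dPsi s G \<beta> (p * exp t))) \<longlongrightarrow>
      (dPhi (Psi s G \<beta> p) + 0) * ((1 + 0) * dPsi s G \<beta> (p * exp 0))) (at_right 0)"
    by (intro tendsto_intros isCont_tendsto_compose[OF isCont_dPsi])
  then have "\<forall>\<^sub>F t in at_right 0. (dPhi (Psi s G \<beta> p) + t) * ((1 + t) * dPsi s G \<beta> (p * exp t)) < 1 - 6 * \<delta>"
    by (rule order_tendstoD(2)) (use \<delta> in \<open>simp add: D0_def\<close>)
  then obtain \<theta> where \<theta>: "0 < \<theta>"
    "(dPhi (Psi s G \<beta> p) + \<theta>) * ((1 + \<theta>) * dPsi s G \<beta> (p * exp \<theta>)) < 1 - 6 * \<delta>"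
    by (rule eventually_at_right_obtain)

  have "((\<lambda>t. Psi s G \<beta> (p * exp t)) \<longlongrightarrow> Psi s G \<beta> (p * exp 0)) (at_right 0)"
    "((\<lambda>t. Psi s G \<beta> (p * exp (- t))) \<longlongrightarrow> Psi s G \<beta> (p * exp (- 0))) (at_right 0)"
    by (intro isCont_tendsto_compose[OF isCont_Psi] tendsto_intros)+
  then have "\<forall>\<^sub>F t in at_right 0. Psi s G \<beta> (p * exp t) < Psi s G \<beta> p + \<theta> / 4"
    "\<forall>\<^sub>F t in at_right 0. Psi s G \<beta> p - \<theta> / 4 < Psi s G \<beta> (p * exp (- t))"
    using \<theta>(1) by (simp_all add: order_tendstoD)
  moreover have "\<forall>\<^sub>F t in at_right 0. t < \<theta>"
    by (rule order_tendstoD(2)[OF tendsto_ident_at \<theta>(1)])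
  ultimately have "\<forall>\<^sub>F t in at_right 0. Psi s G \<beta> (p * exp t) < Psi s G \<beta> p + \<theta> / 4 \<and>
      Psi s G \<beta> p - \<theta> / 4 < Psi s G \<beta> (p * exp (- t)) \<and> t < \<theta>"
    by eventually_elim blast
  then obtain r where r: "0 < r" "Psi s G \<beta> (p * exp r) < Psi s G \<beta> p + \<theta> / 4"
    "Psi s G \<beta> p - \<theta> / 4 < Psi s G \<beta> (p * exp (- r))" "r < \<theta>"
    by (rule eventually_at_right_obtain) blast

  have near: "(dPhi (Psi s G \<beta> p) + \<theta>) * ((1 + \<theta>) * dPsi s G \<beta> (p * exp r)) \<le> 1 - 6 * \<delta>"
  proof -
    have "(dPhi (Psi s G \<beta> p) + \<theta>) * ((1 + \<theta>) * dPsi s G \<beta> (p * exp r)) \<le>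
        (dPhi (Psi s G \<beta> p) + \<theta>) * ((1 + \<theta>) * dPsi s G \<beta> (p * exp \<theta>))"
      using \<theta>(1) dPhi_bounds(1)[of "Psi s G \<beta> p"] \<beta> p r(4)
      by (intro mult_left_mono dPsi_mono) auto
    then show ?thesis using \<theta>(2) by linarith
  qed
  show ?thesis
    by (rule that[of \<delta> \<theta> r]) (use \<delta> \<theta> r near in auto)
qed

text \<open>\<open>om\<close> is \<omega> as a function of \<tau>, with \<open>B\<close> for
  \<open>Psi s G \<beta> 1\<close>. The threshold will double as the margin \<eta> of the soft
  maximum, whence \<tau> in the exponents and the condition \<open>\<tau> < r\<close>.\<close>

lemma small_threshold:
  fixes \<theta> r h B :: real and d :: nat and om :: "real \<Rightarrow> real"
  defines "om \<equiv> \<lambda>t. 2 * (2 * t * B + t)"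
  assumes "0 < \<theta>" "0 < r" "0 < h"
  obtains \<tau> :: real where "0 < \<tau>" "\<tau> < 1" "\<tau> < \<theta>" "\<tau> < r" "2 * \<tau> * B < \<theta> / 4" "om \<tau> < 1"
    "(1 + om \<tau>) * exp (d * \<tau>) < 1 + h" "1 - h < (1 - om \<tau>) * exp (- (d * \<tau>))"
proof -
  have om: "(om \<longlongrightarrow> 2 * (2 * 0 * B + 0)) (at_right 0)"
    unfolding om_def by (intro tendsto_intros)
  have 1: "((\<lambda>t::real. (1 + om t) * exp (d * t)) \<longlongrightarrow> (1 + 2 * (2 * 0 * B + 0)) * exp (d * (0::real))) (at_right 0)"
    by (intro tendsto_intros om)
  have 2: "((\<lambda>t::real. (1 - om t) * exp (- (d * t))) \<longlongrightarrow> (1 - 2 * (2 * 0 * B + 0)) * exp (- (d * (0::real)))) (at_right 0)"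
    by (intro tendsto_intros om)
  have 3: "((\<lambda>t. 2 * t * B) \<longlongrightarrow> 2 * 0 * B) (at_right 0)"
    by (intro tendsto_intros)
  have 4: "((\<lambda>t. t) \<longlongrightarrow> 0) (at_right (0::real))"
    by (rule tendsto_ident_at)
  have "\<forall>\<^sub>F t::real in at_right 0. t < 1 \<and> t < \<theta> \<and> t < r \<and> 2 * t * B < \<theta> / 4 \<and> om t < 1 \<and>
    (1 + om t) * exp (d * t) < 1 + h \<and> 1 - h < (1 - om t) * exp (- (d * t))"
    by (intro eventually_conj order_tendstoD(2)[OF 4] order_tendstoD(2)[OF 3] order_tendstoD(2)[OF om]
      order_tendstoD(2)[OF 1] order_tendstoD(1)[OF 2]) (use assms in auto)
  then show ?thesis by (rule eventually_at_right_obtain) (use that in blast)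
qed

text \<open>With \<open>l = sqrt n\<close> both \<open>n\<^sup>2 * exp (- (l * \<tau>))\<close> and
  \<open>l / n\<close> tend to 0. Apart from the size and ratio conditions and the lower bounds on
  \<open>l\<close>, every requirement bounds a constant multiple of such a null sequence or of
  \<open>1 / (n - 2)\<close>.\<close>

lemma eventually_large:
  fixes s :: nat and G :: "nat \<Rightarrow> 'v sgraph" and A K M N \<delta> \<theta> \<tau> g L :: real and l far :: "nat \<Rightarrow> real"
  defines "l \<equiv> \<lambda>n. sqrt (real n)"
  defines "far \<equiv> \<lambda>n. (2 * N * (real n)\<^sup>2 + 1) * exp (- (l n * \<tau>))"
  assumes graph: "\<forall>i\<in>{1..s}. finite_simple_graph (G i)"
    and \<tau>: "0 < \<tau>" and \<delta>: "0 < \<delta>" and \<theta>: "0 < \<theta>"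
  shows "\<forall>\<^sub>F n in sequentially. (\<forall>i\<in>{1..s}. card (verts (G i)) \<le> n) \<and> 3 \<le> n \<and>
      (\<forall>i\<in>{1..s}. edges (G i) \<noteq> {} \<longrightarrow> \<bar>density_ratio (verts (G i)) n - 1\<bar> \<le> \<tau>) \<and>
      max_degree s G \<le> l n \<and> K \<le> l n \<and> l n * (A / (real n - 2)) \<le> 1 / 4 \<and>
      g / (real n - 2) \<le> \<theta> / 2 \<and> far n \<le> 1 \<and> K * (M * far n) \<le> \<delta> \<and>
      6 * K * l n * (A / (real n - 2)) * A \<le> \<delta> \<and>
      3 * K * (A / (real n - 2)) \<le> \<delta> \<and> 9 * K * (A / (real n - 2)) * L \<le> \<delta>"
proof -
  have far0: "far \<longlonglongrightarrow> 0" unfolding far_def l_def using \<tau> by real_asymp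
  have sq: "filterlim l at_top sequentially" unfolding l_def by real_asymp
  have inv: "(\<lambda>n. 1 / (real n - 2)) \<longlonglongrightarrow> 0" by real_asymp
  have sqinv: "(\<lambda>n. l n / (real n - 2)) \<longlonglongrightarrow> 0" unfolding l_def by real_asymp
  have small: "\<forall>\<^sub>F n in sequentially. u n \<le> d"
    if "\<phi> \<longlonglongrightarrow> 0" "0 < d" "\<And>n. u n = c * \<phi> n" for c d :: real and u \<phi>
  proof -
    have "u \<longlonglongrightarrow> c * 0" unfolding that(3) by (intro tendsto_intros that(1))
    then have "\<forall>\<^sub>F n in sequentially. u n < d"
      by (rule order_tendstoD(2)) (use that(2) in simp)
    then show ?thesis by eventually_elim simp
  qed
  have ratio: "\<forall>\<^sub>F n in sequentially. edges (G i) \<noteq> {} \<longrightarrow> \<bar>density_ratio (verts (G i)) n - 1\<bar> \<le> \<tau>"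
    if i: "i \<in> {1..s}" for i
  proof (cases "edges (G i) = {}")
    case False
    then obtain \<alpha> where \<alpha>: "\<alpha> \<subseteq> verts (G i)" "card \<alpha> = 2" and fin: "finite (verts (G i))"
      using graph i unfolding finite_simple_graph_def by blast
    have "2 \<le> card (verts (G i))" using card_mono[OF fin \<alpha>(1)] \<alpha>(2) by simp
    then have "(\<lambda>n. density_ratio (verts (G i)) n) \<longlonglongrightarrow> 1" using fin by (rule density_ratio_tendsto)
    from tendstoD[OF this \<tau>] show ?thesis
      by eventually_elim (simp add: dist_real_def)
  qed simp
  show ?thesis
  proof (intro eventually_conj)
    show "\<forall>\<^sub>F n in sequentially. \<forall>i\<in>{1..s}. card (verts (G i)) \<le> n"
      by (rule eventually_ball_finite) (simp_all add: eventually_ge_at_top)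
    show "\<forall>\<^sub>F n in sequentially. 3 \<le> n" by (rule eventually_ge_at_top)
    show "\<forall>\<^sub>F n in sequentially. \<forall>i\<in>{1..s}. edges (G i) \<noteq> {} \<longrightarrow> \<bar>density_ratio (verts (G i)) n - 1\<bar> \<le> \<tau>"
      by (rule eventually_ball_finite) (use ratio in auto)
    show "\<forall>\<^sub>F n in sequentially. max_degree s G \<le> l n" "\<forall>\<^sub>F n in sequentially. K \<le> l n"
      using sq unfolding filterlim_at_top by blast+
    show "\<forall>\<^sub>F n in sequentially. l n * (A / (real n - 2)) \<le> 1 / 4"
      by (rule small[OF sqinv, of _ _ A]) simp_all
    show "\<forall>\<^sub>F n in sequentially. g / (real n - 2) \<le> \<theta> / 2"
      by (rule small[OF inv, of _ _ g]) (use \<theta> in simp_all)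
    show "\<forall>\<^sub>F n in sequentially. far n \<le> 1"
      by (rule small[OF far0, of _ _ 1]) simp_all
    show "\<forall>\<^sub>F n in sequentially. K * (M * far n) \<le> \<delta>"
      by (rule small[OF far0, of _ _ "K * M"]) (use \<delta> in simp_all)
    show "\<forall>\<^sub>F n in sequentially. 6 * K * l n * (A / (real n - 2)) * A \<le> \<delta>"
      by (rule small[OF sqinv, of _ _ "6 * K * A * A"]) (use \<delta> in simp_all)
    show "\<forall>\<^sub>F n in sequentially. 3 * K * (A / (real n - 2)) \<le> \<delta>"
      by (rule small[OF inv, of _ _ "3 * K * A"]) (use \<delta> in simp_all)
    show "\<forall>\<^sub>F n in sequentially. 9 * K * (A / (real n - 2)) * L \<le> \<delta>"
      by (rule small[OF inv, of _ _ "9 * K * A * L"]) (use \<delta> in simp_all)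
  qed
qed

lemma eventually_contracting:
  assumes graph: "\<And>i. i \<in> {1..s} \<Longrightarrow> finite_simple_graph (G i)"
    and \<beta>: "\<And>i. i \<in> {1..s} \<Longrightarrow> \<beta> i > 0"
    and "high_temperature s G \<beta>"
  obtains \<delta> C where "0 < \<delta>" "0 < C"
    "\<forall>\<^sub>F n in sequentially. 3 \<le> n \<and> (\<exists>W. contracting_glauber (complete_edges n) (hamiltonian s G \<beta> n) W \<delta> C)"
proof -
  obtain p where fp: "0 < p" "phi s G \<beta> p = p" "\<And>q. 0 < q \<Longrightarrow> phi s G \<beta> q = q \<Longrightarrow> q = p"
    and deriv: "deriv (phi s G \<beta>) p < 1"
    using assms(3) unfolding high_temperature_def by blast
  obtain \<delta> \<theta> r where \<delta>: "0 < \<delta>" "5 * \<delta> \<le> 1" and \<theta>: "0 < \<theta>" and r: "0 < r"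
    "Psi s G \<beta> (p * exp r) \<le> Psi s G \<beta> p + \<theta> / 4" "Psi s G \<beta> p - \<theta> / 4 \<le> Psi s G \<beta> (p * exp (- r))"
    and near: "(dPhi (Psi s G \<beta> p) + \<theta>) * ((1 + \<theta>) * dPsi s G \<beta> (p * exp r)) \<le> 1 - 6 * \<delta>"
    by (rule subcritical_neighbourhood[of s \<beta> p G]) (use \<beta> fp(1) deriv in blast)+
  obtain c where c: "0 < c" "c \<le> 1" "\<And>u. p * exp r \<le> u \<Longrightarrow> phi s G \<beta> u \<le> (1 - c) * u"
    "\<And>u. 0 < u \<Longrightarrow> u \<le> p * exp (- r) \<Longrightarrow> (1 + c) * u \<le> phi s G \<beta> u"
    by (rule phi_gap[of s \<beta> p G r]) (use \<beta> fp r(1) in blast)+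

  have fixed: "p < u \<Longrightarrow> phi s G \<beta> u < u" "0 < u \<Longrightarrow> u < p \<Longrightarrow> u < phi s G \<beta> u" for u
    by (rule phi_unique_fixed_point[of s \<beta> p G]; use \<beta> fp in blast)+

  \<comment> \<open>Makes \<open>K * c / 2\<close> equal to \<open>2 * dPsi s G \<beta> 1\<close>
    plus \<open>c / 2\<close>, so the outward drift is beaten and \<open>K\<close> is positive even
    if \<open>dPsi\<close> vanishes.\<close>
  define K where "K = 1 + 4 * dPsi s G \<beta> 1 / c"
  have pos: "0 < K" "2 * dPsi s G \<beta> 1 \<le> K * (c / 2)"
    using c(1) dPsi_nonneg[of s \<beta> 1 G] \<beta> by (auto simp: K_def field_simps add_pos_nonneg)
  define h where "h = min (\<delta> / K) (c / 4)"
  have h: "0 < h" "K * h \<le> \<delta>" "h \<le> c / 4"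
    using \<delta>(1) pos(1) c(1) by (auto simp: h_def min_def field_simps)

  obtain \<tau> :: real where tau: "0 < \<tau>" "\<tau> < 1" "\<tau> < \<theta>" "\<tau> < r" "2 * \<tau> * Psi s G \<beta> 1 < \<theta> / 4"
      "2 * (2 * \<tau> * Psi s G \<beta> 1 + \<tau>) < 1"
      "(1 + 2 * (2 * \<tau> * Psi s G \<beta> 1 + \<tau>)) * exp (max_degree s G * \<tau>) < 1 + h"
      "1 - h < (1 - 2 * (2 * \<tau> * Psi s G \<beta> 1 + \<tau>)) * exp (- (max_degree s G * \<tau>))"
    by (rule small_threshold[OF \<theta> r(1) h(1)])
  define C where "C = exp (K * (\<bar>ln p\<bar> + \<bar>ln \<tau>\<bar> + \<tau>))"
  define A where "A = log_slope s G \<tau>"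
  \<comment> \<open>The patterns depend on \<open>s\<close> and \<open>G\<close> only, so
    \<open>N\<close> is fixed before \<open>n\<close>, and the number of indices grows like the
    number of edges.\<close>
  define N where "N = real (card (lyapunov.patterns s G))"
  define M where "M = 1 + 2 / \<tau> ^ max_degree s G"
  have M: "0 < M" using tau(1) by (simp add: M_def add_pos_pos)
  let ?far = "\<lambda>n. (2 * N * (real n)\<^sup>2 + 1) * exp (- (sqrt (real n) * \<tau>))"
  have graph': "\<forall>i\<in>{1..s}. finite_simple_graph (G i)" using graph by blast
  have "\<forall>\<^sub>F n in sequentially. 3 \<le> n \<and> (\<exists>W. contracting_glauber (complete_edges n) (hamiltonian s G \<beta> n) W \<delta> C)"
    using eventually_large[where s = s and G = G and \<tau> = \<tau> and \<delta> = \<delta> and \<theta> = \<theta> and A = A and K = K and M = M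
        and N = N and g = "ergm_size.gradient_const s G \<beta>" and L = "2 * dPsi s G \<beta> 1", OF graph' tau(1) \<delta>(1) \<theta>]
  proof eventually_elim
    case (elim n)
    then have n: "\<And>i. i \<in> {1..s} \<Longrightarrow> card (verts (G i)) \<le> n" "3 \<le> n"
      "\<forall>i\<in>{1..s}. edges (G i) \<noteq> {} \<longrightarrow> \<bar>density_ratio (verts (G i)) n - 1\<bar> \<le> \<tau>"
      "max_degree s G \<le> sqrt n" "K \<le> sqrt n" "sqrt n * (A / (real n - 2)) \<le> 1 / 4"
      "ergm_size.gradient_const s G \<beta> / (real n - 2) \<le> \<theta> / 2" "?far n \<le> 1" "K * (M * ?far n) \<le> \<delta>"
      "6 * K * sqrt n * (A / (real n - 2)) * A \<le> \<delta>" "3 * K * (A / (real n - 2)) \<le> \<delta>"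
      "9 * K * (A / (real n - 2)) * (2 * dPsi s G \<beta> 1) \<le> \<delta>"
      by blast+
    interpret lyapunov s G \<beta> n \<tau> p "sqrt n" K
      by unfold_locales
        (use graph \<beta> n(1,2) tau(1,2) fp(1) pos(1) n(4-6) in \<open>simp_all add: A_def\<close>)
    have eps: "\<epsilon> = A / (real n - 2)" by (simp add: \<epsilon>_def A_def)
    have far: "(card indices + 1) * exp (- (sqrt n * \<tau>)) \<le> ?far n"
    proof (rule mult_right_mono)
      have "card CE \<le> n\<^sup>2"
        unfolding card_complete_edges using n(2) by (intro binomial_le_pow) simp
      then have "real (card CE) \<le> (real n)\<^sup>2" by (metis of_nat_le_iff of_nat_power)
      then have "2 * N * real (card CE) \<le> 2 * N * (real n)\<^sup>2"
        by (intro mult_left_mono) (simp_all add: N_def)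
      then show "real (card indices + 1) \<le> 2 * N * (real n)\<^sup>2 + 1"
        by (simp add: card_indices N_def)
    qed simp
    have "K * (M * ((card indices + 1) * exp (- (sqrt n * \<tau>)))) \<le> K * (M * ?far n)"
      by (intro mult_left_mono far) (use pos(1) M in simp_all)
    then have far': "K * ((1 + 2 / \<tau> ^ max_degree s G) * ((card indices + 1) * exp (- (sqrt n * \<tau>)))) \<le> \<delta>"
      using n(9) unfolding M_def by linarith
    have "contracting_glauber CE (hamiltonian s G \<beta> n) W \<delta> C"
    proof unfold_locales
      show "rate a x \<le> rate a (insert e x)" if "a \<in> CE" for a e x by (rule rate_mono[OF that])
      show "0 < \<delta>" "\<delta> \<le> 1" using \<delta> by auto
      show "1 \<le> W x" for x by (rule W_ge_1)
      show "W x \<le> C" for x unfolding C_def by (rule W_le) (use far n(8) in linarith)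
      show "(\<Sum>a\<in>CE - {e}. upd a W x - W x) +
         (\<Sum>a\<in>CE - {e}. (rate a (insert e x) - rate a x) * W (insert e x - {a})) \<le> (1 - \<delta>) * W x"
        if e: "e \<in> CE" and x: "x \<subseteq> CE - {e}" for e x
      proof (rule W_contraction[where c = c and h = h and \<eta> = \<tau> and r = r and \<theta> = \<theta>])
        show "phi s G \<beta> u \<le> u" if "p \<le> u" for u
          using fixed(1)[of u] fp(2) that by (cases "u = p") auto
        show "u \<le> phi s G \<beta> u" if "0 < u" "u \<le> p" for u
          using fixed(2)[of u] fp(2) that by (cases "u = p") auto
        show "6 * K * sqrt n * \<epsilon> * log_slope s G \<tau> \<le> \<delta>" "3 * K * \<epsilon> \<le> \<delta>"
          "9 * K * \<epsilon> * (2 * dPsi s G \<beta> 1) \<le> \<delta>"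
          using n(10-12) unfolding eps A_def by simp_all
        show "(1 + \<omega>) * exp (max_degree s G * \<tau>) \<le> 1 + h" "\<omega> \<le> 1"
          "1 - h \<le> (1 - \<omega>) * exp (- (max_degree s G * \<tau>))"
          unfolding \<omega>_def using tau(6-8) by linarith+
        show "ratio_close \<tau>" unfolding ratio_close_def by (rule n(3))
      qed (fact c near r pos(2) \<delta> e x far' n(7) \<theta> h(2,3) |
          rule less_imp_le, fact tau h(1) | fact c(3) c(4))+
    qed
    then show ?case using n(2) by blast
  qed
  moreover have "0 < C" by (simp add: C_def)
  ultimately show ?thesis using that \<delta>(1) by blast
qed

theorem theorem1:
  fixes s :: nat and G :: "nat \<Rightarrow> 'v sgraph" and \<beta> :: "nat \<Rightarrow> real"
  assumes "s \<ge> 1"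
    and "\<And>i. i \<in> {1..s} \<Longrightarrow> finite_simple_graph (G i)"
    and "\<And>i. i \<in> {1..s} \<Longrightarrow> \<beta> i > 0"
    and "high_temperature s G \<beta>"
  shows "\<exists>c>0. \<forall>\<^sub>F n in sequentially.
    \<forall>(v :: nat set \<Rightarrow> real) (f :: nat set set \<Rightarrow> real) (t :: real).
      (\<forall>e\<in>complete_edges n. v e \<ge> 0) \<longrightarrow> f \<in> Lip n v \<longrightarrow> t \<ge> 0 \<longrightarrow>
      \<P>(x in ergm s G \<beta> n. \<bar>f x - (\<integral>y. f y \<partial>ergm s G \<beta> n)\<bar> > t)
        \<le> 2 * exp (- (c * t\<^sup>2 / (norm_1 n v * norm_inf n v)))"
proof -
  obtain \<delta> C where pos: "0 < \<delta>" "0 < C" and ev: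
    "\<forall>\<^sub>F n in sequentially. 3 \<le> n \<and> (\<exists>W. contracting_glauber (complete_edges n) (hamiltonian s G \<beta> n) W \<delta> C)"
    by (rule eventually_contracting[of s G \<beta>]) (use assms(2-4) in blast)+
  show ?thesis
  proof (intro exI[of _ "\<delta> / (2 * C)"] conjI)
    show "0 < \<delta> / (2 * C)" using pos by simp
    show "\<forall>\<^sub>F n in sequentially.
      \<forall>(v :: nat set \<Rightarrow> real) (f :: nat set set \<Rightarrow> real) (t :: real).
        (\<forall>e\<in>complete_edges n. v e \<ge> 0) \<longrightarrow> f \<in> Lip n v \<longrightarrow> t \<ge> 0 \<longrightarrow>
        \<P>(x in ergm s G \<beta> n. \<bar>f x - (\<integral>y. f y \<partial>ergm s G \<beta> n)\<bar> > t)
          \<le> 2 * exp (- (\<delta> / (2 * C) * t\<^sup>2 / (norm_1 n v * norm_inf n v)))"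
      using ev
    proof eventually_elim
      case (elim n)
      then obtain W where n: "3 \<le> n" and "contracting_glauber (complete_edges n) (hamiltonian s G \<beta> n) W \<delta> C"
        by blast
      then interpret contracting_glauber "complete_edges n" "hamiltonian s G \<beta> n" W \<delta> C by simp
      show ?case
      proof (intro allI impI)
        fix v :: "nat set \<Rightarrow> real" and f :: "nat set set \<Rightarrow> real" and t :: real
        assume f: "f \<in> Lip n v" and t: "0 \<le> t"
        have vmax: "v e \<le> norm_inf n v" if "e \<in> complete_edges n" for e
          unfolding norm_inf_def using that by (intro Max_ge) auto
        show "\<P>(x in ergm s G \<beta> n. \<bar>f x - (\<integral>y. f y \<partial>ergm s G \<beta> n)\<bar> > t)
          \<le> 2 * exp (- (\<delta> / (2 * C) * t\<^sup>2 / (norm_1 n v * norm_inf n v)))"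
        proof (cases "0 < norm_1 n v * norm_inf n v")
          case True
          then have "0 < norm_inf n v * (\<Sum>e\<in>complete_edges n. v e)"
            by (simp add: norm_1_def mult.commute)
          from concentration[OF Lip_flip[OF f] vmax t this] show ?thesis
            unfolding prob_ergm[OF n] norm_1_def by (simp only: mult.commute[of "norm_inf n v"])
        next
          \<comment> \<open>Typically the zero vector: division by 0 yields 0, so the right-hand
            side is at least 2 and the claim is trivial.\<close>
          case False
          have "\<P>(x in ergm s G \<beta> n. \<bar>f x - (\<integral>y. f y \<partial>ergm s G \<beta> n)\<bar> > t) \<le> 1"
            by (rule prob_space.prob_le_1[OF prob_space_ergm])
          moreover have "\<delta> / (2 * C) * t\<^sup>2 / (norm_1 n v * norm_inf n v) \<le> 0"
            using False pos by (intro divide_nonneg_nonpos) auto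
          then have "1 \<le> exp (- (\<delta> / (2 * C) * t\<^sup>2 / (norm_1 n v * norm_inf n v)))" by simp
          ultimately show ?thesis by linarith
        qed
      qed
    qed
  qed
qed

end
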